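(* Let $A\in\mathbb{R}^{m\times n}$ ($m\ge n$) have simple singular values $\sigma_1>\cdots>\sigma_n>0$, $b\in\mathbb{R}^m$, and assume that the discrete Picard condition with parameter $\beta>0$ is satisfied (in the sense of the context). Let $\gamma_k=\|A-P_{k+1}B_kQ_k^T\|$, where $P_{k+1},B_k,Q_k$ are generated by $k$-step Lanczos bidiagonalization, and let $\eta_k$ and $\Delta_k$ be as defined in the context. Then for $k=1,2,\dots,n-1$, $$\sigma_{k+1}\le\gamma_k\le\sqrt{1+\eta_k^2}\,\sigma_{k+1},$$ with $$\eta_k\le\begin{cases}\xi_k\frac{|u_{k+1}^Tb|}{|u_k^Tb|}\left(1+\mathcal{O}(\rho^{-2})\right)&\text{for }1\le k\le k_0,\\[2pt]\xi_k\sqrt{k-k_0+1}\left(1+\mathcal{O}(\rho^{-2})\right)&\text{for }k_0<k\le n-1\end{cases}$$ for severely ill-posed problems ($\sigma_j=\mathcal{O}(\rho^{-j})$, $\rho>1$), and $$\eta_k\le\begin{cases}\xi_1\frac{\sigma_1}{\sigma_2}\frac{|u_2^Tb|}{|u_1^Tb|}\sqrt{\frac{1}{2\alpha-1}}&\text{for }k=1,\\[2pt]\xi_k\frac{\sigma_k}{\sigma_{k+1}}\frac{|u_{k+1}^Tb|}{|u_k^Tb|}\sqrt{\frac{k^2}{4\alpha^2-1}+\frac{k}{2\alpha-1}}\,|L_{k_1}^{(k)}(0)|&\text{for }1<k\le k_0,\\[2pt]\xi_k\frac{\sigma_k}{\sigma_{k+1}}\sqrt{\frac{kk_0}{4\alpha^2-1}+\frac{k(k-k_0+1)}{2\alpha-1}}\,|L_{k_1}^{(k)}(0)|&\text{for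 }k_0<k\le n-1\end{cases}$$ for moderately or mildly ill-posed problems with $\sigma_j=\zeta j^{-\alpha}$, $j=1,\dots,n$ ($\zeta>0$, $\alpha>\frac12$). Here $\xi_k=\sqrt{\left(\frac{\|\Delta_k\|}{1+\|\Delta_k\|^2}\right)^2+1}$ if $\|\Delta_k\|<1$, and $\xi_k$ is some number with $\xi_k\le\frac{\sqrt5}{2}$ if $\|\Delta_k\|\ge1$.
   Context: $\|\cdot\|$ is the 2-norm. The SVD of $A$ is $A=U\begin{pmatrix}\Sigma\\ \mathbf{0}\end{pmatrix}V^T$ with $U=(u_1,\dots,u_m)$, $V=(v_1,\dots,v_n)$ orthogonal, $\Sigma=\mathrm{diag}(\sigma_1,\dots,\sigma_n)$; $\Sigma_k=\mathrm{diag}(\sigma_1,\dots,\sigma_k)$. For $k\ge2$, $|L_{k_1}^{(k)}(0)|=\max_{j=1,\dots,k}\prod_{i=1,\,i\ne j}^k\frac{\sigma_i^2}{|\sigma_j^2-\sigma_i^2|}$. Lanczos bidiagonalization: $p_1=b/\|b\|$, $\beta_1q_0=0$; for $j=1,\dots,k$: $r=A^Tp_j-\beta_jq_{j-1}$, $\alpha_j=\|r\|$, $q_j=r/\alpha_j$, $z=Aq_j-\alpha_jp_j$, $\beta_{j+1}=\|z\|$, $p_{j+1}=z/\beta_{j+1}$. $P_{k+1}=(p_1,\dots,p_{k+1})$, $Q_k=(q_1,\dots,q_k)$ have orthonormal columns, and $B_k=P_{k+1}^TAQ_k\in\mathbb{R}^{(k+1)\times k}$ is lower bidiagonal with diagonal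 $\alpha_1,\dots,\alpha_k$ and subdiagonal $\beta_2,\dots,\beta_{k+1}$; $AQ_k=P_{k+1}B_k$. Definition of $\Delta_k\in\mathbb{R}^{(n-k)\times k}$ (all $u_i^Tb\ne0$): let $D=\mathrm{diag}(\sigma_iu_i^Tb)\in\mathbb{R}^{n\times n}$ and let $T_k\in\mathbb{R}^{n\times k}$ have $i$-th row $(1,\sigma_i^2,\dots,\sigma_i^{2k-2})$. Partition $D=\mathrm{diag}(D_1,D_2)$ with $D_1\in\mathbb{R}^{k\times k}$ and $T_k=\begin{pmatrix}T_{k1}\\ T_{k2}\end{pmatrix}$ with $T_{k1}\in\mathbb{R}^{k\times k}$ (nonsingular). Then $\Delta_k=D_2T_{k2}T_{k1}^{-1}D_1^{-1}$. Definition of $\eta_k\ge0$: $\eta_k^2\sigma_{k+1}^2=\|\Sigma_k(I+\Delta_k^T\Delta_k)^{-1}\Delta_k^T\Delta_k\|^2+\|\Sigma_k(I+\Delta_k^T\Delta_k)^{-1}\Delta_k^T\|^2$. Discrete Picard condition and noise model: $b=\hat b+e$ with $|u_i^T\hat b|=\sigma_i^{1+\beta}$, $i=1,\dots,n$, $\beta>0$, and $e$ white noise of level $\eta>0$ (unrelated to $\eta_k$), i.e. $|u_i^Te|\approx\eta$. The transition index $k_0$ is the index at which $|u_{k_0}^T b|\approx|u_{k_0}^T\hat b|>|u_{k_0}^Te|\approx\eta$ and $|u_{k_0+1}^Tb|\approx|u_{k_0+1}^Te|\approx\eta$. These relations are used in the following exact idealized form: $|u_j^Tb|=\sigma_j^{1+\beta}$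 for $j\le k_0$; $|u_j^Tb|=\eta$ for $k_0<j\le n$; $|u_{j+1}^Tb|\le|u_j^Tb|$ for $1\le j\le n-1$; and $|u_{k+1}^Tb|/|u_k^Tb|=(\sigma_{k+1}/\sigma_k)^{1+\beta}$ for $k\le k_0$, $|u_{k+1}^Tb|/|u_k^Tb|=1$ for $k>k_0$. Severe ill-posedness: $\sigma_j=\mathcal{O}(\rho^{-j})$ is meant in the sense that the singular values decay at the geometric rate $\rho^{-1}$: there are constants $0<c\le C$ with $c\,\rho^{-(j-i)}\le\sigma_j/\sigma_i\le C\rho^{-(j-i)}$ for $1\le i\le j\le n$. The expression $1+\mathcal{O}(\rho^{-2})$ denotes a quantity $1+r$ with $|r|\le K\rho^{-2}$ for $\rho\ge\rho_0$, where $K$ and $\rho_0$ depend only on $c,C,\beta$ (not on $k,n$). *)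

theory Defs
  imports Complex_Main
    "Jordan_Normal_Form.Matrix"
    "Jordan_Normal_Form.Gauss_Jordan_Elimination"
begin

(* Matrices have explicit dimensions because the constants hidden in the O-terms must not
   depend on m, n and k.  Sequences such as sigma, u, p, q are indexed from 1,
   whereas rows and columns of matrices are indexed from 0. *)

definition vnorm :: "real vec \<Rightarrow> real" where
  "vnorm v = sqrt (v \<bullet> v)"

definition opnorm :: "real mat \<Rightarrow> real" where
  "opnorm M = (SUP x \<in> {x \<in> carrier_vec (dim_col M). vnorm x \<le> 1}. vnorm (M *\<^sub>v x))"

(* Only meaningful for invertible M. *)
definition minv :: "real mat \<Rightarrow> real mat" where
  "minv M = the (mat_inverse M)"

(* The library's orthogonal_mat does not require the columns to be normalized. *)
definition orthonormal_mat :: "nat \<Rightarrow> real mat \<Rightarrow> bool" where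
  "orthonormal_mat d M \<longleftrightarrow> M \<in> carrier_mat d d \<and>
     transpose_mat M * M = 1\<^sub>m d \<and> M * transpose_mat M = 1\<^sub>m d"

definition is_svd ::
  "nat \<Rightarrow> nat \<Rightarrow> real mat \<Rightarrow> real mat \<Rightarrow> (nat \<Rightarrow> real) \<Rightarrow> real mat \<Rightarrow> bool" where
  "is_svd m n A U \<sigma> V \<longleftrightarrow> A \<in> carrier_mat m n \<and> n \<le> m \<and>
     orthonormal_mat m U \<and> orthonormal_mat n V \<and>
     A = U * (mat_diag n (\<lambda>i. \<sigma> (i + 1)) @\<^sub>r 0\<^sub>m (m - n) n) * transpose_mat V"

definition simple_positive :: "nat \<Rightarrow> (nat \<Rightarrow> real) \<Rightarrow> bool" where
  "simple_positive n \<sigma> \<longleftrightarrow>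
     (\<forall>i\<in>{1..n}. 0 < \<sigma> i) \<and> (\<forall>i\<in>{1..n}. \<forall>j\<in>{1..n}. i < j \<longrightarrow> \<sigma> j < \<sigma> i)"

definition ucoef :: "real mat \<Rightarrow> real vec \<Rightarrow> nat \<Rightarrow> real" where
  "ucoef U b i = col U (i - 1) \<bullet> b"


(* lanczos A b j = (q_j, beta_(j+1), p_(j+1)); the initial values q_0 = 0 and beta_1 = 0
   only serve to make beta_1 q_0 vanish. *)
primrec lanczos :: "real mat \<Rightarrow> real vec \<Rightarrow> nat \<Rightarrow> real vec \<times> real \<times> real vec" where
  "lanczos A b 0 = (0\<^sub>v (dim_col A), 0, (1 / vnorm b) \<cdot>\<^sub>v b)"
| "lanczos A b (Suc j) =
     (let (q, \<beta>, p) = lanczos A b j;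
          r = transpose_mat A *\<^sub>v p - \<beta> \<cdot>\<^sub>v q;
          \<alpha> = vnorm r;
          q' = (1 / \<alpha>) \<cdot>\<^sub>v r;
          z = A *\<^sub>v q' - \<alpha> \<cdot>\<^sub>v p;
          \<beta>' = vnorm z
      in (q', \<beta>', (1 / \<beta>') \<cdot>\<^sub>v z))"

definition lanczos_q :: "real mat \<Rightarrow> real vec \<Rightarrow> nat \<Rightarrow> real vec" where
  "lanczos_q A b j = fst (lanczos A b j)"

definition lanczos_p :: "real mat \<Rightarrow> real vec \<Rightarrow> nat \<Rightarrow> real vec" where
  "lanczos_p A b j = snd (snd (lanczos A b (j - 1)))"

definition lanczos_Q :: "real mat \<Rightarrow> real vec \<Rightarrow> nat \<Rightarrow> real mat" where
  "lanczos_Q A b k = mat_of_cols (dim_col A) (map (lanczos_q A b) [1..<k + 1])"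

definition lanczos_P :: "real mat \<Rightarrow> real vec \<Rightarrow> nat \<Rightarrow> real mat" where
  "lanczos_P A b k = mat_of_cols (dim_row A) (map (lanczos_p A b) [1..<k + 1])"

definition lanczos_B :: "real mat \<Rightarrow> real vec \<Rightarrow> nat \<Rightarrow> real mat" where
  "lanczos_B A b k = transpose_mat (lanczos_P A b (k + 1)) * A * lanczos_Q A b k"

definition lanczos_gamma :: "real mat \<Rightarrow> real vec \<Rightarrow> nat \<Rightarrow> real" where
  "lanczos_gamma A b k =
     opnorm (A - lanczos_P A b (k + 1) * lanczos_B A b k * transpose_mat (lanczos_Q A b k))"


definition Delta_mat ::
  "nat \<Rightarrow> real mat \<Rightarrow> (nat \<Rightarrow> real) \<Rightarrow> real vec \<Rightarrow> nat \<Rightarrow> real mat" where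
  "Delta_mat n U \<sigma> b k =
     (let D = mat_diag n (\<lambda>i. \<sigma> (i + 1) * ucoef U b (i + 1));
          T = mat n k (\<lambda>(i, j). \<sigma> (i + 1) ^ (2 * j));
          (D\<^sub>1, _, _, D\<^sub>2) = split_block D k k;
          (T\<^sub>1, _, T\<^sub>2, _) = split_block T k k
      in D\<^sub>2 * T\<^sub>2 * minv T\<^sub>1 * minv D\<^sub>1)"

definition eta_num ::
  "nat \<Rightarrow> real mat \<Rightarrow> (nat \<Rightarrow> real) \<Rightarrow> real vec \<Rightarrow> nat \<Rightarrow> real" where
  "eta_num n U \<sigma> b k =
     (let \<Delta> = Delta_mat n U \<sigma> b k;
          S = mat_diag k (\<lambda>i. \<sigma> (i + 1));
          G = minv (1\<^sub>m k + transpose_mat \<Delta> * \<Delta>)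
      in sqrt ((opnorm (S * G * transpose_mat \<Delta> * \<Delta>))\<^sup>2 + (opnorm (S * G * transpose_mat \<Delta>))\<^sup>2)
         / \<sigma> (k + 1))"

(* For k >= 2, the largest absolute value at 0 of the k Lagrange basis polynomials
   for the nodes sigma_1^2, ..., sigma_k^2. *)
definition lagrange_max :: "(nat \<Rightarrow> real) \<Rightarrow> nat \<Rightarrow> real" where
  "lagrange_max \<sigma> k =
     Max ((\<lambda>j. \<Prod>i\<in>{1..k} - {j}. (\<sigma> i)\<^sup>2 / \<bar>(\<sigma> j)\<^sup>2 - (\<sigma> i)\<^sup>2\<bar>) ` {1..k})"


definition discrete_picard ::
  "nat \<Rightarrow> nat \<Rightarrow> real mat \<Rightarrow> (nat \<Rightarrow> real) \<Rightarrow> real \<Rightarrow> real vec \<Rightarrow> bool" where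
  "discrete_picard m n U \<sigma> \<beta> bhat \<longleftrightarrow> bhat \<in> carrier_vec m \<and>
     (\<forall>i\<in>{1..n}. \<bar>ucoef U bhat i\<bar> = \<sigma> i powr (1 + \<beta>))"

(* The relations for noise of level eta with transition index k0, stated as exact equalities. *)
definition noise_model ::
  "nat \<Rightarrow> real mat \<Rightarrow> (nat \<Rightarrow> real) \<Rightarrow> real \<Rightarrow> real vec \<Rightarrow> real \<Rightarrow> nat \<Rightarrow> bool" where
  "noise_model n U \<sigma> \<beta> b \<eta> k0 \<longleftrightarrow> 0 < \<eta> \<and> 1 \<le> k0 \<and> k0 < n \<and>
     (\<forall>j\<in>{1..k0}. \<bar>ucoef U b j\<bar> = \<sigma> j powr (1 + \<beta>)) \<and>
     (\<forall>j\<in>{k0<..n}. \<bar>ucoef U b j\<bar> = \<eta>) \<and>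
     (\<forall>j\<in>{1..<n}. \<bar>ucoef U b (j + 1)\<bar> \<le> \<bar>ucoef U b j\<bar>) \<and>
     (\<forall>k\<in>{1..<n}. \<bar>ucoef U b (k + 1)\<bar> / \<bar>ucoef U b k\<bar> =
        (if k \<le> k0 then (\<sigma> (k + 1) / \<sigma> k) powr (1 + \<beta>) else 1))"

definition severely_ill_posed ::
  "real \<Rightarrow> real \<Rightarrow> real \<Rightarrow> nat \<Rightarrow> (nat \<Rightarrow> real) \<Rightarrow> bool" where
  "severely_ill_posed c C \<rho> n \<sigma> \<longleftrightarrow>
     (\<forall>i j. 1 \<le> i \<and> i \<le> j \<and> j \<le> n \<longrightarrow>
        c / \<rho> ^ (j - i) \<le> \<sigma> j / \<sigma> i \<and> \<sigma> j / \<sigma> i \<le> C / \<rho> ^ (j - i))"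

definition polynomially_ill_posed ::
  "real \<Rightarrow> real \<Rightarrow> nat \<Rightarrow> (nat \<Rightarrow> real) \<Rightarrow> bool" where
  "polynomially_ill_posed \<zeta> \<alpha> n \<sigma> \<longleftrightarrow> (\<forall>j\<in>{1..n}. \<sigma> j = \<zeta> * real j powr (- \<alpha>))"

end

theory Submission
  imports Defs "Jordan_Normal_Form.Determinant"
begin

text \<open>Write \<open>c i\<close> for the coordinate of a vector along the right singular vector \<open>v i\<close>. In these
coordinates the Krylov space \<open>K\<close> of \<open>A\<^sup>T A\<close> and \<open>A\<^sup>T b\<close> of order \<open>k\<close> consists of the vectors with
\<open>c i = \<sigma> i * (u i \<bullet> b) * g ((\<sigma> i)\<^sup>2)\<close> for a polynomial \<open>g\<close> of degree less than \<open>k\<close>. Interpolating \<open>g\<close>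
at the first \<open>k\<close> nodes \<open>(\<sigma> i)\<^sup>2\<close> shows that \<open>K\<close> is the graph of \<open>\<Delta> = \<Delta>\<^sub>k\<close>: the last \<open>n - k\<close>
coordinates are \<open>\<Delta>\<close> applied to the first \<open>k\<close>, and the entries of \<open>\<Delta>\<close> are values of Lagrange basis
polynomials, weighted by the coefficients of \<open>b\<close>.

Lanczos bidiagonalization gives \<open>P B Q\<^sup>T = A Q Q\<^sup>T\<close>, and \<open>Q Q\<^sup>T\<close> is the orthogonal projector onto \<open>K\<close>;
hence \<open>\<gamma>\<^sub>k = \<parallel>A (1 - Q Q\<^sup>T)\<parallel>\<close>. The lower bound (\<open>sigma_le_gamma\<close>) is the usual rank argument: some
nonzero combination of \<open>v 1, \<dots>, v (k + 1)\<close> is orthogonal to all columns of \<open>Q\<close>, and \<open>A\<close> stretches it by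
at least \<open>\<sigma> (k + 1)\<close>. For the upper bound (\<open>gamma_le\<close>) the residual \<open>y\<close> of a vector \<open>x\<close> is
orthogonal to the graph of \<open>\<Delta>\<close> while \<open>x - y\<close> lies on it. Solving these two relations for the first
\<open>k\<close> coordinates of \<open>y\<close> gives \<open>G \<Delta>\<^sup>T \<Delta> x\<^sub>1 - G \<Delta>\<^sup>T x\<^sub>2\<close> with \<open>G = (1 + \<Delta>\<^sup>T \<Delta>)\<^sup>-\<^sup>1\<close>, which contributes
\<open>(\<eta>\<^sub>k \<sigma> (k + 1))\<^sup>2\<close> to \<open>\<gamma>\<^sub>k\<^sup>2\<close>. The remaining coordinates are multiplied by at most \<open>\<sigma> (k + 1)\<close>.

For \<open>\<eta>\<^sub>k\<close> itself, both blocks factor through \<open>\<Sigma>\<^sub>k \<Delta>\<^sup>T\<close>: the one without the trailing \<open>\<Delta>\<close> is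
\<open>\<Sigma>\<^sub>k \<Delta>\<^sup>T\<close> times a contraction, and the other one carries the extra factor
\<open>\<Delta> G\<close>, whose norm is at most \<open>d / (1 + d\<^sup>2)\<close> if \<open>d = \<parallel>\<Delta>\<parallel> < 1\<close> and at most \<open>1 / 2\<close> always. This is
the origin of \<open>\<xi>\<^sub>k\<close>. Finally \<open>\<Sigma>\<^sub>k \<Delta>\<^sup>T\<close> is dominated entrywise by a matrix of rank one, because a
Lagrange polynomial has its largest absolute value at \<open>0\<close> among the points of \<open>[0, (\<sigma> k)\<^sup>2]\<close>. So (\<open>eta_le_energy\<close>) everything is
reduced to the product of a sum over the tail \<open>j > k\<close> and a sum over \<open>i \<le> k\<close>. For geometrically decaying
singular values both sums are dominated by one term up to a factor \<open>1 + O(\<rho>\<^sup>-\<^sup>2)\<close> (\<open>eta_severe\<close>); for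
\<open>\<sigma> j = \<zeta> * j powr - \<alpha>\<close> they are compared with integrals of powers (\<open>eta_poly\<close>).\<close>

section \<open>Euclidean and operator norms\<close>

lemma Cauchy_Schwarz_sum:
  fixes a b :: "'i \<Rightarrow> real"
  shows "(\<Sum>i\<in>I. a i * b i)\<^sup>2 \<le> (\<Sum>i\<in>I. (a i)\<^sup>2) * (\<Sum>i\<in>I. (b i)\<^sup>2)"
proof -
  have "0 \<le> (\<Sum>i\<in>I. \<Sum>j\<in>I. (a i * b j - a j * b i)\<^sup>2)"
    by (intro sum_nonneg) auto
  also have "\<dots> = (\<Sum>i\<in>I. \<Sum>j\<in>I. (a i)\<^sup>2 * (b j)\<^sup>2 + (b i)\<^sup>2 * (a j)\<^sup>2 - 2 * ((a i * b i) * (a j * b j)))"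
    by (intro sum.cong refl) (simp add: power2_eq_square algebra_simps)
  also have "\<dots> = 2 * ((\<Sum>i\<in>I. (a i)\<^sup>2) * (\<Sum>i\<in>I. (b i)\<^sup>2)) - 2 * (\<Sum>i\<in>I. a i * b i)\<^sup>2"
    by (simp add: sum.distrib sum_subtractf sum_distrib_left[symmetric] sum_distrib_right[symmetric]
        power2_eq_square mult.commute)
  finally show ?thesis by simp
qed

lemma scalar_prod_self: "(v :: real vec) \<bullet> v = (\<Sum>i<dim_vec v. (v $ i)\<^sup>2)"
  by (simp add: scalar_prod_def power2_eq_square atLeast0LessThan)

lemma scalar_prod_self_nonneg: "0 \<le> (v :: real vec) \<bullet> v"
  by (simp add: scalar_prod_self sum_nonneg)

lemma vnorm_power2: "(vnorm v)\<^sup>2 = v \<bullet> v"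
  by (simp add: vnorm_def scalar_prod_self_nonneg)

lemma vnorm_power2_sum: "(vnorm v)\<^sup>2 = (\<Sum>i<dim_vec v. (v $ i)\<^sup>2)"
  by (simp add: vnorm_power2 scalar_prod_self)

lemma vnorm_nonneg: "0 \<le> vnorm v"
  by (simp add: vnorm_def scalar_prod_self_nonneg)

lemma vnorm_le_iff: "0 \<le> a \<Longrightarrow> vnorm v \<le> a \<longleftrightarrow> v \<bullet> v \<le> a\<^sup>2"
  by (simp add: vnorm_power2[symmetric] abs_le_square_iff[symmetric] vnorm_nonneg)

lemma vnorm_zero [simp]: "vnorm (0\<^sub>v n) = 0"
  by (simp add: vnorm_def)

lemma vnorm_eq_0_iff: "v \<in> carrier_vec n \<Longrightarrow> vnorm v = 0 \<longleftrightarrow> v = 0\<^sub>v n"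
  by (auto simp: vnorm_def scalar_prod_self sum_nonneg_eq_0_iff)

lemma vnorm_smult: "vnorm (a \<cdot>\<^sub>v v) = \<bar>a\<bar> * vnorm v"
proof -
  have "(a \<cdot>\<^sub>v v) \<bullet> (a \<cdot>\<^sub>v v) = a\<^sup>2 * (v \<bullet> v)"
    by (simp add: scalar_prod_self power_mult_distrib sum_distrib_left)
  thus ?thesis by (simp add: vnorm_def real_sqrt_mult)
qed

lemma scalar_prod_le_vnorm:
  assumes "v \<in> carrier_vec n" "w \<in> carrier_vec n"
  shows "\<bar>v \<bullet> w\<bar> \<le> vnorm v * vnorm w"
proof -
  have "(v \<bullet> w)\<^sup>2 \<le> (vnorm v * vnorm w)\<^sup>2"
    using Cauchy_Schwarz_sum[of "\<lambda>i. v $ i" "\<lambda>i. w $ i" "{..<n}"] assms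
    by (simp add: power_mult_distrib vnorm_power2_sum scalar_prod_def atLeast0LessThan)
  thus ?thesis
    using power2_le_imp_le[of "\<bar>v \<bullet> w\<bar>" "vnorm v * vnorm w"] by (simp add: vnorm_nonneg)
qed

lemma vnorm_triangle_diff:
  assumes "v \<in> carrier_vec n" "w \<in> carrier_vec n"
  shows "vnorm (v - w) \<le> vnorm v + vnorm w"
proof -
  have "(v - w) \<bullet> (v - w) = v \<bullet> v - 2 * (v \<bullet> w) + w \<bullet> w"
    using assms by (simp add: minus_scalar_prod_distrib[of _ n] scalar_prod_minus_distrib[of _ n]
        comm_scalar_prod[of w n v])
  moreover have "- (v \<bullet> w) \<le> vnorm v * vnorm w" using scalar_prod_le_vnorm[OF assms] by simp
  ultimately show ?thesis
    by (subst vnorm_le_iff) (auto simp: vnorm_nonneg power2_sum vnorm_power2)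
qed

text \<open>Entrywise domination by \<open>g h\<^sup>T\<close> bounds the operator norm by the Frobenius norm of \<open>g h\<^sup>T\<close>. This is
used twice: with a crude choice of \<open>g\<close> it makes every operator norm finite, and with the sharp
choice it gives the bound for \<open>\<Sigma>\<^sub>k \<Delta>\<^sup>T\<close>.\<close>

lemma vnorm_mult_vec_rank_one:
  assumes M: "M \<in> carrier_mat r c"
    and entry: "\<And>i j. i < r \<Longrightarrow> j < c \<Longrightarrow> \<bar>M $$ (i, j)\<bar> \<le> g i * h j"
    and v: "v \<in> carrier_vec c"
  shows "vnorm (M *\<^sub>v v) \<le> sqrt ((\<Sum>i<r. (g i)\<^sup>2) * (\<Sum>j<c. (h j)\<^sup>2)) * vnorm v"
proof -
  have row: "((M *\<^sub>v v) $ i)\<^sup>2 \<le> (g i)\<^sup>2 * ((\<Sum>j<c. (h j)\<^sup>2) * (vnorm v)\<^sup>2)" if i: "i < r" for i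
  proof -
    have "\<bar>(M *\<^sub>v v) $ i\<bar> = \<bar>\<Sum>j<c. M $$ (i, j) * v $ j\<bar>"
      using M v i by (simp add: scalar_prod_def atLeast0LessThan)
    also have "\<dots> \<le> (\<Sum>j<c. \<bar>M $$ (i, j)\<bar> * \<bar>v $ j\<bar>)"
      by (rule order_trans[OF sum_abs]) (simp add: abs_mult)
    also have "\<dots> \<le> (\<Sum>j<c. g i * h j * \<bar>v $ j\<bar>)"
      by (intro sum_mono mult_right_mono) (use entry i in auto)
    also have "\<dots> = g i * (\<Sum>j<c. h j * \<bar>v $ j\<bar>)"
      by (simp add: sum_distrib_left mult.assoc)
    finally have "\<bar>(M *\<^sub>v v) $ i\<bar>\<^sup>2 \<le> (g i * (\<Sum>j<c. h j * \<bar>v $ j\<bar>))\<^sup>2"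
      by (intro power_mono) auto
    also have "\<dots> \<le> (g i)\<^sup>2 * ((\<Sum>j<c. (h j)\<^sup>2) * (\<Sum>j<c. \<bar>v $ j\<bar>\<^sup>2))"
      unfolding power_mult_distrib by (intro mult_left_mono Cauchy_Schwarz_sum) auto
    finally show ?thesis using v by (simp add: vnorm_power2_sum)
  qed
  have "(vnorm (M *\<^sub>v v))\<^sup>2 = (\<Sum>i<r. ((M *\<^sub>v v) $ i)\<^sup>2)"
    using M by (simp add: vnorm_power2_sum)
  also have "\<dots> \<le> (\<Sum>i<r. (g i)\<^sup>2 * ((\<Sum>j<c. (h j)\<^sup>2) * (vnorm v)\<^sup>2))"
    by (intro sum_mono row) auto
  also have "\<dots> = (sqrt ((\<Sum>i<r. (g i)\<^sup>2) * (\<Sum>j<c. (h j)\<^sup>2)) * vnorm v)\<^sup>2"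
    by (simp add: power_mult_distrib sum_distrib_right[symmetric] sum_nonneg)
  finally show ?thesis by (rule power2_le_imp_le) (simp add: vnorm_nonneg sum_nonneg)
qed

text \<open>The supremum in the definition of the operator norm is taken over the reals, where it carries
information only because the set is bounded.\<close>

lemma opnorm_image_bdd_above:
  "bdd_above ((\<lambda>x. vnorm (M *\<^sub>v x)) ` {x \<in> carrier_vec (dim_col M). vnorm x \<le> 1})"
proof -
  define g where "g i = (\<Sum>j<dim_col M. \<bar>M $$ (i, j)\<bar>)" for i
  define F where "F = sqrt ((\<Sum>i<dim_row M. (g i)\<^sup>2) * (\<Sum>j<dim_col M. 1\<^sup>2))"
  have F0: "0 \<le> F" by (simp add: F_def sum_nonneg)
  have "vnorm (M *\<^sub>v x) \<le> F" if x: "x \<in> carrier_vec (dim_col M)" "vnorm x \<le> 1" for x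
  proof -
    have "vnorm (M *\<^sub>v x) \<le> F * vnorm x"
      unfolding F_def
    proof (rule vnorm_mult_vec_rank_one)
      fix i j assume "i < dim_row M" "j < dim_col M"
      thus "\<bar>M $$ (i, j)\<bar> \<le> g i * 1" unfolding g_def
        using member_le_sum[of j "{..<dim_col M}" "\<lambda>j. \<bar>M $$ (i, j)\<bar>"] by simp
    qed (use x in auto)
    also have "\<dots> \<le> F" using mult_left_mono[OF x(2) F0] by simp
    finally show ?thesis .
  qed
  thus ?thesis by (intro bdd_aboveI2) auto
qed

lemma opnorm_leI:
  assumes "\<And>x. x \<in> carrier_vec (dim_col M) \<Longrightarrow> vnorm x \<le> 1 \<Longrightarrow> vnorm (M *\<^sub>v x) \<le> a"
  shows "opnorm M \<le> a"
  unfolding opnorm_def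
proof (rule cSUP_least)
  have "0\<^sub>v (dim_col M) \<in> {x \<in> carrier_vec (dim_col M). vnorm x \<le> 1}" by simp
  thus "{x \<in> carrier_vec (dim_col M). vnorm x \<le> 1} \<noteq> {}" by blast
qed (use assms in auto)

lemma vnorm_le_opnorm:
  assumes x: "x \<in> carrier_vec (dim_col M)" "vnorm x \<le> 1"
  shows "vnorm (M *\<^sub>v x) \<le> opnorm M"
  unfolding opnorm_def by (rule cSUP_upper[OF _ opnorm_image_bdd_above]) (use x in simp)

lemma opnorm_nonneg: "0 \<le> opnorm M"
  using vnorm_le_opnorm[of "0\<^sub>v (dim_col M)" M] vnorm_nonneg[of "M *\<^sub>v 0\<^sub>v (dim_col M)"]
  by simp

lemma vnorm_mult_vec_le_opnorm:
  assumes x: "x \<in> carrier_vec (dim_col M)"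
  shows "vnorm (M *\<^sub>v x) \<le> opnorm M * vnorm x"
proof (cases "vnorm x = 0")
  case True
  hence "x = 0\<^sub>v (dim_col M)" using vnorm_eq_0_iff[OF x] by simp
  moreover have "M *\<^sub>v 0\<^sub>v (dim_col M) = 0\<^sub>v (dim_row M)" by (intro eq_vecI) auto
  ultimately show ?thesis by simp
next
  case False
  hence pos: "0 < vnorm x" using vnorm_nonneg[of x] by simp
  let ?y = "(1 / vnorm x) \<cdot>\<^sub>v x"
  have "vnorm (M *\<^sub>v ?y) \<le> opnorm M"
    by (rule vnorm_le_opnorm) (use x pos in \<open>auto simp: vnorm_smult\<close>)
  also have "M *\<^sub>v ?y = (1 / vnorm x) \<cdot>\<^sub>v (M *\<^sub>v x)"
    using x by (subst mult_mat_vec[of _ "dim_row M" "dim_col M"]) auto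
  finally show ?thesis using pos by (simp add: vnorm_smult field_simps)
qed

section \<open>Inverses and kernels\<close>

lemma minv_eqI:
  assumes A: "A \<in> carrier_mat d d" and B: "B \<in> carrier_mat d d" and AB: "A * B = 1\<^sub>m d"
  shows "minv A = B"
proof -
  have BA: "B * A = 1\<^sub>m d" by (rule mat_mult_left_right_inverse[OF A B AB])
  have "A \<in> Units (ring_mat TYPE(real) d ())"
    unfolding Units_def using A B AB BA by (auto simp: ring_mat_def)
  then obtain C where C: "mat_inverse A = Some C"
    using mat_inverse(1)[OF A, where b = "()"] by (cases "mat_inverse A") auto
  have C': "C * A = 1\<^sub>m d" "C \<in> carrier_mat d d" using mat_inverse(2)[OF A C] by auto
  have "C = C * (A * B)" using AB C' by simp
  also have "\<dots> = B" using C' A B by (subst assoc_mult_mat[symmetric]) auto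
  finally show ?thesis using C by (simp add: minv_def)
qed

text \<open>A kernel vector \<open>v\<close> of \<open>1 + D\<^sup>T D\<close> satisfies \<open>0 = \<parallel>v\<parallel>\<^sup>2 + \<parallel>D v\<parallel>\<^sup>2\<close>.\<close>

lemma minv_gram_plus_one:
  assumes D: "D \<in> carrier_mat r k"
  defines "H \<equiv> 1\<^sub>m k + transpose_mat D * D"
  shows "minv H \<in> carrier_mat k k" "minv H * H = 1\<^sub>m k" "H * minv H = 1\<^sub>m k"
proof -
  have H: "H \<in> carrier_mat k k" using D by (auto simp: H_def)
  have "det H \<noteq> 0"
  proof
    assume "det H = 0"
    then obtain v where v: "v \<in> carrier_vec k" "v \<noteq> 0\<^sub>v k" "H *\<^sub>v v = 0\<^sub>v k"
      using det_0_iff_vec_prod_zero[OF H] by blast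
    have Dv: "D *\<^sub>v v \<in> carrier_vec r" using D v by simp
    have "0 = (H *\<^sub>v v) \<bullet> v" using v by simp
    also have "H *\<^sub>v v = v + transpose_mat D *\<^sub>v (D *\<^sub>v v)"
      unfolding H_def using D v by (simp add: add_mult_distrib_mat_vec[of _ k k])
    also have "\<dots> \<bullet> v = v \<bullet> v + (D *\<^sub>v v) \<bullet> (D *\<^sub>v v)"
      using D v Dv by (simp add: add_scalar_prod_distrib[of _ k] transpose_vec_mult_scalar[of _ r k])
    finally have "v \<bullet> v \<le> 0" using scalar_prod_self_nonneg[of "D *\<^sub>v v"] by simp
    hence "vnorm v = 0" using scalar_prod_self_nonneg[of v] by (simp add: vnorm_def)
    thus False using v vnorm_eq_0_iff by blast
  qed
  hence "H \<in> Units (ring_mat TYPE(real) k ())" by (rule det_non_zero_imp_unit[OF H])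
  then obtain C where C: "mat_inverse H = Some C"
    using mat_inverse(1)[OF H, where b = "()"] by (cases "mat_inverse H") auto
  hence [simp]: "minv H = C" by (simp add: minv_def)
  show "minv H \<in> carrier_mat k k" "minv H * H = 1\<^sub>m k" "H * minv H = 1\<^sub>m k"
    using mat_inverse(2)[OF H C] by auto
qed

text \<open>Fewer equations than unknowns: a zero row makes the system square and singular.\<close>

lemma exists_nonzero_kernel_vec:
  fixes M :: "real mat"
  assumes M: "M \<in> carrier_mat k (Suc k)"
  obtains v where "v \<in> carrier_vec (Suc k)" "v \<noteq> 0\<^sub>v (Suc k)" "M *\<^sub>v v = 0\<^sub>v k"
proof -
  define N where "N = mat (Suc k) (Suc k) (\<lambda>(i, j). if i < k then M $$ (i, j) else 0)"
  have N: "N \<in> carrier_mat (Suc k) (Suc k)" by (simp add: N_def)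
  have "transpose_mat N *\<^sub>v unit_vec (Suc k) k = 0\<^sub>v (Suc k)"
    by (intro eq_vecI) (auto simp: N_def)
  moreover have "unit_vec (Suc k) k \<noteq> (0\<^sub>v (Suc k) :: real vec)"
    by (metis index_unit_vec(2) index_zero_vec(1) lessI zero_neq_one)
  ultimately have "det (transpose_mat N) = 0"
    using det_0_iff_vec_prod_zero[of "transpose_mat N" "Suc k"] N by (metis transpose_carrier_mat unit_vec_carrier)
  hence "det N = 0" using det_transpose[OF N] by simp
  then obtain v where v: "v \<in> carrier_vec (Suc k)" "v \<noteq> 0\<^sub>v (Suc k)" "N *\<^sub>v v = 0\<^sub>v (Suc k)"
    using det_0_iff_vec_prod_zero[OF N] by blast
  have "M *\<^sub>v v = 0\<^sub>v k"
  proof (intro eq_vecI)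
    fix i assume "i < dim_vec (0\<^sub>v k)"
    hence i: "i < k" by simp
    have "row M i = row N i" using i M by (intro eq_vecI) (auto simp: N_def)
    hence "(M *\<^sub>v v) $ i = (N *\<^sub>v v) $ i" using i M N by simp
    thus "(M *\<^sub>v v) $ i = 0\<^sub>v k $ i" using v i by simp
  qed (use M in auto)
  thus ?thesis using that v by blast
qed

section \<open>Lanczos bidiagonalization\<close>

lemma mult_vec_smult_unit_vec:
  fixes M :: "real mat"
  assumes "M \<in> carrier_mat r c" "i < c"
  shows "M *\<^sub>v (a \<cdot>\<^sub>v unit_vec c i) = a \<cdot>\<^sub>v col M i"
  using assms by (intro eq_vecI) (auto simp: mult.commute)

lemma gram_mult_vec_linear:
  fixes M :: "real mat"
  assumes M: "M \<in> carrier_mat r c" and x: "x \<in> carrier_vec r" and y: "y \<in> carrier_vec r"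
  shows "M *\<^sub>v (transpose_mat M *\<^sub>v (s \<cdot>\<^sub>v x + t \<cdot>\<^sub>v y))
    = s \<cdot>\<^sub>v (M *\<^sub>v (transpose_mat M *\<^sub>v x)) + t \<cdot>\<^sub>v (M *\<^sub>v (transpose_mat M *\<^sub>v y))"
  using M x y by (simp add: mult_add_distrib_mat_vec[of _ c r] mult_add_distrib_mat_vec[of _ r c]
      mult_mat_vec[of _ c r] mult_mat_vec[of _ r c])

text \<open>Zero columns are admitted because the iteration yields zero vectors from a breakdown on; with that,
\<open>M M\<^sup>T\<close> is still the orthogonal projector onto the column space.\<close>

lemma projector_fixes_col:
  fixes M :: "real mat"
  assumes M: "M \<in> carrier_mat r c"
    and orth: "\<And>i j. i < c \<Longrightarrow> j < c \<Longrightarrow> i \<noteq> j \<Longrightarrow> col M i \<bullet> col M j = 0"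
    and norm: "\<And>i. i < c \<Longrightarrow> col M i = 0\<^sub>v r \<or> col M i \<bullet> col M i = 1"
    and i: "i < c"
  shows "M *\<^sub>v (transpose_mat M *\<^sub>v col M i) = col M i"
proof (cases "col M i = 0\<^sub>v r")
  case True
  have "transpose_mat M *\<^sub>v 0\<^sub>v r = 0\<^sub>v c" "M *\<^sub>v 0\<^sub>v c = 0\<^sub>v r"
    using M by (auto intro!: eq_vecI)
  thus ?thesis using True by simp
next
  case False
  hence "transpose_mat M *\<^sub>v col M i = 1 \<cdot>\<^sub>v unit_vec c i"
    using M orth norm i by (intro eq_vecI) (auto simp: unit_vec_def)
  thus ?thesis using mult_vec_smult_unit_vec[OF M i, of 1] by simp
qed

text \<open>Normalizing with \<open>1 / 0 = 0\<close> sends the zero vector to itself, so the first identity also covers a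
vanishing residual, and the recurrences below persist through a breakdown.\<close>

lemma normalized_vec:
  fixes r :: "real vec"
  assumes r: "r \<in> carrier_vec d" and v: "v = (1 / vnorm r) \<cdot>\<^sub>v r"
  shows "vnorm r \<cdot>\<^sub>v v = r" "v \<in> carrier_vec d"
    "vnorm r = 0 \<Longrightarrow> v = 0\<^sub>v d" "vnorm r \<noteq> 0 \<Longrightarrow> v \<bullet> v = 1"
proof -
  show "v \<in> carrier_vec d" using r v by simp
  show z: "v = 0\<^sub>v d" if "vnorm r = 0" using that r v vnorm_eq_0_iff[OF r] by (auto intro!: eq_vecI)
  show "vnorm r \<cdot>\<^sub>v v = r"
  proof (cases "vnorm r = 0")
    case True thus ?thesis using r z vnorm_eq_0_iff[OF r] by (auto intro!: eq_vecI)
  next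
    case False thus ?thesis using v by (simp add: smult_smult_assoc)
  qed
  show "v \<bullet> v = 1" if "vnorm r \<noteq> 0"
    using that r vnorm_nonneg[of r] by (simp add: v vnorm_power2[symmetric] vnorm_smult)
qed

text \<open>The vectors and coefficients are indexed so that one step of the iteration goes from \<open>j\<close> to \<open>Suc j\<close>:
\<open>q j\<close> and \<open>alf j\<close> are \<open>q\<^sub>j\<close> and \<open>\<alpha>\<^sub>j\<close>, but \<open>p j\<close> and \<open>bet j\<close> are \<open>p\<close> and \<open>\<beta>\<close> with index \<open>j + 1\<close>.\<close>

locale bidiagonalization =
  fixes A :: "real mat" and b :: "real vec" and m n :: nat
  assumes A_carrier: "A \<in> carrier_mat m n" and b_carrier: "b \<in> carrier_vec m"
begin

definition q :: "nat \<Rightarrow> real vec" where "q j = lanczos_q A b j"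

definition p :: "nat \<Rightarrow> real vec" where "p j = lanczos_p A b (Suc j)"

definition bet :: "nat \<Rightarrow> real" where "bet j = fst (snd (lanczos A b j))"

definition alf :: "nat \<Rightarrow> real" where
  "alf j = vnorm (transpose_mat A *\<^sub>v p (j - 1) - bet (j - 1) \<cdot>\<^sub>v q (j - 1))"

lemma lanczos_triple: "lanczos A b j = (q j, bet j, p j)"
  by (simp add: q_def bet_def p_def lanczos_q_def lanczos_p_def)

lemma q_0: "q 0 = 0\<^sub>v n" and bet_0: "bet 0 = 0" and p_0: "p 0 = (1 / vnorm b) \<cdot>\<^sub>v b"
  using lanczos_triple[of 0] A_carrier by auto

lemma q_Suc_eq: "q (Suc j) = (1 / alf (Suc j)) \<cdot>\<^sub>v (transpose_mat A *\<^sub>v p j - bet j \<cdot>\<^sub>v q j)"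
  and bet_Suc_eq: "bet (Suc j) = vnorm (A *\<^sub>v q (Suc j) - alf (Suc j) \<cdot>\<^sub>v p j)"
  and p_Suc_eq: "p (Suc j) = (1 / bet (Suc j)) \<cdot>\<^sub>v (A *\<^sub>v q (Suc j) - alf (Suc j) \<cdot>\<^sub>v p j)"
  using lanczos_triple[of "Suc j"] lanczos_triple[of j] by (auto simp: Let_def alf_def)

lemma q_carrier: "q j \<in> carrier_vec n" and p_carrier: "p j \<in> carrier_vec m"
proof (induction j)
  case 0
  show "q 0 \<in> carrier_vec n" "p 0 \<in> carrier_vec m" using b_carrier by (simp_all add: q_0 p_0)
next
  case (Suc j)
  show q: "q (Suc j) \<in> carrier_vec n" using Suc A_carrier by (simp add: q_Suc_eq)
  show "p (Suc j) \<in> carrier_vec m" using Suc q A_carrier by (simp add: p_Suc_eq)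
qed

lemma q_dim [simp]: "dim_vec (q j) = n" and p_dim [simp]: "dim_vec (p j) = m"
  using q_carrier[of j] p_carrier[of j] by auto

lemma Av_carrier: "A *\<^sub>v q j \<in> carrier_vec m" "transpose_mat A *\<^sub>v p j \<in> carrier_vec n"
  using A_carrier q_carrier p_carrier by auto

lemma q_residual_carrier: "transpose_mat A *\<^sub>v p j - bet j \<cdot>\<^sub>v q j \<in> carrier_vec n"
  and p_residual_carrier: "A *\<^sub>v q (Suc j) - alf (Suc j) \<cdot>\<^sub>v p j \<in> carrier_vec m"
  using q_carrier p_carrier Av_carrier by auto

lemma alf_Suc: "alf (Suc j) = vnorm (transpose_mat A *\<^sub>v p j - bet j \<cdot>\<^sub>v q j)"
  by (simp add: alf_def)

lemma At_p: "transpose_mat A *\<^sub>v p j = alf (Suc j) \<cdot>\<^sub>v q (Suc j) + bet j \<cdot>\<^sub>v q j"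
proof -
  have "alf (Suc j) \<cdot>\<^sub>v q (Suc j) = transpose_mat A *\<^sub>v p j - bet j \<cdot>\<^sub>v q j"
    using normalized_vec(1)[OF q_residual_carrier q_Suc_eq[unfolded alf_Suc]] by (simp add: alf_Suc)
  thus ?thesis using A_carrier q_carrier[of j] Av_carrier(2)[of j] by (auto intro!: eq_vecI)
qed

lemma A_q: "A *\<^sub>v q (Suc j) = alf (Suc j) \<cdot>\<^sub>v p j + bet (Suc j) \<cdot>\<^sub>v p (Suc j)"
proof -
  have "bet (Suc j) \<cdot>\<^sub>v p (Suc j) = A *\<^sub>v q (Suc j) - alf (Suc j) \<cdot>\<^sub>v p j"
    using normalized_vec(1)[OF p_residual_carrier p_Suc_eq[unfolded bet_Suc_eq]] by (simp add: bet_Suc_eq)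
  thus ?thesis using A_carrier p_carrier[of j] Av_carrier(1)[of "Suc j"] by (auto intro!: eq_vecI)
qed

lemma q_dichotomy: "alf (Suc j) = 0 \<and> q (Suc j) = 0\<^sub>v n \<or> alf (Suc j) \<noteq> 0 \<and> q (Suc j) \<bullet> q (Suc j) = 1"
  using normalized_vec(3,4)[OF q_residual_carrier q_Suc_eq[unfolded alf_Suc], of j]
  by (auto simp: alf_Suc)

lemma p_dichotomy: "bet (Suc j) = 0 \<and> p (Suc j) = 0\<^sub>v m \<or> bet (Suc j) \<noteq> 0 \<and> p (Suc j) \<bullet> p (Suc j) = 1"
  using normalized_vec(3,4)[OF p_residual_carrier p_Suc_eq[unfolded bet_Suc_eq], of j]
  by (auto simp: bet_Suc_eq)

lemma p_zero_or_unit: "p j = 0\<^sub>v m \<and> bet j = 0 \<or> p j \<bullet> p j = 1"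
proof (cases j)
  case 0 thus ?thesis using normalized_vec(3,4)[OF b_carrier p_0] by (auto simp: bet_0)
next
  case (Suc i) thus ?thesis using p_dichotomy[of i] by auto
qed

lemma q_zero_or_unit: "q j = 0\<^sub>v n \<or> q j \<bullet> q j = 1"
  using q_dichotomy by (cases j) (auto simp: q_0)

text \<open>A zero vector in the iteration forces the next coefficient to vanish. Contrapositively, a nonzero
coefficient certifies that the two vectors next to it are unit vectors, which is what makes the
diagonal terms cancel in the proof of orthogonality.\<close>

lemma bet_nonzero: "bet j \<noteq> 0 \<Longrightarrow> p j \<bullet> p j = 1 \<and> q j \<bullet> q j = 1"
proof (cases j)
  case (Suc i)
  assume nz: "bet j \<noteq> 0"
  have "A *\<^sub>v 0\<^sub>v n - 0 \<cdot>\<^sub>v p i = 0\<^sub>v m" using A_carrier p_carrier[of i] by (auto intro!: eq_vecI)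
  hence "alf j \<noteq> 0" using nz q_dichotomy[of i] by (auto simp: Suc bet_Suc_eq)
  thus ?thesis using nz q_dichotomy[of i] p_dichotomy[of i] by (auto simp: Suc)
qed (simp add: bet_0)

lemma alf_nonzero: "alf (Suc j) \<noteq> 0 \<Longrightarrow> p j \<bullet> p j = 1 \<and> q (Suc j) \<bullet> q (Suc j) = 1"
proof -
  assume nz: "alf (Suc j) \<noteq> 0"
  have "transpose_mat A *\<^sub>v 0\<^sub>v m - 0 \<cdot>\<^sub>v q j = 0\<^sub>v n"
    using A_carrier q_carrier[of j] by (auto intro!: eq_vecI)
  hence "\<not> (p j = 0\<^sub>v m \<and> bet j = 0)" using nz by (auto simp: alf_Suc)
  thus ?thesis using nz q_dichotomy[of j] p_zero_or_unit[of j] by auto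
qed

lemma adjoint:
  assumes "x \<in> carrier_vec n" "y \<in> carrier_vec m"
  shows "(transpose_mat A *\<^sub>v y) \<bullet> x = y \<bullet> (A *\<^sub>v x)"
  by (rule transpose_vec_mult_scalar[OF A_carrier assms])

lemma Aq_inner: "p i \<bullet> (A *\<^sub>v q (Suc j)) = alf (Suc j) * (p i \<bullet> p j) + bet (Suc j) * (p i \<bullet> p (Suc j))"
  unfolding A_q using p_carrier by (simp add: scalar_prod_add_distrib[of _ m])

lemma Atp_inner: "(transpose_mat A *\<^sub>v p i) \<bullet> q j = alf (Suc i) * (q (Suc i) \<bullet> q j) + bet i * (q i \<bullet> q j)"
  unfolding At_p using q_carrier by (simp add: add_scalar_prod_distrib[of _ n])

text \<open>Both families are treated in one induction. By the recurrences for \<open>A\<close> and its adjoint, the inner product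
of a new vector with an old one reduces to inner products of earlier vectors; only the
neighbouring index leaves a difference of two squared norms, which are equal whenever their
coefficient is nonzero.\<close>

lemma lanczos_orthogonal_upto:
  "\<forall>j\<le>N. \<forall>i<j. q i \<bullet> q j = 0 \<and> p i \<bullet> p j = 0"
proof (induction N)
  case (Suc N)
  have pc: "p i \<bullet> p j = p j \<bullet> p i" for i j by (rule comm_scalar_prod[OF p_carrier p_carrier])
  have qc: "q i \<bullet> q j = q j \<bullet> q i" for i j by (rule comm_scalar_prod[OF q_carrier q_carrier])
  have qo: "q i \<bullet> q j = 0" and po: "p i \<bullet> p j = 0" if "i \<le> N" "j \<le> N" "i \<noteq> j" for i j
    using that Suc.IH[rule_format, of j i] Suc.IH[rule_format, of i j] pc[of i j] qc[of i j]
    by (cases "i < j"; simp)+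
  have q_new: "q i \<bullet> q (Suc N) = 0" if i: "i \<le> N" for i
  proof (cases i)
    case 0 thus ?thesis using q_carrier[of "Suc N"] by (simp add: q_0)
  next
    case (Suc l)
    have "alf (Suc N) * (q (Suc N) \<bullet> q i) = (transpose_mat A *\<^sub>v p N) \<bullet> q i - bet N * (q N \<bullet> q i)"
      by (simp add: Atp_inner)
    also have "(transpose_mat A *\<^sub>v p N) \<bullet> q i = alf i * (p N \<bullet> p l) + bet i * (p N \<bullet> p i)"
      by (simp add: adjoint[OF q_carrier p_carrier] Suc Aq_inner)
    also have "p N \<bullet> p l = 0" using po[of N l] i Suc by simp
    also have "alf i * 0 + bet i * (p N \<bullet> p i) - bet N * (q N \<bullet> q i) = 0"
    proof (cases "i = N")
      case True thus ?thesis using bet_nonzero[of N] by (cases "bet N = 0") auto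
    next
      case False thus ?thesis using qo[of N i] po[of N i] i by simp
    qed
    finally have "alf (Suc N) * (q (Suc N) \<bullet> q i) = 0" .
    thus ?thesis using q_dichotomy[of N] qc[of i "Suc N"] q_carrier[of i] by auto
  qed
  have p_new: "p i \<bullet> p (Suc N) = 0" if i: "i \<le> N" for i
  proof -
    have "bet (Suc N) * (p i \<bullet> p (Suc N)) = p i \<bullet> (A *\<^sub>v q (Suc N)) - alf (Suc N) * (p i \<bullet> p N)"
      by (simp add: Aq_inner)
    also have "p i \<bullet> (A *\<^sub>v q (Suc N)) = alf (Suc i) * (q (Suc i) \<bullet> q (Suc N)) + bet i * (q i \<bullet> q (Suc N))"
      by (simp add: adjoint[OF q_carrier p_carrier, symmetric] Atp_inner)
    also have "q i \<bullet> q (Suc N) = 0" using q_new i by simp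
    also have "alf (Suc i) * (q (Suc i) \<bullet> q (Suc N)) + bet i * 0 - alf (Suc N) * (p i \<bullet> p N) = 0"
    proof (cases "i = N")
      case True thus ?thesis using alf_nonzero[of N] by (cases "alf (Suc N) = 0") auto
    next
      case False thus ?thesis using q_new[of "Suc i"] po[of i N] i by simp
    qed
    finally have "bet (Suc N) * (p i \<bullet> p (Suc N)) = 0" .
    thus ?thesis using p_dichotomy[of N] p_carrier[of i] by auto
  qed
  show ?case
  proof (intro allI impI)
    fix j i assume "j \<le> Suc N" "i < j"
    thus "q i \<bullet> q j = 0 \<and> p i \<bullet> p j = 0"
      using Suc.IH[rule_format, of j i] q_new[of i] p_new[of i] by (cases "j = Suc N") simp_all
  qed
qed simp

lemma q_orthogonal: "i \<noteq> j \<Longrightarrow> q i \<bullet> q j = 0"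
  and p_orthogonal: "i \<noteq> j \<Longrightarrow> p i \<bullet> p j = 0"
  using lanczos_orthogonal_upto[of j, rule_format, of j i] lanczos_orthogonal_upto[of i, rule_format, of i j]
    comm_scalar_prod[OF q_carrier[of i] q_carrier[of j]]
    comm_scalar_prod[OF p_carrier[of i] p_carrier[of j]]
  by (cases "i < j"; simp)+

lemma lanczos_Q_carrier: "lanczos_Q A b k \<in> carrier_mat n k"
  and lanczos_P_carrier: "lanczos_P A b k \<in> carrier_mat m k"
  unfolding lanczos_Q_def lanczos_P_def carrier_matD[OF A_carrier]
  using mat_of_cols_carrier(1)[of n "map (lanczos_q A b) [1..<k + 1]"]
    mat_of_cols_carrier(1)[of m "map (lanczos_p A b) [1..<k + 1]"]
  by (simp_all only: length_map length_upt diff_add_inverse2)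

lemma col_lanczos_Q: "j < k \<Longrightarrow> col (lanczos_Q A b k) j = q (Suc j)"
  and col_lanczos_P: "j < k \<Longrightarrow> col (lanczos_P A b k) j = p j"
proof -
  assume j: "j < k"
  hence nth: "map f [1..<k + 1] ! j = f (Suc j)" for f :: "nat \<Rightarrow> real vec"
    by (simp del: upt_Suc)
  have len: "j < length (map f [1..<k + 1])" for f :: "nat \<Rightarrow> real vec"
    using j by (simp del: upt_Suc)
  show "col (lanczos_Q A b k) j = q (Suc j)" "col (lanczos_P A b k) j = p j"
    unfolding lanczos_Q_def lanczos_P_def carrier_matD[OF A_carrier]
    using col_mat_of_cols[OF len, of "lanczos_q A b" n] col_mat_of_cols[OF len, of "lanczos_p A b" m]
      q_carrier[of "Suc j"] p_carrier[of j]
    by (simp_all only: nth q_def p_def)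
qed

lemma lanczos_P_projector:
  assumes "j < k"
  shows "lanczos_P A b k *\<^sub>v (transpose_mat (lanczos_P A b k) *\<^sub>v p j) = p j"
  using projector_fixes_col[OF lanczos_P_carrier, of k j] p_zero_or_unit p_orthogonal assms
  by (auto simp: col_lanczos_P)

lemma lanczos_Q_projector:
  assumes "j < k"
  shows "lanczos_Q A b k *\<^sub>v (transpose_mat (lanczos_Q A b k) *\<^sub>v q (Suc j)) = q (Suc j)"
  using projector_fixes_col[OF lanczos_Q_carrier, of k j] q_zero_or_unit q_orthogonal assms
  by (auto simp: col_lanczos_Q)

text \<open>The columns of \<open>A Q\<close> are combinations of columns of \<open>P\<close>, so the projector \<open>P P\<^sup>T\<close> inside \<open>P B\<close> fixes
them.\<close>

lemma lanczos_P_B: "lanczos_P A b (k + 1) * lanczos_B A b k = A * lanczos_Q A b k"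
proof -
  let ?P = "lanczos_P A b (k + 1)" and ?Q = "lanczos_Q A b k"
  note [simp] = lanczos_P_carrier lanczos_Q_carrier A_carrier
  have Bc: "lanczos_B A b k \<in> carrier_mat (k + 1) k"
    unfolding lanczos_B_def
    by (rule mult_carrier_mat[OF mult_carrier_mat[OF _ A_carrier]]) auto
  show ?thesis
  proof (rule mat_col_eqI)
    fix j assume "j < dim_col (A * ?Q)"
    hence j: "j < k" using lanczos_Q_carrier[of k] by simp
    have cb: "col (lanczos_B A b k) j = transpose_mat ?P *\<^sub>v (A *\<^sub>v q (Suc j))"
      unfolding lanczos_B_def using j col_lanczos_Q[OF j] q_carrier[of "Suc j"]
      by (subst col_mult2[OF mult_carrier_mat[of _ "k + 1" m _ n] lanczos_Q_carrier])
        (auto simp: assoc_mult_mat_vec[of _ "k + 1" m _ n])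
    have "col (?P * lanczos_B A b k) j = ?P *\<^sub>v (transpose_mat ?P *\<^sub>v (A *\<^sub>v q (Suc j)))"
      using cb j by (subst col_mult2[OF lanczos_P_carrier Bc]) auto
    also have "\<dots> = alf (Suc j) \<cdot>\<^sub>v (?P *\<^sub>v (transpose_mat ?P *\<^sub>v p j))
        + bet (Suc j) \<cdot>\<^sub>v (?P *\<^sub>v (transpose_mat ?P *\<^sub>v p (Suc j)))"
      unfolding A_q by (rule gram_mult_vec_linear[OF lanczos_P_carrier p_carrier p_carrier])
    also have "\<dots> = A *\<^sub>v q (Suc j)"
      using lanczos_P_projector[of j "k + 1"] lanczos_P_projector[of "Suc j" "k + 1"] j by (simp add: A_q)
    also have "\<dots> = col (A * ?Q) j"
      using j col_lanczos_Q[OF j] by (subst col_mult2[OF A_carrier lanczos_Q_carrier]) auto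
    finally show "col (?P * lanczos_B A b k) j = col (A * ?Q) j" .
  qed (simp_all only: index_mult_mat carrier_matD[OF Bc] carrier_matD[OF lanczos_P_carrier]
      carrier_matD[OF lanczos_Q_carrier] carrier_matD[OF A_carrier])
qed

text \<open>The part of \<open>x\<close> orthogonal to the columns of \<open>Q\<close>; the matrix whose norm is \<open>\<gamma>\<^sub>k\<close> maps \<open>x\<close> to \<open>A\<close> applied
to this residual.\<close>

definition residual :: "nat \<Rightarrow> real vec \<Rightarrow> real vec" where
  "residual k x = x - lanczos_Q A b k *\<^sub>v (transpose_mat (lanczos_Q A b k) *\<^sub>v x)"

lemma residual_carrier: "x \<in> carrier_vec n \<Longrightarrow> residual k x \<in> carrier_vec n"
  using lanczos_Q_carrier[of k] by (simp add: residual_def)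

lemma gamma_matrix_mult:
  assumes x: "x \<in> carrier_vec n"
  shows "(A - lanczos_P A b (k + 1) * lanczos_B A b k * transpose_mat (lanczos_Q A b k)) *\<^sub>v x
    = A *\<^sub>v residual k x"
proof -
  let ?Q = "lanczos_Q A b k"
  have Q: "?Q \<in> carrier_mat n k" by (rule lanczos_Q_carrier)
  have AQ: "A * ?Q \<in> carrier_mat m k" using A_carrier Q by simp
  have "(A - A * ?Q * transpose_mat ?Q) *\<^sub>v x = A *\<^sub>v x - (A * ?Q * transpose_mat ?Q) *\<^sub>v x"
    by (rule minus_mult_distrib_mat_vec[of _ m n])
      (use A_carrier Q x in \<open>auto intro: mult_carrier_mat[OF AQ]\<close>)
  also have "(A * ?Q * transpose_mat ?Q) *\<^sub>v x = A *\<^sub>v (?Q *\<^sub>v (transpose_mat ?Q *\<^sub>v x))"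
    using A_carrier Q x
    by (simp add: assoc_mult_mat_vec[OF AQ _ x] assoc_mult_mat_vec[OF A_carrier Q] del: assoc_mult_mat)
  also have "A *\<^sub>v x - A *\<^sub>v (?Q *\<^sub>v (transpose_mat ?Q *\<^sub>v x)) = A *\<^sub>v residual k x"
    unfolding residual_def using Q x by (subst mult_minus_distrib_mat_vec[OF A_carrier]) auto
  finally show ?thesis by (simp only: lanczos_P_B)
qed

lemma gamma_matrix_dim:
  "dim_col (A - lanczos_P A b (k + 1) * lanczos_B A b k * transpose_mat (lanczos_Q A b k)) = n"
  using lanczos_Q_carrier[of k] by simp

lemma residual_orthogonal:
  assumes x: "x \<in> carrier_vec n" and j: "j \<in> {1..k}"
  shows "residual k x \<bullet> q j = 0"
proof -
  let ?Q = "lanczos_Q A b k"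
  have Q: "?Q \<in> carrier_mat n k" by (rule lanczos_Q_carrier)
  obtain i where i: "j = Suc i" "i < k" using j by (cases j) auto
  have Qx: "transpose_mat ?Q *\<^sub>v x \<in> carrier_vec k" using Q x by simp
  have "(?Q *\<^sub>v (transpose_mat ?Q *\<^sub>v x)) \<bullet> q j = (transpose_mat ?Q *\<^sub>v x) \<bullet> (transpose_mat ?Q *\<^sub>v q j)"
    using transpose_vec_mult_scalar[of "transpose_mat ?Q" k n "q j" "transpose_mat ?Q *\<^sub>v x"] Q Qx q_carrier[of j] by simp
  also have "\<dots> = x \<bullet> (?Q *\<^sub>v (transpose_mat ?Q *\<^sub>v q j))"
    using transpose_vec_mult_scalar[OF Q _ x, of "transpose_mat ?Q *\<^sub>v q j"] Q q_carrier[of j] by simp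
  also have "\<dots> = x \<bullet> q j" using lanczos_Q_projector[OF i(2)] i by simp
  finally show ?thesis unfolding residual_def
    using Q x q_carrier[of j] Qx by (simp add: minus_scalar_prod_distrib[of _ n])
qed

lemma residual_norm_le:
  assumes x: "x \<in> carrier_vec n"
  shows "vnorm (residual k x) \<le> vnorm x"
proof -
  let ?Q = "lanczos_Q A b k" and ?y = "residual k x"
  have Q: "?Q \<in> carrier_mat n k" by (rule lanczos_Q_carrier)
  define w where "w = transpose_mat ?Q *\<^sub>v x"
  have w: "w \<in> carrier_vec k" using Q x by (simp add: w_def)
  have y: "?y \<in> carrier_vec n" by (rule residual_carrier[OF x])
  have Qw: "?Q *\<^sub>v w \<in> carrier_vec n" using Q w by simp
  have "transpose_mat ?Q *\<^sub>v ?y = 0\<^sub>v k"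
  proof (intro eq_vecI)
    fix i assume "i < dim_vec (0\<^sub>v k)"
    thus "(transpose_mat ?Q *\<^sub>v ?y) $ i = 0\<^sub>v k $ i"
      using Q residual_orthogonal[OF x, of "Suc i" k] comm_scalar_prod[OF y q_carrier]
      by (simp add: col_lanczos_Q)
  qed (use Q in auto)
  hence 0: "?y \<bullet> (?Q *\<^sub>v w) = 0"
    using transpose_vec_mult_scalar[OF Q w y] w by simp
  have xe: "x = ?y + ?Q *\<^sub>v w" using x Q by (auto simp: residual_def w_def intro!: eq_vecI)
  have "x \<bullet> x = ?y \<bullet> ?y + (?Q *\<^sub>v w) \<bullet> (?Q *\<^sub>v w)"
    by (subst (1 2) xe) (use y Qw 0 comm_scalar_prod[OF y Qw] in
      \<open>simp add: scalar_prod_add_distrib[of _ n] add_scalar_prod_distrib[of _ n]\<close>)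
  thus ?thesis
    by (subst vnorm_le_iff) (simp_all add: vnorm_nonneg vnorm_power2 scalar_prod_self_nonneg)
qed

end

section \<open>Lagrange interpolation and the entries of Delta\<close>

lemma poly_eq_sum_lessThan:
  fixes p :: "'a :: comm_ring_1 poly"
  assumes "degree p < k"
  shows "poly p x = (\<Sum>i<k. x ^ i * poly.coeff p i)"
proof -
  have "(\<Sum>i\<le>degree p. poly.coeff p i * x ^ i) = (\<Sum>i<k. poly.coeff p i * x ^ i)"
    using assms by (intro sum.mono_neutral_left) (auto simp: coeff_eq_0)
  thus ?thesis by (simp add: poly_altdef mult.commute)
qed

definition lagrange_poly :: "(nat \<Rightarrow> real) \<Rightarrow> nat \<Rightarrow> nat \<Rightarrow> real poly" where
  "lagrange_poly x k s = (\<Prod>l\<in>{..<k} - {s}. Polynomial.smult (1 / (x s - x l)) [:- x l, 1:])"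

lemma poly_lagrange_poly: "poly (lagrange_poly x k s) t = (\<Prod>l\<in>{..<k} - {s}. (t - x l) / (x s - x l))"
  unfolding lagrange_poly_def poly_prod by (intro prod.cong) (simp_all add: diff_divide_distrib)

lemma poly_lagrange_poly_node:
  assumes "inj_on x {..<k}" "s < k" "l < k"
  shows "poly (lagrange_poly x k s) (x l) = (if l = s then 1 else 0)"
proof (cases "l = s")
  case True
  have "(x s - x j) / (x s - x j) = 1" if "j \<in> {..<k} - {s}" for j
    using that assms inj_onD[OF assms(1), of s j] by auto
  thus ?thesis using True by (simp add: poly_lagrange_poly)
next
  case False
  thus ?thesis using assms by (auto simp: poly_lagrange_poly)
qed

lemma degree_lagrange_poly:
  assumes "s < k"
  shows "degree (lagrange_poly x k s) < k"
proof -
  have "degree (lagrange_poly x k s) \<le> sum (degree \<circ> (\<lambda>l. Polynomial.smult (1 / (x s - x l)) [:- x l, 1:])) ({..<k} - {s})"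
    unfolding lagrange_poly_def by (rule degree_prod_sum_le) simp
  also have "\<dots> \<le> (\<Sum>l\<in>{..<k} - {s}. 1)"
    by (intro sum_mono) (auto intro: order_trans[OF degree_smult_le])
  also have "\<dots> < k" using assms by simp
  finally show ?thesis .
qed

lemma lagrange_interpolation:
  assumes inj: "inj_on x {..<k}" and deg: "degree g < k"
  shows "poly g t = (\<Sum>s<k. poly g (x s) * poly (lagrange_poly x k s) t)"
proof -
  define h where "h = (\<Sum>s<k. Polynomial.smult (poly g (x s)) (lagrange_poly x k s))"
  have h: "poly h t = (\<Sum>s<k. poly g (x s) * poly (lagrange_poly x k s) t)" for t
    by (simp add: h_def poly_sum)
  have deg_h: "degree h < k" unfolding h_def
    using deg degree_lagrange_poly[of _ k x]
    by (intro degree_sum_less) (auto intro: le_less_trans[OF degree_smult_le])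
  have eq: "poly g (x l) = poly h (x l)" if "l < k" for l
  proof -
    have "poly h (x l) = (\<Sum>s<k. if l = s then poly g (x s) else 0)"
      unfolding h using that poly_lagrange_poly_node[OF inj] by (intro sum.cong) auto
    thus ?thesis using that by simp
  qed
  have "g = h"
  proof (rule poly_eqI_degree)
    show "poly g y = poly h y" if "y \<in> x ` {..<k}" for y
      using that eq by blast
    show "degree g < card (x ` {..<k})" "degree h < card (x ` {..<k})"
      using deg deg_h by (simp_all only: card_image[OF inj] card_lessThan)
  qed
  hence "poly g t = poly h t" by (rule arg_cong)
  thus ?thesis by (rule trans[OF _ h])
qed

text \<open>Evaluating the Lagrange polynomials at the nodes gives the identity matrix, so their coefficients
are the columns of the inverse of the Vandermonde matrix.\<close>

lemma minv_vandermonde: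
  assumes inj: "inj_on x {..<k}"
  shows "minv (mat k k (\<lambda>(i, j). x i ^ j)) = mat k k (\<lambda>(i, j). poly.coeff (lagrange_poly x k j) i)"
    (is "minv ?T = ?C")
proof (rule minv_eqI)
  show "?T * ?C = 1\<^sub>m k"
  proof (rule eq_matI)
    fix i j assume "i < dim_row (1\<^sub>m k)" "j < dim_col (1\<^sub>m k)"
    hence ij: "i < k" "j < k" by auto
    have "(?T * ?C) $$ (i, j) = (\<Sum>a<k. x i ^ a * poly.coeff (lagrange_poly x k j) a)"
      using ij by (simp add: scalar_prod_def atLeast0LessThan)
    also have "\<dots> = poly (lagrange_poly x k j) (x i)"
      using poly_eq_sum_lessThan[OF degree_lagrange_poly[OF ij(2)]] by simp
    finally show "(?T * ?C) $$ (i, j) = 1\<^sub>m k $$ (i, j)"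
      using poly_lagrange_poly_node[OF inj ij(2) ij(1)] ij by simp
  qed auto
qed auto

lemma minv_mat_diag:
  assumes "\<And>i. i < k \<Longrightarrow> w i \<noteq> 0"
  shows "minv (mat_diag k w) = mat_diag k (\<lambda>i. 1 / w i)"
proof (rule minv_eqI)
  show "mat_diag k w * mat_diag k (\<lambda>i. 1 / w i) = 1\<^sub>m k"
    unfolding mat_diag_diag using assms by (auto simp: mat_diag_def intro!: eq_matI)
qed auto

text \<open>Multiplying the coefficients of the Lagrange polynomials by the lower part of the Vandermonde matrix
evaluates these polynomials at the remaining nodes.\<close>

lemma Delta_mat_eq:
  fixes U :: "real mat" and \<sigma> :: "nat \<Rightarrow> real" and b :: "real vec" and n k :: nat
  defines "w \<equiv> \<lambda>i. \<sigma> (Suc i) * ucoef U b (Suc i)" and "x \<equiv> \<lambda>i. (\<sigma> (Suc i))\<^sup>2"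
  assumes k: "k \<le> n" and inj: "inj_on x {..<k}" and w: "\<And>i. i < k \<Longrightarrow> w i \<noteq> 0"
  shows "Delta_mat n U \<sigma> b k =
    mat (n - k) k (\<lambda>(r, s). w (k + r) * poly (lagrange_poly x k s) (x (k + r)) / w s)"
proof -
  let ?D = "mat_diag n (\<lambda>i. \<sigma> (i + 1) * ucoef U b (i + 1))"
  let ?T = "mat n k (\<lambda>(i, j). \<sigma> (i + 1) ^ (2 * j))"
  let ?T2 = "mat (n - k) k (\<lambda>(r, j). x (k + r) ^ j)"
  have "fst (split_block ?T k k) = mat k k (\<lambda>(i, j). x i ^ j)"
    by (rule eq_matI) (use k in \<open>simp_all add: split_block_def Let_def x_def power_mult\<close>)
  moreover have "fst (snd (snd (split_block ?T k k))) = ?T2"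
    by (rule eq_matI) (use k in \<open>simp_all add: split_block_def Let_def x_def power_mult add.commute[of _ k]\<close>)
  ultimately obtain X Y where T: "split_block ?T k k = (mat k k (\<lambda>(i, j). x i ^ j), X, ?T2, Y)"
    by (cases "split_block ?T k k") auto
  have "fst (split_block ?D k k) = mat_diag k w"
    by (rule eq_matI) (use k in \<open>simp_all add: split_block_def Let_def w_def mat_diag_def\<close>)
  moreover have "snd (snd (snd (split_block ?D k k))) = mat_diag (n - k) (\<lambda>r. w (k + r))"
    by (rule eq_matI) (use k in \<open>simp_all add: split_block_def Let_def w_def mat_diag_def add.commute[of _ k]\<close>)
  ultimately obtain X' Y' where D: "split_block ?D k k = (mat_diag k w, X', Y', mat_diag (n - k) (\<lambda>r. w (k + r)))"
    by (cases "split_block ?D k k") auto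
  let ?C = "mat k k (\<lambda>(i, j). poly.coeff (lagrange_poly x k j) i)"
  have "Delta_mat n U \<sigma> b k = mat_diag (n - k) (\<lambda>r. w (k + r)) * ?T2 * ?C * mat_diag k (\<lambda>i. 1 / w i)"
    unfolding Delta_mat_def Let_def T D by (simp add: minv_vandermonde[OF inj] minv_mat_diag[OF w])
  also have "mat_diag (n - k) (\<lambda>r. w (k + r)) * ?T2 * ?C = mat_diag (n - k) (\<lambda>r. w (k + r)) * (?T2 * ?C)"
    by (rule assoc_mult_mat[OF mat_diag_dim mat_carrier mat_carrier])
  also have "?T2 * ?C = mat (n - k) k (\<lambda>(r, s). poly (lagrange_poly x k s) (x (k + r)))"
  proof (rule eq_matI)
    fix r s assume "r < dim_row (mat (n - k) k (\<lambda>(r, s). poly (lagrange_poly x k s) (x (k + r))))"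
      "s < dim_col (mat (n - k) k (\<lambda>(r, s). poly (lagrange_poly x k s) (x (k + r))))"
    hence rs: "r < n - k" "s < k" by auto
    have "(?T2 * ?C) $$ (r, s) = (\<Sum>a<k. x (k + r) ^ a * poly.coeff (lagrange_poly x k s) a)"
      using rs by (simp add: scalar_prod_def atLeast0LessThan)
    also have "\<dots> = poly (lagrange_poly x k s) (x (k + r))"
      using poly_eq_sum_lessThan[OF degree_lagrange_poly[OF rs(2)]] by simp
    finally show "(?T2 * ?C) $$ (r, s) = mat (n - k) k (\<lambda>(r, s). poly (lagrange_poly x k s) (x (k + r))) $$ (r, s)"
      using rs by simp
  qed auto
  also have "mat_diag (n - k) (\<lambda>r. w (k + r)) * \<dots> =
      mat (n - k) k (\<lambda>(r, s). w (k + r) * poly (lagrange_poly x k s) (x (k + r)))"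
    by (subst mat_diag_mult_left[of _ _ k]) (auto intro!: eq_matI)
  also have "\<dots> * mat_diag k (\<lambda>i. 1 / w i) =
      mat (n - k) k (\<lambda>(r, s). w (k + r) * poly (lagrange_poly x k s) (x (k + r)) / w s)"
    by (subst mat_diag_mult_right[of _ "n - k"]) (auto intro!: eq_matI)
  finally show ?thesis .
qed

section \<open>Coordinates along the right singular vectors\<close>

locale svd =
  fixes m n :: nat and A U :: "real mat" and \<sigma> :: "nat \<Rightarrow> real" and V :: "real mat"
  assumes svd: "is_svd m n A U \<sigma> V"
begin

lemma A_dim: "A \<in> carrier_mat m n" and n_le_m: "n \<le> m"
  and U_carrier: "U \<in> carrier_mat m m" and V_carrier: "V \<in> carrier_mat n n"
  and Ut_U: "transpose_mat U * U = 1\<^sub>m m"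
  and Vt_V: "transpose_mat V * V = 1\<^sub>m n" and V_Vt: "V * transpose_mat V = 1\<^sub>m n"
  using svd by (auto simp: is_svd_def orthonormal_mat_def)

definition coord :: "real vec \<Rightarrow> nat \<Rightarrow> real" where
  "coord x i = col V i \<bullet> x"

lemma coord_eq: "i < n \<Longrightarrow> coord x i = (transpose_mat V *\<^sub>v x) $ i"
  using V_carrier by (simp add: coord_def)

lemma coord_add:
  "x \<in> carrier_vec n \<Longrightarrow> y \<in> carrier_vec n \<Longrightarrow> coord (x + y) i = coord x i + coord y i"
  and coord_diff:
  "x \<in> carrier_vec n \<Longrightarrow> y \<in> carrier_vec n \<Longrightarrow> coord (x - y) i = coord x i - coord y i"
  and coord_smult: "x \<in> carrier_vec n \<Longrightarrow> coord (a \<cdot>\<^sub>v x) i = a * coord x i"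
  and coord_zero: "coord (0\<^sub>v n) i = 0"
  using V_carrier
  by (auto simp: coord_def scalar_prod_add_distrib[of _ n] scalar_prod_minus_distrib[of _ n])

lemma coord_V_mult:
  assumes "z \<in> carrier_vec n" "i < n"
  shows "coord (V *\<^sub>v z) i = z $ i"
proof -
  have "transpose_mat V *\<^sub>v (V *\<^sub>v z) = z"
    using assoc_mult_mat_vec[of "transpose_mat V" n n V n z] V_carrier assms by (simp add: Vt_V)
  thus ?thesis using assms by (simp add: coord_eq)
qed

lemma parseval:
  assumes x: "x \<in> carrier_vec n" and y: "y \<in> carrier_vec n"
  shows "x \<bullet> y = (\<Sum>i<n. coord x i * coord y i)"
proof -
  have Vy: "transpose_mat V *\<^sub>v y \<in> carrier_vec n" using V_carrier y by simp
  have "V *\<^sub>v (transpose_mat V *\<^sub>v y) = y"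
    using assoc_mult_mat_vec[of V n n "transpose_mat V" n y] V_carrier y by (simp add: V_Vt)
  hence "x \<bullet> y = (transpose_mat V *\<^sub>v x) \<bullet> (transpose_mat V *\<^sub>v y)"
    using transpose_vec_mult_scalar[OF V_carrier Vy x] by simp
  also have "\<dots> = (\<Sum>i<n. coord x i * coord y i)"
    using V_carrier by (simp add: scalar_prod_def atLeast0LessThan coord_def)
  finally show ?thesis .
qed

lemma vnorm_power2_coord: "x \<in> carrier_vec n \<Longrightarrow> (vnorm x)\<^sup>2 = (\<Sum>i<n. (coord x i)\<^sup>2)"
  unfolding vnorm_power2 by (simp add: parseval power2_eq_square)

definition Sig :: "real mat" where
  "Sig = mat m n (\<lambda>(i, j). if i = j then \<sigma> (Suc i) else 0)"

lemma Sig_carrier: "Sig \<in> carrier_mat m n" by (simp add: Sig_def)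

lemma A_eq: "A = U * Sig * transpose_mat V"
proof -
  have "mat_diag n (\<lambda>i. \<sigma> (i + 1)) @\<^sub>r 0\<^sub>m (m - n) n = Sig"
    unfolding Sig_def append_rows_def mat_diag_def using n_le_m
    by (intro eq_matI) (auto simp: four_block_mat_def Let_def)
  thus ?thesis using svd by (simp add: is_svd_def)
qed

lemma A_col_V:
  assumes i: "i < n"
  shows "A *\<^sub>v col V i = \<sigma> (Suc i) \<cdot>\<^sub>v col U i"
proof -
  have v: "col V i \<in> carrier_vec n" using V_carrier i by auto
  have "transpose_mat V *\<^sub>v col V i = unit_vec n i"
    using col_mult2[of "transpose_mat V" n n V n i] V_carrier i by (simp add: Vt_V)
  moreover have "Sig *\<^sub>v unit_vec n i = \<sigma> (Suc i) \<cdot>\<^sub>v unit_vec m i"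
    using i n_le_m by (intro eq_vecI) (auto simp: Sig_def)
  moreover have "A *\<^sub>v col V i = U *\<^sub>v (Sig *\<^sub>v (transpose_mat V *\<^sub>v col V i))"
    unfolding A_eq using U_carrier V_carrier Sig_carrier v
    by (simp add: assoc_mult_mat_vec[OF mult_carrier_mat[OF U_carrier Sig_carrier] _ v, of "transpose_mat V"]
        assoc_mult_mat_vec[OF U_carrier Sig_carrier] del: assoc_mult_mat)
  ultimately show ?thesis
    using mult_vec_smult_unit_vec[OF U_carrier, of i "\<sigma> (Suc i)"] i n_le_m by simp
qed

lemma At_col_U:
  assumes i: "i < n"
  shows "transpose_mat A *\<^sub>v col U i = \<sigma> (Suc i) \<cdot>\<^sub>v col V i"
proof -
  have im: "i < m" using i n_le_m by simp
  have u: "col U i \<in> carrier_vec m" using U_carrier im by auto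
  have *: "transpose_mat U *\<^sub>v col U i = unit_vec m i"
    using col_mult2[of "transpose_mat U" m m U m i] U_carrier im by (simp add: Ut_U)
  moreover have "transpose_mat Sig *\<^sub>v unit_vec m i = \<sigma> (Suc i) \<cdot>\<^sub>v unit_vec n i"
    using i n_le_m by (intro eq_vecI) (auto simp: Sig_def)
  moreover have "transpose_mat A *\<^sub>v col U i = V *\<^sub>v (transpose_mat Sig *\<^sub>v (transpose_mat U *\<^sub>v col U i))"
  proof -
    have "transpose_mat A = V * (transpose_mat Sig * transpose_mat U)"
      unfolding A_eq using U_carrier V_carrier Sig_carrier
      by (simp add: transpose_mult[OF mult_carrier_mat[OF U_carrier Sig_carrier]] transpose_mult[OF U_carrier Sig_carrier]
          del: assoc_mult_mat)
    thus ?thesis using U_carrier V_carrier Sig_carrier u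
      by (simp add: assoc_mult_mat_vec[of V n n "transpose_mat Sig * transpose_mat U" m]
          assoc_mult_mat_vec[of "transpose_mat Sig" n m "transpose_mat U" m] del: assoc_mult_mat)
  qed
  ultimately show ?thesis
    using mult_vec_smult_unit_vec[OF V_carrier i, of "\<sigma> (Suc i)"] by simp
qed

lemma coord_At:
  assumes z: "z \<in> carrier_vec m" and i: "i < n"
  shows "coord (transpose_mat A *\<^sub>v z) i = \<sigma> (Suc i) * ucoef U z (Suc i)"
proof -
  have v: "col V i \<in> carrier_vec n" using V_carrier i by auto
  have "coord (transpose_mat A *\<^sub>v z) i = (transpose_mat A *\<^sub>v z) \<bullet> col V i"
    unfolding coord_def using A_dim z v by (intro comm_scalar_prod[of _ n]) auto
  also have "\<dots> = z \<bullet> (\<sigma> (Suc i) \<cdot>\<^sub>v col U i)"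
    by (simp add: transpose_vec_mult_scalar[OF A_dim v z] A_col_V[OF i])
  also have "\<dots> = \<sigma> (Suc i) * (z \<bullet> col U i)"
    using U_carrier z by simp
  also have "z \<bullet> col U i = col U i \<bullet> z"
    using U_carrier z i n_le_m by (intro comm_scalar_prod[of _ m]) auto
  finally show ?thesis by (simp add: ucoef_def)
qed

lemma ucoef_A:
  assumes x: "x \<in> carrier_vec n" and i: "i < n"
  shows "ucoef U (A *\<^sub>v x) (Suc i) = \<sigma> (Suc i) * coord x i"
proof -
  have u: "col U i \<in> carrier_vec m" using U_carrier i n_le_m by auto
  have "ucoef U (A *\<^sub>v x) (Suc i) = (transpose_mat A *\<^sub>v col U i) \<bullet> x"
    using transpose_vec_mult_scalar[OF A_dim x u] by (simp add: ucoef_def)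
  also have "\<dots> = \<sigma> (Suc i) * (col V i \<bullet> x)"
    using V_carrier x by (simp add: At_col_U[OF i])
  finally show ?thesis by (simp add: coord_def)
qed

lemma coord_gram:
  assumes "x \<in> carrier_vec n" "i < n"
  shows "coord (transpose_mat A *\<^sub>v (A *\<^sub>v x)) i = (\<sigma> (Suc i))\<^sup>2 * coord x i"
  using coord_At[of "A *\<^sub>v x" i] ucoef_A[of x i] assms A_dim by (simp add: power2_eq_square)

lemma vnorm_A_power2:
  assumes x: "x \<in> carrier_vec n"
  shows "(vnorm (A *\<^sub>v x))\<^sup>2 = (\<Sum>i<n. (\<sigma> (Suc i) * coord x i)\<^sup>2)"
proof -
  have Ax: "A *\<^sub>v x \<in> carrier_vec m" using A_dim x by simp
  have g: "transpose_mat A *\<^sub>v (A *\<^sub>v x) \<in> carrier_vec n" using A_dim Ax by simp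
  have "(vnorm (A *\<^sub>v x))\<^sup>2 = (transpose_mat A *\<^sub>v (A *\<^sub>v x)) \<bullet> x"
    by (simp add: vnorm_power2 transpose_vec_mult_scalar[OF A_dim x Ax])
  also have "\<dots> = (\<Sum>i<n. (\<sigma> (Suc i) * coord x i)\<^sup>2)"
    unfolding parseval[OF g x] by (intro sum.cong) (auto simp: coord_gram x power2_eq_square)
  finally show ?thesis .
qed

end

section \<open>Krylov spaces as polynomials\<close>

locale lanczos_svd = svd m n A U \<sigma> V for m n :: nat and A U :: "real mat" and \<sigma> :: "nat \<Rightarrow> real" and V :: "real mat" +
  fixes b :: "real vec"
  assumes b_dim: "b \<in> carrier_vec m"
    and simple: "simple_positive n \<sigma>"
    and ucoef_nonzero: "\<And>i. i \<in> {1..n} \<Longrightarrow> ucoef U b i \<noteq> 0"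
begin

sublocale bidiagonalization A b m n
  by unfold_locales (rule A_dim b_dim)+

definition wgt :: "nat \<Rightarrow> real" where "wgt i = \<sigma> (Suc i) * ucoef U b (Suc i)"

definition node :: "nat \<Rightarrow> real" where "node i = (\<sigma> (Suc i))\<^sup>2"

lemma sigma_pos: "i < n \<Longrightarrow> 0 < \<sigma> (Suc i)"
  using simple by (auto simp: simple_positive_def)

lemma sigma_mono: "i \<le> j \<Longrightarrow> j < n \<Longrightarrow> \<sigma> (Suc j) \<le> \<sigma> (Suc i)"
  using simple by (cases "i = j") (auto simp: simple_positive_def less_imp_le)

lemma wgt_nonzero: "i < n \<Longrightarrow> wgt i \<noteq> 0"
  using sigma_pos[of i] ucoef_nonzero[of "Suc i"] by (auto simp: wgt_def)

lemma inj_node: "k \<le> n \<Longrightarrow> inj_on node {..<k}"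
proof (rule linorder_inj_onI')
  fix i j assume "k \<le> n" "i \<in> {..<k}" "j \<in> {..<k}" "i < j"
  hence "\<sigma> (Suc j) < \<sigma> (Suc i)" "0 < \<sigma> (Suc j)"
    using simple sigma_pos[of j] by (auto simp: simple_positive_def)
  thus "node i \<noteq> node j" by (auto simp: node_def power2_eq_iff)
qed

text \<open>\<open>krylov d\<close> is the Krylov space of \<open>A\<^sup>T A\<close> and \<open>A\<^sup>T b\<close> of order \<open>d + 1\<close>, with its elements
\<open>g (A\<^sup>T A) A\<^sup>T b\<close> described through their coordinates, in which \<open>A\<^sup>T A\<close> multiplies \<open>g\<close> by the
variable.\<close>

definition krylov :: "nat \<Rightarrow> real vec \<Rightarrow> bool" where
  "krylov d x \<longleftrightarrow> x \<in> carrier_vec n \<and>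
     (\<exists>g. degree g \<le> d \<and> (\<forall>i<n. coord x i = wgt i * poly g (node i)))"

lemma krylovI:
  "x \<in> carrier_vec n \<Longrightarrow> degree g \<le> d \<Longrightarrow> (\<And>i. i < n \<Longrightarrow> coord x i = wgt i * poly g (node i)) \<Longrightarrow> krylov d x"
  by (auto simp: krylov_def)

lemma krylov_carrier: "krylov d x \<Longrightarrow> x \<in> carrier_vec n"
  by (simp add: krylov_def)

lemma krylov_mono: "krylov d x \<Longrightarrow> d \<le> e \<Longrightarrow> krylov e x"
  unfolding krylov_def by (meson order_trans)

lemma krylov_zero: "krylov d (0\<^sub>v n)"
  by (rule krylovI[of _ 0]) (auto simp: coord_zero)

lemma krylov_smult: "krylov d x \<Longrightarrow> krylov d (a \<cdot>\<^sub>v x)"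
proof -
  assume x: "krylov d x"
  then obtain g where g: "degree g \<le> d" "\<forall>i<n. coord x i = wgt i * poly g (node i)"
    by (auto simp: krylov_def)
  show ?thesis
    by (rule krylovI[of _ "Polynomial.smult a g"])
      (use g krylov_carrier[OF x] in \<open>auto simp: coord_smult intro: order_trans[OF degree_smult_le]\<close>)
qed

lemma krylov_add: "krylov d x \<Longrightarrow> krylov d y \<Longrightarrow> krylov d (x + y)"
proof -
  assume x: "krylov d x" and y: "krylov d y"
  obtain g where g: "degree g \<le> d" "\<forall>i<n. coord x i = wgt i * poly g (node i)"
    using x by (auto simp: krylov_def)
  obtain h where h: "degree h \<le> d" "\<forall>i<n. coord y i = wgt i * poly h (node i)"
    using y by (auto simp: krylov_def)
  show ?thesis
    by (rule krylovI[of _ "g + h"])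
      (use g h krylov_carrier[OF x] krylov_carrier[OF y] in
        \<open>auto simp: coord_add degree_add_le algebra_simps\<close>)
qed

lemma krylov_diff: "krylov d x \<Longrightarrow> krylov d y \<Longrightarrow> krylov d (x - y)"
proof -
  assume x: "krylov d x" and y: "krylov d y"
  have "x - y = x + (- 1) \<cdot>\<^sub>v y"
    using krylov_carrier[OF x] krylov_carrier[OF y] by (intro eq_vecI) auto
  thus ?thesis using krylov_add[OF x krylov_smult[OF y, of "- 1"]] by (simp only:)
qed

lemma krylov_gram: "krylov d x \<Longrightarrow> krylov (Suc d) (transpose_mat A *\<^sub>v (A *\<^sub>v x))"
proof -
  assume x: "krylov d x"
  then obtain g where g: "degree g \<le> d" "\<forall>i<n. coord x i = wgt i * poly g (node i)"
    by (auto simp: krylov_def)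
  show ?thesis
    by (rule krylovI[of _ "pCons 0 g"])
      (use g krylov_carrier[OF x] A_dim in
        \<open>auto simp: coord_gram node_def intro: order_trans[OF degree_pCons_le]\<close>)
qed

text \<open>The two statements support each other: \<open>q\<close> is obtained from \<open>A\<^sup>T p\<close>, and \<open>A\<^sup>T p\<close> at the next step
from \<open>A\<^sup>T A q\<close>, which raises the degree by one.\<close>

lemma krylov_lanczos: "krylov j (transpose_mat A *\<^sub>v p j) \<and> krylov j (q (Suc j))"
proof (induction j)
  case 0
  have "transpose_mat A *\<^sub>v p 0 = (1 / vnorm b) \<cdot>\<^sub>v (transpose_mat A *\<^sub>v b)"
    unfolding p_0 using A_dim b_dim by (simp add: mult_mat_vec[of _ n m])
  moreover have "krylov 0 (transpose_mat A *\<^sub>v b)"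
    by (rule krylovI[of _ 1]) (use A_dim b_dim in \<open>auto simp: coord_At wgt_def\<close>)
  ultimately have "krylov 0 (transpose_mat A *\<^sub>v p 0)" by (simp add: krylov_smult)
  thus ?case
    by (simp add: q_Suc_eq q_0 krylov_smult krylov_diff krylov_zero)
next
  case (Suc j)
  have "transpose_mat A *\<^sub>v p (Suc j) = (1 / bet (Suc j)) \<cdot>\<^sub>v
      (transpose_mat A *\<^sub>v (A *\<^sub>v q (Suc j)) - alf (Suc j) \<cdot>\<^sub>v (transpose_mat A *\<^sub>v p j))"
    unfolding p_Suc_eq using A_dim p_carrier[of j] Av_carrier(1)[of "Suc j"]
    by (simp add: mult_mat_vec[of _ n m] mult_minus_distrib_mat_vec[of _ n m])
  moreover have "krylov (Suc j) \<dots>"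
    using Suc krylov_mono[of j _ "Suc j"] by (intro krylov_smult krylov_diff krylov_gram) auto
  ultimately have *: "krylov (Suc j) (transpose_mat A *\<^sub>v p (Suc j))" by simp
  hence "krylov (Suc j) (q (Suc (Suc j)))"
    unfolding q_Suc_eq[of "Suc j"] using Suc krylov_mono[of j _ "Suc j"]
    by (intro krylov_smult krylov_diff) auto
  with * show ?case by simp
qed

lemma krylov_lanczos_Q_mult:
  assumes w: "w \<in> carrier_vec k" and k: "0 < k"
  shows "krylov (k - 1) (lanczos_Q A b k *\<^sub>v w)"
proof -
  have "\<exists>g. degree g \<le> k - 1 \<and> (\<forall>i<n. coord (q (Suc j)) i = wgt i * poly g (node i))" if "j < k" for j
    using krylov_mono[of j "q (Suc j)" "k - 1"] krylov_lanczos[of j] that by (auto simp: krylov_def)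
  then obtain G where G: "\<And>j. j < k \<Longrightarrow> degree (G j) \<le> k - 1"
    "\<And>j i. j < k \<Longrightarrow> i < n \<Longrightarrow> coord (q (Suc j)) i = wgt i * poly (G j) (node i)"
    by metis
  have Q: "lanczos_Q A b k \<in> carrier_mat n k" by (rule lanczos_Q_carrier)
  have c: "coord (lanczos_Q A b k *\<^sub>v w) i = (\<Sum>j<k. w $ j * coord (q (Suc j)) i)" if i: "i < n" for i
  proof -
    have v: "col V i \<in> carrier_vec n" using V_carrier i by auto
    have "coord (lanczos_Q A b k *\<^sub>v w) i = (transpose_mat (lanczos_Q A b k) *\<^sub>v col V i) \<bullet> w"
      unfolding coord_def by (rule transpose_vec_mult_scalar[OF Q w v, symmetric])
    also have "\<dots> = (\<Sum>j<k. (q (Suc j) \<bullet> col V i) * w $ j)"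
      using Q w by (simp add: scalar_prod_def[of _ w] atLeast0LessThan col_lanczos_Q)
    also have "\<dots> = (\<Sum>j<k. w $ j * coord (q (Suc j)) i)"
      unfolding coord_def by (intro sum.cong refl) (simp add: comm_scalar_prod[OF q_carrier v])
    finally show ?thesis .
  qed
  show ?thesis
  proof (rule krylovI)
    show "lanczos_Q A b k *\<^sub>v w \<in> carrier_vec n" using Q w by simp
    show "degree (\<Sum>j<k. Polynomial.smult (w $ j) (G j)) \<le> k - 1"
      using G by (intro degree_sum_le) (auto intro: order_trans[OF degree_smult_le])
    fix i assume i: "i < n"
    show "coord (lanczos_Q A b k *\<^sub>v w) i = wgt i * poly (\<Sum>j<k. Polynomial.smult (w $ j) (G j)) (node i)"
      unfolding c[OF i] poly_sum sum_distrib_left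
      by (intro sum.cong) (use G(2)[OF _ i] in auto)
  qed
qed

text \<open>This is the inclusion of the Krylov space in the span of the \<open>q\<close>, in dual form, which avoids
speaking of spans and dimensions. Splitting \<open>g\<close> as \<open>a + t * h\<close>, the constant part is the inner product
with \<open>A\<^sup>T b\<close>, a multiple of the first \<open>q\<close>. For the other part the factor \<open>t\<close> is moved to the other
side: it replaces \<open>y\<close> by \<open>A\<^sup>T A y\<close>, which by the recurrences is orthogonal to one \<open>q\<close> fewer.\<close>

lemma orthogonal_to_krylov:
  assumes "y \<in> carrier_vec n" and "\<And>j. j \<in> {1..k} \<Longrightarrow> y \<bullet> q j = 0" and "degree g < k"
  shows "(\<Sum>i<n. coord y i * (wgt i * poly g (node i))) = 0"
  using assms
proof (induction k arbitrary: y g)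
  case (Suc k)
  note y = Suc.prems(1) and orth = Suc.prems(2)
  obtain a h where g: "g = pCons a h" by (cases g)
  have Aty: "(transpose_mat A *\<^sub>v p j) \<bullet> y = 0" if "j \<le> k" for j
  proof -
    have "q j \<bullet> y = 0"
      using orth[of j] that comm_scalar_prod[OF y q_carrier[of j]] y by (cases "j = 0") (auto simp: q_0)
    moreover have "q (Suc j) \<bullet> y = 0"
      using orth[of "Suc j"] that comm_scalar_prod[OF y q_carrier[of "Suc j"]] by simp
    ultimately show ?thesis unfolding At_p using y q_carrier
      by (simp add: add_scalar_prod_distrib[of _ n])
  qed
  have const: "(\<Sum>i<n. coord y i * wgt i) = 0"
  proof -
    have bb: "b = vnorm b \<cdot>\<^sub>v p 0" using normalized_vec(1)[OF b_dim p_0] by simp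
    have "transpose_mat A *\<^sub>v b = vnorm b \<cdot>\<^sub>v (transpose_mat A *\<^sub>v p 0)"
      by (subst bb) (use A_dim p_carrier[of 0] in \<open>simp add: mult_mat_vec[of _ n m]\<close>)
    hence "(transpose_mat A *\<^sub>v b) \<bullet> y = 0" using Aty[of 0] y A_dim by simp
    moreover have "(transpose_mat A *\<^sub>v b) \<bullet> y = (\<Sum>i<n. coord y i * wgt i)"
      using A_dim b_dim y by (subst parseval) (auto simp: coord_At wgt_def mult.commute intro!: sum.cong)
    ultimately show ?thesis by simp
  qed
  define z where "z = transpose_mat A *\<^sub>v (A *\<^sub>v y)"
  have z: "z \<in> carrier_vec n" using A_dim y by (simp add: z_def)
  have shift: "(\<Sum>i<n. coord z i * (wgt i * poly h (node i))) = 0"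
  proof (cases "h = 0")
    case False
    hence "degree h < k" using Suc.prems(3) by (simp add: g)
    moreover have "z \<bullet> q j = 0" if j: "j \<in> {1..k}" for j
    proof -
      obtain i where i: "j = Suc i" "Suc i \<le> k" using j by (cases j) auto
      have Ay: "A *\<^sub>v y \<in> carrier_vec m" using A_dim y by simp
      have "z \<bullet> q j = (A *\<^sub>v y) \<bullet> (A *\<^sub>v q j)"
        unfolding z_def by (rule adjoint[OF q_carrier Ay])
      also have "\<dots> = alf j * ((A *\<^sub>v y) \<bullet> p i) + bet j * ((A *\<^sub>v y) \<bullet> p j)"
        unfolding i(1) A_q using p_carrier Ay by (simp add: scalar_prod_add_distrib[of _ m])
      also have "(A *\<^sub>v y) \<bullet> p i = 0"
        using Aty[of i] i adjoint[OF y p_carrier[of i]] comm_scalar_prod[OF Ay p_carrier[of i]] by simp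
      also have "(A *\<^sub>v y) \<bullet> p j = 0"
        using Aty[of j] i adjoint[OF y p_carrier[of j]] comm_scalar_prod[OF Ay p_carrier[of j]] by simp
      finally show ?thesis by simp
    qed
    ultimately show ?thesis using Suc.IH[OF z] by blast
  qed simp
  have "(\<Sum>i<n. coord y i * (wgt i * poly g (node i))) =
      a * (\<Sum>i<n. coord y i * wgt i) + (\<Sum>i<n. coord z i * (wgt i * poly h (node i)))"
    unfolding sum_distrib_left sum.distrib[symmetric]
    by (intro sum.cong refl) (simp add: g z_def coord_gram y node_def algebra_simps)
  thus ?case using const shift by simp
qed simp

section \<open>The lower bound for gamma\<close>

lemma norm_A_residual_le_gamma:
  assumes x: "x \<in> carrier_vec n"
  shows "vnorm (A *\<^sub>v residual k x) \<le> lanczos_gamma A b k * vnorm x"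
  unfolding lanczos_gamma_def gamma_matrix_mult[OF x, symmetric]
  by (rule vnorm_mult_vec_le_opnorm) (simp only: gamma_matrix_dim x)

lemma sigma_le_gamma:
  assumes k: "Suc k \<le> n"
  shows "\<sigma> (Suc k) \<le> lanczos_gamma A b k"
proof -
  obtain v where v: "v \<in> carrier_vec (Suc k)" "v \<noteq> 0\<^sub>v (Suc k)"
    "mat k (Suc k) (\<lambda>(i, j). coord (q (Suc i)) j) *\<^sub>v v = 0\<^sub>v k"
    using exists_nonzero_kernel_vec[of "mat k (Suc k) (\<lambda>(i, j). coord (q (Suc i)) j)" k] by auto
  define z where "z = vec n (\<lambda>i. if i < Suc k then v $ i else 0)"
  define x where "x = V *\<^sub>v z"
  have z: "z \<in> carrier_vec n" by (simp add: z_def)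
  have x: "x \<in> carrier_vec n" using V_carrier z by (simp add: x_def)
  have cx: "coord x i = (if i < Suc k then v $ i else 0)" if "i < n" for i
    using coord_V_mult[OF z that] that by (simp add: x_def z_def)
  have sum_restrict: "(\<Sum>i<n. F i) = (\<Sum>i<Suc k. F i)" if "\<And>i. i \<ge> Suc k \<Longrightarrow> i < n \<Longrightarrow> F i = 0" for F :: "nat \<Rightarrow> real"
    using that k by (intro sum.mono_neutral_right) auto
  have "q (Suc i) \<bullet> x = 0" if i: "i < k" for i
  proof -
    have "q (Suc i) \<bullet> x = (\<Sum>j<n. coord (q (Suc i)) j * coord x j)" by (rule parseval[OF q_carrier x])
    also have "\<dots> = (\<Sum>j<Suc k. coord (q (Suc i)) j * coord x j)" by (rule sum_restrict) (simp add: cx)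
    also have "\<dots> = (\<Sum>j<Suc k. coord (q (Suc i)) j * v $ j)"
      by (intro sum.cong) (use cx k in auto)
    also have "\<dots> = (mat k (Suc k) (\<lambda>(i, j). coord (q (Suc i)) j) *\<^sub>v v) $ i"
      using i v(1) by (simp add: scalar_prod_def atLeast0LessThan del: sum.lessThan_Suc)
    finally show ?thesis using v(3) i by simp
  qed
  hence "transpose_mat (lanczos_Q A b k) *\<^sub>v x = 0\<^sub>v k"
    using lanczos_Q_carrier[of k] by (intro eq_vecI) (auto simp: col_lanczos_Q)
  hence res: "residual k x = x"
    using lanczos_Q_carrier[of k] x by (auto simp: residual_def intro!: eq_vecI)
  have nz: "vnorm x \<noteq> 0"
  proof
    assume "vnorm x = 0"
    hence "(\<Sum>i<n. (coord x i)\<^sup>2) = 0" using vnorm_power2_coord[OF x] by simp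
    hence "\<forall>i<n. coord x i = 0" by (simp add: sum_nonneg_eq_0_iff)
    hence "\<forall>i<Suc k. v $ i = 0" using cx k by (metis less_le_trans)
    hence "v = 0\<^sub>v (Suc k)" using v(1) by (intro eq_vecI) auto
    thus False using v(2) by simp
  qed
  have "(\<sigma> (Suc k) * vnorm x)\<^sup>2 = (\<Sum>i<Suc k. (\<sigma> (Suc k) * coord x i)\<^sup>2)"
    unfolding power_mult_distrib vnorm_power2_coord[OF x] sum_distrib_left by (rule sum_restrict) (simp add: cx)
  also have "\<dots> \<le> (\<Sum>i<Suc k. (\<sigma> (Suc i) * coord x i)\<^sup>2)"
    unfolding power_mult_distrib
    by (intro sum_mono mult_right_mono power_mono) (use sigma_mono sigma_pos[of k] k in auto)
  also have "\<dots> = (vnorm (A *\<^sub>v x))\<^sup>2"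
    unfolding vnorm_A_power2[OF x] by (rule sum_restrict[symmetric]) (simp add: cx)
  finally have "\<sigma> (Suc k) * vnorm x \<le> vnorm (A *\<^sub>v x)"
    by (rule power2_le_imp_le) (rule vnorm_nonneg)
  also have "\<dots> \<le> lanczos_gamma A b k * vnorm x"
    using norm_A_residual_le_gamma[OF x, of k] by (simp add: res)
  finally show ?thesis using nz vnorm_nonneg[of x] by simp
qed

end

section \<open>The resolvent of a Gram matrix\<close>

lemma gram_resolvent_norm:
  fixes D :: "real mat"
  assumes D: "D \<in> carrier_mat r k" and w: "w \<in> carrier_vec k"
  defines "z \<equiv> transpose_mat D *\<^sub>v (D *\<^sub>v w)"
  shows "(vnorm (w + z))\<^sup>2 = (vnorm w)\<^sup>2 + 2 * (vnorm (D *\<^sub>v w))\<^sup>2 + (vnorm z)\<^sup>2"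
    and "(vnorm (D *\<^sub>v w))\<^sup>2 \<le> vnorm w * vnorm z"
proof -
  have Dw: "D *\<^sub>v w \<in> carrier_vec r" and z: "z \<in> carrier_vec k"
    using D w by (auto simp: z_def)
  have zw: "z \<bullet> w = (vnorm (D *\<^sub>v w))\<^sup>2"
    unfolding z_def vnorm_power2 by (rule transpose_vec_mult_scalar[OF D w Dw])
  show "(vnorm (w + z))\<^sup>2 = (vnorm w)\<^sup>2 + 2 * (vnorm (D *\<^sub>v w))\<^sup>2 + (vnorm z)\<^sup>2"
    using w z zw comm_scalar_prod[OF w z]
    by (simp add: vnorm_power2 add_scalar_prod_distrib[of _ k] scalar_prod_add_distrib[of _ k])
  show "(vnorm (D *\<^sub>v w))\<^sup>2 \<le> vnorm w * vnorm z"
    using scalar_prod_le_vnorm[OF z w] zw by (simp add: mult.commute)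
qed

text \<open>Substituting \<open>x = w + D\<^sup>T D w\<close> shows that this and the next lemma bound \<open>\<parallel>D (1 + D\<^sup>T D)\<^sup>-\<^sup>1\<parallel>\<close>. For a singular
value \<open>s\<close> of \<open>D\<close> the relevant number is \<open>s / (1 + s\<^sup>2)\<close>, which never exceeds \<open>1 / 2\<close>.\<close>

lemma mult_vec_le_half_gram_resolvent:
  fixes D :: "real mat"
  assumes D: "D \<in> carrier_mat r k" and w: "w \<in> carrier_vec k"
  shows "vnorm (D *\<^sub>v w) \<le> 1 / 2 * vnorm (w + transpose_mat D *\<^sub>v (D *\<^sub>v w))"
proof -
  define a s c where "a = vnorm w" and "s = vnorm (D *\<^sub>v w)" and "c = vnorm (transpose_mat D *\<^sub>v (D *\<^sub>v w))"
  note * = gram_resolvent_norm[OF D w, folded a_def s_def c_def]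
  have "0 \<le> (a - c)\<^sup>2" by simp
  hence "4 * s\<^sup>2 \<le> a\<^sup>2 + 2 * s\<^sup>2 + c\<^sup>2" using *(2) by (simp add: power2_diff)
  hence "s\<^sup>2 \<le> (1 / 2 * vnorm (w + transpose_mat D *\<^sub>v (D *\<^sub>v w)))\<^sup>2"
    using *(1) by (simp add: power_mult_distrib power_divide)
  thus ?thesis unfolding s_def by (rule power2_le_imp_le) (simp add: vnorm_nonneg)
qed

text \<open>On \<open>[0, 1]\<close> the function \<open>s / (1 + s\<^sup>2)\<close> increases, so its largest value over the singular values of \<open>D\<close>
is at \<open>s = \<parallel>D\<parallel>\<close>. The proof works with one vector instead: with \<open>d = \<parallel>D\<parallel>\<close> and \<open>l = (\<parallel>D w\<parallel> / \<parallel>w\<parallel>)\<^sup>2 \<le> d\<^sup>2\<close>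
it rests on \<open>\<parallel>D\<^sup>T D w\<parallel> \<ge> l * \<parallel>w\<parallel>\<close> and
\<open>d\<^sup>2 - (1 + d ^ 4) * l + d\<^sup>2 * l\<^sup>2 = (d\<^sup>2 - l) * (1 - d\<^sup>2 * l) \<ge> 0\<close>.\<close>

lemma mult_vec_le_opnorm_gram_resolvent:
  fixes D :: "real mat"
  assumes D: "D \<in> carrier_mat r k" and w: "w \<in> carrier_vec k" and d1: "opnorm D < 1"
  shows "vnorm (D *\<^sub>v w) \<le> opnorm D / (1 + (opnorm D)\<^sup>2) * vnorm (w + transpose_mat D *\<^sub>v (D *\<^sub>v w))"
proof -
  define a s c d where "a = vnorm w" and "s = vnorm (D *\<^sub>v w)"
    and "c = vnorm (transpose_mat D *\<^sub>v (D *\<^sub>v w))" and "d = opnorm D"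
  note * = gram_resolvent_norm[OF D w, folded a_def s_def c_def]
  have d: "0 \<le> d" "d < 1" using opnorm_nonneg[of D] d1 by (auto simp: d_def)
  have a0: "0 \<le> a" and s0: "0 \<le> s" by (simp_all add: a_def s_def vnorm_nonneg)
  have "s \<le> d * a"
    unfolding s_def a_def d_def by (rule vnorm_mult_vec_le_opnorm) (use D w in auto)
  hence sd: "s\<^sup>2 \<le> d\<^sup>2 * a\<^sup>2" using power_mono[of s "d * a" 2] s0 by (simp add: power_mult_distrib)
  \<comment> \<open>the difference of the squares of the two sides, after multiplication by \<open>1 + d\<^sup>2\<close>\<close>
  have key: "0 \<le> d\<^sup>2 * a\<^sup>2 - (1 + d ^ 4) * s\<^sup>2 + d\<^sup>2 * c\<^sup>2"
  proof (cases "a = 0")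
    case True
    thus ?thesis using sd by simp
  next
    case False
    have "d\<^sup>2 \<le> 1" using d by (simp add: power_le_one)
    hence "d\<^sup>2 * s\<^sup>2 \<le> 1 * s\<^sup>2" "d\<^sup>2 * a\<^sup>2 \<le> 1 * a\<^sup>2" by (intro mult_right_mono; simp)+
    hence "0 \<le> (d\<^sup>2 * a\<^sup>2 - s\<^sup>2) * (a\<^sup>2 - d\<^sup>2 * s\<^sup>2)" using sd by (intro mult_nonneg_nonneg) auto
    also have "\<dots> = a\<^sup>2 * (d\<^sup>2 * a\<^sup>2 - (1 + d ^ 4) * s\<^sup>2) + d\<^sup>2 * (s\<^sup>2)\<^sup>2"
      by (simp add: power2_eq_square power4_eq_xxxx algebra_simps)
    also have "\<dots> \<le> a\<^sup>2 * (d\<^sup>2 * a\<^sup>2 - (1 + d ^ 4) * s\<^sup>2) + d\<^sup>2 * (a * c)\<^sup>2"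
      by (intro add_left_mono mult_left_mono power_mono *(2)) auto
    also have "\<dots> = a\<^sup>2 * (d\<^sup>2 * a\<^sup>2 - (1 + d ^ 4) * s\<^sup>2 + d\<^sup>2 * c\<^sup>2)"
      by (simp add: power_mult_distrib algebra_simps)
    finally show ?thesis using False by (simp add: zero_le_mult_iff)
  qed
  have "((1 + d\<^sup>2) * s)\<^sup>2 \<le> d\<^sup>2 * (a\<^sup>2 + 2 * s\<^sup>2 + c\<^sup>2)"
    using key by (simp add: power2_eq_square power4_eq_xxxx algebra_simps)
  also have "\<dots> = (d * vnorm (w + transpose_mat D *\<^sub>v (D *\<^sub>v w)))\<^sup>2"
    using *(1) by (simp add: power_mult_distrib)
  finally have "(1 + d\<^sup>2) * s \<le> d * vnorm (w + transpose_mat D *\<^sub>v (D *\<^sub>v w))"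
    by (rule power2_le_imp_le) (use d in \<open>simp add: vnorm_nonneg\<close>)
  moreover have "0 < 1 + d\<^sup>2" by (simp add: add_pos_nonneg)
  ultimately show ?thesis
    by (simp add: s_def d_def pos_le_divide_eq mult.commute)
qed

context
  fixes D G :: "real mat" and r k :: nat
  assumes D: "D \<in> carrier_mat r k"
    and G_def: "G = minv (1\<^sub>m k + transpose_mat D * D)"
begin

lemma gram_resolvent_carrier: "G \<in> carrier_mat k k"
  unfolding G_def by (rule minv_gram_plus_one(1)[OF D])

lemma gram_resolvent_unique:
  assumes w: "w \<in> carrier_vec k" and eq: "w + transpose_mat D *\<^sub>v (D *\<^sub>v w) = x"
  shows "w = G *\<^sub>v x"
proof -
  have H: "1\<^sub>m k + transpose_mat D * D \<in> carrier_mat k k" using D by auto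
  have "x = (1\<^sub>m k + transpose_mat D * D) *\<^sub>v w"
    unfolding eq[symmetric] using D w by (simp add: add_mult_distrib_mat_vec[of _ k k])
  hence "G *\<^sub>v x = (G * (1\<^sub>m k + transpose_mat D * D)) *\<^sub>v w"
    using assoc_mult_mat_vec[OF gram_resolvent_carrier H w] by simp
  thus ?thesis using minv_gram_plus_one(2)[OF D] w by (simp add: G_def)
qed

lemma gram_resolvent_solves:
  assumes x: "x \<in> carrier_vec k"
  shows "G *\<^sub>v x + transpose_mat D *\<^sub>v (D *\<^sub>v (G *\<^sub>v x)) = x"
proof -
  have H: "1\<^sub>m k + transpose_mat D * D \<in> carrier_mat k k" using D by auto
  have Gx: "G *\<^sub>v x \<in> carrier_vec k" using gram_resolvent_carrier x by simp
  have "x = ((1\<^sub>m k + transpose_mat D * D) * G) *\<^sub>v x"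
    using minv_gram_plus_one(3)[OF D] x by (simp add: G_def)
  also have "\<dots> = (1\<^sub>m k + transpose_mat D * D) *\<^sub>v (G *\<^sub>v x)"
    by (rule assoc_mult_mat_vec[OF H gram_resolvent_carrier x])
  also have "\<dots> = G *\<^sub>v x + transpose_mat D *\<^sub>v (D *\<^sub>v (G *\<^sub>v x))"
    using D Gx by (simp add: add_mult_distrib_mat_vec[of _ k k])
  finally show ?thesis by simp
qed

context
  fixes S :: "real mat"
  assumes S: "S \<in> carrier_mat k k"
begin

text \<open>The products \<open>S G D\<^sup>T\<close> and \<open>S G D\<^sup>T D\<close>, with \<open>S = \<Sigma>\<^sub>k\<close> and \<open>D = \<Delta>\<^sub>k\<close>, are the two blocks in the definition
of \<open>\<eta>\<^sub>k\<close>.\<close>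

lemma SGDt_mult_vec: "v \<in> carrier_vec r \<Longrightarrow> (S * G * transpose_mat D) *\<^sub>v v = S *\<^sub>v (G *\<^sub>v (transpose_mat D *\<^sub>v v))"
  using D S gram_resolvent_carrier
  by (simp add: assoc_mult_mat_vec[OF mult_carrier_mat[OF S gram_resolvent_carrier]]
      assoc_mult_mat_vec[OF S gram_resolvent_carrier] del: assoc_mult_mat)

lemma SGDtD_mult_vec:
  "v \<in> carrier_vec k \<Longrightarrow> (S * G * transpose_mat D * D) *\<^sub>v v = S *\<^sub>v (G *\<^sub>v (transpose_mat D *\<^sub>v (D *\<^sub>v v)))"
  using assoc_mult_mat_vec[OF mult_carrier_mat[OF mult_carrier_mat[OF S gram_resolvent_carrier] transpose_carrier_mat[THEN iffD2, OF D]] D]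
    SGDt_mult_vec[of "D *\<^sub>v v"] D by simp

lemma SGDt_dims: "dim_col (S * G * transpose_mat D) = r" "dim_col (S * G * transpose_mat D * D) = k"
  using D by auto

context
  fixes F :: real
  assumes F0: "0 \<le> F"
    and F: "\<And>v. v \<in> carrier_vec r \<Longrightarrow> vnorm (S *\<^sub>v (transpose_mat D *\<^sub>v v)) \<le> F * vnorm v"
begin

text \<open>The push-through identity \<open>G D\<^sup>T = D\<^sup>T (1 + D D\<^sup>T)\<^sup>-\<^sup>1\<close> moves the resolvent to the right, where it is a
contraction. The vector \<open>v\<close> in the proof is this second resolvent applied to \<open>y\<close>.\<close>

lemma opnorm_SGDt_le: "opnorm (S * G * transpose_mat D) \<le> F"
proof (rule opnorm_leI)
  fix y assume "y \<in> carrier_vec (dim_col (S * G * transpose_mat D))" and y1: "vnorm y \<le> 1"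
  hence y: "y \<in> carrier_vec r" by (simp only: SGDt_dims)
  define w where "w = G *\<^sub>v (transpose_mat D *\<^sub>v y)"
  have Dty: "transpose_mat D *\<^sub>v y \<in> carrier_vec k" using D y by simp
  have w: "w \<in> carrier_vec k" using gram_resolvent_carrier Dty by (simp add: w_def)
  have Dw: "D *\<^sub>v w \<in> carrier_vec r" using D w by simp
  define v where "v = y - D *\<^sub>v w"
  have v: "v \<in> carrier_vec r" using y Dw by (simp add: v_def)
  have "w + transpose_mat D *\<^sub>v (D *\<^sub>v w) = transpose_mat D *\<^sub>v y"
    unfolding w_def by (rule gram_resolvent_solves[OF Dty])
  moreover have "transpose_mat D *\<^sub>v v = transpose_mat D *\<^sub>v y - transpose_mat D *\<^sub>v (D *\<^sub>v w)"
    unfolding v_def using D y Dw by (simp add: mult_minus_distrib_mat_vec[of _ k r])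
  moreover have "w = (w + transpose_mat D *\<^sub>v (D *\<^sub>v w)) - transpose_mat D *\<^sub>v (D *\<^sub>v w)"
    using w D by (auto intro!: eq_vecI)
  ultimately have wv: "w = transpose_mat D *\<^sub>v v" by simp
  have yv: "y = v + transpose_mat (transpose_mat D) *\<^sub>v (transpose_mat D *\<^sub>v v)"
    unfolding wv[symmetric] transpose_transpose using y Dw D by (auto simp: v_def intro!: eq_vecI)
  have "(vnorm v)\<^sup>2 \<le> (vnorm y)\<^sup>2"
    using gram_resolvent_norm(1)[of "transpose_mat D" k r v] D v yv by simp
  hence vy: "vnorm v \<le> vnorm y" by (rule power2_le_imp_le) (rule vnorm_nonneg)
  have "vnorm ((S * G * transpose_mat D) *\<^sub>v y) = vnorm (S *\<^sub>v (transpose_mat D *\<^sub>v v))"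
    by (simp add: SGDt_mult_vec[OF y] w_def[symmetric] wv[symmetric])
  also have "\<dots> \<le> F * vnorm v" by (rule F[OF v])
  also have "\<dots> \<le> F * 1" using vy y1 F0 by (intro mult_left_mono) auto
  finally show "vnorm ((S * G * transpose_mat D) *\<^sub>v y) \<le> F" by simp
qed

text \<open>The resolvent commutes with \<open>D\<^sup>T D\<close>, so \<open>S G D\<^sup>T D = (S D\<^sup>T) (D G)\<close>.\<close>

lemma opnorm_SGDtD_le:
  assumes t0: "0 \<le> t"
    and t: "\<And>w. w \<in> carrier_vec k \<Longrightarrow> vnorm (D *\<^sub>v w) \<le> t * vnorm (w + transpose_mat D *\<^sub>v (D *\<^sub>v w))"
  shows "opnorm (S * G * transpose_mat D * D) \<le> F * t"
proof (rule opnorm_leI)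
  fix x assume "x \<in> carrier_vec (dim_col (S * G * transpose_mat D * D))" and x1: "vnorm x \<le> 1"
  hence x: "x \<in> carrier_vec k" by (simp only: SGDt_dims)
  define w where "w = G *\<^sub>v x"
  define z where "z = transpose_mat D *\<^sub>v (D *\<^sub>v w)"
  have w: "w \<in> carrier_vec k" using gram_resolvent_carrier x by (simp add: w_def)
  have Dw: "D *\<^sub>v w \<in> carrier_vec r" and z: "z \<in> carrier_vec k" using D w by (auto simp: z_def)
  have wz: "w + z = x" unfolding w_def z_def by (rule gram_resolvent_solves[OF x])
  have "z + transpose_mat D *\<^sub>v (D *\<^sub>v z) = transpose_mat D *\<^sub>v (D *\<^sub>v x)"
    unfolding wz[symmetric] using D w z Dw
    by (simp add: mult_add_distrib_mat_vec[of _ r k] mult_add_distrib_mat_vec[of _ k r] z_def[symmetric])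
  hence "z = G *\<^sub>v (transpose_mat D *\<^sub>v (D *\<^sub>v x))" by (rule gram_resolvent_unique[OF z])
  hence "vnorm ((S * G * transpose_mat D * D) *\<^sub>v x) = vnorm (S *\<^sub>v (transpose_mat D *\<^sub>v (D *\<^sub>v w)))"
    by (simp only: SGDtD_mult_vec[OF x] z_def)
  also have "\<dots> \<le> F * vnorm (D *\<^sub>v w)" by (rule F[OF Dw])
  also have "\<dots> \<le> F * (t * vnorm x)"
    using t[OF w] F0 by (intro mult_left_mono) (simp_all add: wz z_def[symmetric])
  also have "\<dots> \<le> F * (t * 1)" using x1 F0 t0 by (intro mult_left_mono) auto
  finally show "vnorm ((S * G * transpose_mat D * D) *\<^sub>v x) \<le> F * t" by simp
qed

lemma sqrt_opnorms_le:
  assumes t0: "0 \<le> t"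
    and t: "\<And>w. w \<in> carrier_vec k \<Longrightarrow> vnorm (D *\<^sub>v w) \<le> t * vnorm (w + transpose_mat D *\<^sub>v (D *\<^sub>v w))"
  shows "sqrt ((opnorm (S * G * transpose_mat D * D))\<^sup>2 + (opnorm (S * G * transpose_mat D))\<^sup>2)
    \<le> sqrt (t\<^sup>2 + 1) * F"
proof -
  have "(opnorm (S * G * transpose_mat D * D))\<^sup>2 + (opnorm (S * G * transpose_mat D))\<^sup>2 \<le> (F * t)\<^sup>2 + F\<^sup>2"
    using opnorm_SGDtD_le[OF t0 t] opnorm_SGDt_le by (intro add_mono power_mono opnorm_nonneg) auto
  also have "\<dots> = (sqrt (t\<^sup>2 + 1) * F)\<^sup>2" by (simp add: power_mult_distrib algebra_simps)
  finally show ?thesis using F0 by (intro real_le_lsqrt) auto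
qed

end
end
end

section \<open>The upper bound for gamma\<close>

context lanczos_svd
begin

lemma Delta_eq:
  assumes "k < n"
  shows "Delta_mat n U \<sigma> b k =
    mat (n - k) k (\<lambda>(r, s). wgt (k + r) * poly (lagrange_poly node k s) (node (k + r)) / wgt s)"
proof -
  have e: "(\<lambda>i. (\<sigma> (Suc i))\<^sup>2) = node"
    by (auto simp: node_def)
  have nz: "\<sigma> (Suc i) * ucoef U b (Suc i) \<noteq> 0" if "i < k" for i
    using wgt_nonzero[of i] that assms by (simp add: wgt_def)
  show ?thesis
    using Delta_mat_eq[of k n \<sigma> U b, unfolded e, OF _ inj_node nz] assms by (simp add: wgt_def node_def)
qed

lemma Delta_carrier: "k < n \<Longrightarrow> Delta_mat n U \<sigma> b k \<in> carrier_mat (n - k) k"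
  by (simp add: Delta_eq)

lemma sum_split_at: "k \<le> n \<Longrightarrow> (\<Sum>i<n. f i) = (\<Sum>i<k. f i) + (\<Sum>r<n - k. f (k + r))" for f :: "nat \<Rightarrow> real"
proof -
  assume k: "k \<le> n"
  have "(\<Sum>i<n. f i) = (\<Sum>i<k. f i) + (\<Sum>i\<in>{k..<n}. f i)"
    using k by (subst sum.union_disjoint[symmetric]) (auto intro!: sum.cong)
  also have "(\<Sum>i\<in>{k..<n}. f i) = (\<Sum>r<n - k. f (k + r))"
    by (rule sum.reindex_bij_witness[of _ "\<lambda>r. k + r" "\<lambda>i. i - k"]) (use k in auto)
  finally show ?thesis .
qed

definition head :: "nat \<Rightarrow> real vec \<Rightarrow> real vec" where "head k x = vec k (coord x)"
definition tail :: "nat \<Rightarrow> real vec \<Rightarrow> real vec" where "tail k x = vec (n - k) (\<lambda>r. coord x (k + r))"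

lemma head_carrier: "head k x \<in> carrier_vec k" and tail_carrier: "tail k x \<in> carrier_vec (n - k)"
  by (simp_all add: head_def tail_def)

lemma vnorm_head_tail:
  "k < n \<Longrightarrow> x \<in> carrier_vec n \<Longrightarrow> (vnorm x)\<^sup>2 = (vnorm (head k x))\<^sup>2 + (vnorm (tail k x))\<^sup>2"
  by (subst vnorm_power2_coord) (simp_all add: sum_split_at[of k] vnorm_power2_sum head_def tail_def)

text \<open>The Krylov space is the graph of \<open>\<Delta>\<close>: row \<open>r\<close> of \<open>\<Delta>\<close> recovers \<open>g\<close> at the node \<open>k + r\<close> from its values at
the first \<open>k\<close> nodes.\<close>

lemma Delta_head_krylov:
  assumes k: "0 < k" "k < n" and x: "krylov (k - 1) x"
  shows "Delta_mat n U \<sigma> b k *\<^sub>v head k x = tail k x"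
proof (rule eq_vecI)
  fix r assume "r < dim_vec (tail k x)"
  hence r: "r < n - k" by (simp add: tail_def)
  obtain g where g: "degree g \<le> k - 1" "\<And>i. i < n \<Longrightarrow> coord x i = wgt i * poly g (node i)"
    using x by (auto simp: krylov_def)
  have "(Delta_mat n U \<sigma> b k *\<^sub>v head k x) $ r =
      (\<Sum>s<k. wgt (k + r) * poly (lagrange_poly node k s) (node (k + r)) / wgt s * (wgt s * poly g (node s)))"
    using r k g(2) by (simp add: Delta_eq head_def scalar_prod_def atLeast0LessThan)
  also have "\<dots> = wgt (k + r) * (\<Sum>s<k. poly g (node s) * poly (lagrange_poly node k s) (node (k + r)))"
    unfolding sum_distrib_left by (intro sum.cong refl) (use wgt_nonzero k in auto)
  also have "\<dots> = wgt (k + r) * poly g (node (k + r))"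
    using lagrange_interpolation[OF inj_node, of k g "node (k + r)"] k g(1) by simp
  also have "\<dots> = tail k x $ r" using r g(2) by (simp add: tail_def)
  finally show "(Delta_mat n U \<sigma> b k *\<^sub>v head k x) $ r = tail k x $ r" .
qed (use k Delta_carrier[of k] in \<open>auto simp: tail_def\<close>)

text \<open>The Lagrange polynomials span the polynomials of degree less than \<open>k\<close>, and testing orthogonality
against each of them is testing against the columns of \<open>1\<close> stacked on \<open>\<Delta>\<close>.\<close>

lemma head_orthogonal:
  assumes k: "0 < k" "k < n" and y: "y \<in> carrier_vec n" and orth: "\<And>j. j \<in> {1..k} \<Longrightarrow> y \<bullet> q j = 0"
  shows "head k y = - (transpose_mat (Delta_mat n U \<sigma> b k) *\<^sub>v tail k y)"
proof (rule eq_vecI)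
  fix s assume "s < dim_vec (- (transpose_mat (Delta_mat n U \<sigma> b k) *\<^sub>v tail k y))"
  hence s: "s < k" using k by (simp add: Delta_eq)
  let ?L = "lagrange_poly node k s"
  have "0 = (\<Sum>i<n. coord y i * (wgt i * poly ?L (node i)))"
    using orthogonal_to_krylov[OF y orth degree_lagrange_poly[OF s]] by simp
  also have "\<dots> = (\<Sum>i<k. coord y i * (wgt i * poly ?L (node i)))
      + (\<Sum>r<n - k. coord y (k + r) * (wgt (k + r) * poly ?L (node (k + r))))"
    by (rule sum_split_at) (use k in simp)
  also have "(\<Sum>i<k. coord y i * (wgt i * poly ?L (node i))) = (\<Sum>i<k. if i = s then coord y s * wgt s else 0)"
    using poly_lagrange_poly_node[OF inj_node s] k by (intro sum.cong) auto
  also have "\<dots> = coord y s * wgt s" using s by simp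
  also have "(\<Sum>r<n - k. coord y (k + r) * (wgt (k + r) * poly ?L (node (k + r)))) =
      wgt s * (transpose_mat (Delta_mat n U \<sigma> b k) *\<^sub>v tail k y) $ s"
    using s k wgt_nonzero[of s]
    by (simp add: Delta_eq tail_def scalar_prod_def atLeast0LessThan sum_distrib_left mult_ac)
  finally have "wgt s * (coord y s + (transpose_mat (Delta_mat n U \<sigma> b k) *\<^sub>v tail k y) $ s) = 0"
    by (simp add: algebra_simps)
  thus "head k y $ s = (- (transpose_mat (Delta_mat n U \<sigma> b k) *\<^sub>v tail k y)) $ s"
    using wgt_nonzero[of s] s k Delta_carrier[of k] by (simp add: head_def eq_neg_iff_add_eq_0)
qed (use k in \<open>simp add: head_def Delta_eq\<close>)

text \<open>Let \<open>x\<^sub>1, x\<^sub>2\<close> and \<open>y\<^sub>1, y\<^sub>2\<close> be the heads and tails of \<open>x\<close> and of its residual. From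
\<open>x\<^sub>2 - y\<^sub>2 = \<Delta> (x\<^sub>1 - y\<^sub>1)\<close> and \<open>y\<^sub>1 = - \<Delta>\<^sup>T y\<^sub>2\<close>, eliminating \<open>y\<^sub>2\<close> gives
\<open>(1 + \<Delta>\<^sup>T \<Delta>) y\<^sub>1 = \<Delta>\<^sup>T \<Delta> x\<^sub>1 - \<Delta>\<^sup>T x\<^sub>2\<close>.\<close>

lemma head_residual:
  fixes k :: nat
  defines "D \<equiv> Delta_mat n U \<sigma> b k"
  assumes k: "0 < k" "k < n" and x: "x \<in> carrier_vec n"
  defines "G \<equiv> minv (1\<^sub>m k + transpose_mat D * D)"
  shows "head k (residual k x) =
    G *\<^sub>v (transpose_mat D *\<^sub>v (D *\<^sub>v head k x)) - G *\<^sub>v (transpose_mat D *\<^sub>v tail k x)"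
proof -
  define y where "y = residual k x"
  have D: "D \<in> carrier_mat (n - k) k" unfolding D_def by (rule Delta_carrier[OF k(2)])
  have G: "G \<in> carrier_mat k k" unfolding G_def by (rule minv_gram_plus_one(1)[OF D])
  have y: "y \<in> carrier_vec n" unfolding y_def by (rule residual_carrier[OF x])
  let ?x1 = "head k x" and ?x2 = "tail k x" and ?y1 = "head k y" and ?y2 = "tail k y"
  note carr = head_carrier[of k x] tail_carrier[of k x] head_carrier[of k y] tail_carrier[of k y]
  define w where "w = transpose_mat (lanczos_Q A b k) *\<^sub>v x"
  have w: "w \<in> carrier_vec k" using lanczos_Q_carrier[of k] x by (simp add: w_def)
  have xy: "x - y = lanczos_Q A b k *\<^sub>v w"
    using x lanczos_Q_carrier[of k] by (auto simp: y_def residual_def w_def intro!: eq_vecI)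
  have hd: "head k (x - y) = ?x1 - ?y1" and tl: "tail k (x - y) = ?x2 - ?y2"
    using x y by (auto simp: head_def tail_def coord_diff intro!: eq_vecI)
  have "D *\<^sub>v head k (x - y) = tail k (x - y)"
    unfolding D_def xy by (rule Delta_head_krylov[OF k krylov_lanczos_Q_mult[OF w k(1)]])
  hence E1: "D *\<^sub>v ?x1 - D *\<^sub>v ?y1 = ?x2 - ?y2"
    using D carr by (simp add: hd tl mult_minus_distrib_mat_vec[of _ "n - k" k])
  have E2: "?y1 = - (transpose_mat D *\<^sub>v ?y2)"
    unfolding D_def by (rule head_orthogonal[OF k y]) (simp add: y_def residual_orthogonal[OF x])
  have Dx: "D *\<^sub>v ?x1 \<in> carrier_vec (n - k)" "D *\<^sub>v ?y1 \<in> carrier_vec (n - k)"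
    using D carr by auto
  have E1': "D *\<^sub>v ?y1 = (D *\<^sub>v ?x1 - ?x2) + ?y2"
    using arg_cong[OF E1, of "\<lambda>v. D *\<^sub>v ?x1 - v"] Dx carr by (auto intro!: eq_vecI simp: vec_eq_iff)
  have "transpose_mat D *\<^sub>v (D *\<^sub>v ?y1) =
      (transpose_mat D *\<^sub>v (D *\<^sub>v ?x1) - transpose_mat D *\<^sub>v ?x2) + transpose_mat D *\<^sub>v ?y2"
    unfolding E1' using D carr Dx
    by (simp add: mult_add_distrib_mat_vec[of _ k "n - k"] mult_minus_distrib_mat_vec[of _ k "n - k"])
  hence "?y1 + transpose_mat D *\<^sub>v (D *\<^sub>v ?y1) =
      transpose_mat D *\<^sub>v (D *\<^sub>v ?x1) - transpose_mat D *\<^sub>v ?x2"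
    using D by (subst E2) (auto intro!: eq_vecI)
  hence "?y1 = G *\<^sub>v (transpose_mat D *\<^sub>v (D *\<^sub>v ?x1) - transpose_mat D *\<^sub>v ?x2)"
    unfolding G_def by (rule gram_resolvent_unique[OF D refl carr(3)])
  also have "\<dots> = G *\<^sub>v (transpose_mat D *\<^sub>v (D *\<^sub>v ?x1)) - G *\<^sub>v (transpose_mat D *\<^sub>v ?x2)"
    using D G Dx carr by (intro mult_minus_distrib_mat_vec[of _ k k]) auto
  finally show ?thesis by (simp add: y_def)
qed

text \<open>Splitting \<open>\<parallel>A y\<parallel>\<^sup>2\<close> at \<open>k\<close>, the head is controlled by the formula above and the Cauchy-Schwarz
inequality, the tail by \<open>\<sigma> (k + 1)\<close> and \<open>\<parallel>y\<parallel> \<le> \<parallel>x\<parallel>\<close>.\<close>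

lemma gamma_le:
  assumes k: "0 < k" "k < n"
  shows "lanczos_gamma A b k \<le> sqrt (1 + (eta_num n U \<sigma> b k)\<^sup>2) * \<sigma> (Suc k)"
proof -
  define D where "D = Delta_mat n U \<sigma> b k"
  define S where "S = mat_diag k (\<lambda>i. \<sigma> (Suc i))"
  define G where "G = minv (1\<^sub>m k + transpose_mat D * D)"
  define a c where "a = opnorm (S * G * transpose_mat D * D)" and "c = opnorm (S * G * transpose_mat D)"
  have D: "D \<in> carrier_mat (n - k) k" unfolding D_def by (rule Delta_carrier[OF k(2)])
  have S: "S \<in> carrier_mat k k" by (simp add: S_def)
  have G: "G \<in> carrier_mat k k" unfolding G_def by (rule minv_gram_plus_one(1)[OF D])
  have sp: "0 < \<sigma> (Suc k)" using sigma_pos k by simp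
  have eta: "eta_num n U \<sigma> b k = sqrt (a\<^sup>2 + c\<^sup>2) / \<sigma> (Suc k)"
    by (simp add: eta_num_def Let_def a_def c_def S_def G_def D_def)
  have rhs: "sqrt (1 + (eta_num n U \<sigma> b k)\<^sup>2) * \<sigma> (Suc k) = sqrt ((\<sigma> (Suc k))\<^sup>2 + (a\<^sup>2 + c\<^sup>2))"
  proof -
    have "(sqrt (1 + (eta_num n U \<sigma> b k)\<^sup>2) * \<sigma> (Suc k))\<^sup>2 = (\<sigma> (Suc k))\<^sup>2 + (a\<^sup>2 + c\<^sup>2)"
      unfolding eta power_mult_distrib power_divide using sp
      by (simp add: add_nonneg_nonneg) (subst distrib_right, simp)
    thus ?thesis using sp by (metis real_sqrt_unique mult_nonneg_nonneg real_sqrt_ge_zero add_nonneg_nonneg zero_le_one zero_le_power2 less_imp_le)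
  qed
  show ?thesis unfolding rhs lanczos_gamma_def
  proof (rule opnorm_leI, unfold gamma_matrix_dim)
    fix x assume x: "x \<in> carrier_vec n" and x1: "vnorm x \<le> 1"
    define y where "y = residual k x"
    have y: "y \<in> carrier_vec n" unfolding y_def by (rule residual_carrier[OF x])
    note carr = head_carrier[of k x] tail_carrier[of k x]
    have v: "G *\<^sub>v (transpose_mat D *\<^sub>v (D *\<^sub>v head k x)) \<in> carrier_vec k"
      "G *\<^sub>v (transpose_mat D *\<^sub>v tail k x) \<in> carrier_vec k"
      using G D carr by (auto intro!: mult_mat_vec_carrier[of _ k k] mult_mat_vec_carrier[of _ k "n - k"])
    have Sy: "S *\<^sub>v head k y =
        (S * G * transpose_mat D * D) *\<^sub>v head k x - (S * G * transpose_mat D) *\<^sub>v tail k x"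
      unfolding SGDtD_mult_vec[OF D G_def S carr(1)] SGDt_mult_vec[OF D G_def S carr(2)]
        y_def head_residual[OF k x, folded D_def, folded G_def]
      by (rule mult_minus_distrib_mat_vec[OF S v])
    have SG: "(S * G * transpose_mat D * D) *\<^sub>v head k x \<in> carrier_vec k"
      "(S * G * transpose_mat D) *\<^sub>v tail k x \<in> carrier_vec k"
      by (simp_all only: carrier_vec_def mem_Collect_eq dim_mult_mat_vec index_mult_mat carrier_matD(1)[OF S])
    have "vnorm (S *\<^sub>v head k y) \<le> vnorm ((S * G * transpose_mat D * D) *\<^sub>v head k x)
        + vnorm ((S * G * transpose_mat D) *\<^sub>v tail k x)"
      unfolding Sy by (rule vnorm_triangle_diff[OF SG])
    also have "\<dots> \<le> a * vnorm (head k x) + c * vnorm (tail k x)"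
      unfolding a_def c_def
      by (intro add_mono vnorm_mult_vec_le_opnorm) (simp_all only: SGDt_dims[OF D G_def S] carr)
    finally have "(vnorm (S *\<^sub>v head k y))\<^sup>2 \<le> (a * vnorm (head k x) + c * vnorm (tail k x))\<^sup>2"
      by (intro power_mono vnorm_nonneg)
    also have "\<dots> \<le> (a\<^sup>2 + c\<^sup>2) * ((vnorm (head k x))\<^sup>2 + (vnorm (tail k x))\<^sup>2)"
    proof -
      have "0 \<le> (a * vnorm (tail k x) - c * vnorm (head k x))\<^sup>2" by simp
      thus ?thesis by (simp add: power2_eq_square algebra_simps)
    qed
    also have "\<dots> = (a\<^sup>2 + c\<^sup>2) * (vnorm x)\<^sup>2" using vnorm_head_tail[OF k(2) x] by simp
    also have "\<dots> \<le> (a\<^sup>2 + c\<^sup>2) * 1"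
      using x1 vnorm_nonneg[of x] by (intro mult_left_mono) (auto simp: power_le_one)
    finally have first: "(vnorm (S *\<^sub>v head k y))\<^sup>2 \<le> a\<^sup>2 + c\<^sup>2" by simp
    have Shead: "(vnorm (S *\<^sub>v head k y))\<^sup>2 = (\<Sum>i<k. (\<sigma> (Suc i) * coord y i)\<^sup>2)"
    proof -
      have "(S *\<^sub>v head k y) $ i = \<sigma> (Suc i) * coord y i" if i: "i < k" for i
      proof -
        have "(S *\<^sub>v head k y) $ i = (\<Sum>j<k. if i = j then \<sigma> (Suc i) * coord y i else 0)"
          using i by (simp add: S_def mat_diag_def head_def scalar_prod_def atLeast0LessThan
              if_distrib[of "\<lambda>x. x * _"] cong: if_cong)
        thus ?thesis using i by simp
      qed
      thus ?thesis using S by (simp add: vnorm_power2_sum)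
    qed
    have "(\<Sum>r<n - k. (\<sigma> (Suc (k + r)) * coord y (k + r))\<^sup>2) \<le> (\<Sum>r<n - k. (\<sigma> (Suc k))\<^sup>2 * (coord y (k + r))\<^sup>2)"
      unfolding power_mult_distrib
      by (intro sum_mono mult_right_mono power_mono) (use sigma_mono sigma_pos in \<open>auto simp: less_imp_le\<close>)
    also have "\<dots> = (\<sigma> (Suc k))\<^sup>2 * (vnorm (tail k y))\<^sup>2"
      by (simp add: vnorm_power2_sum tail_def sum_distrib_left)
    also have "\<dots> \<le> (\<sigma> (Suc k))\<^sup>2 * 1"
    proof (intro mult_left_mono)
      have "(vnorm (tail k y))\<^sup>2 \<le> (vnorm y)\<^sup>2" using vnorm_head_tail[OF k(2) y] by simp
      also have "\<dots> \<le> 1"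
        using residual_norm_le[OF x, of k] x1 vnorm_nonneg[of y] by (intro power_le_one) (auto simp: y_def)
      finally show "(vnorm (tail k y))\<^sup>2 \<le> 1" .
    qed simp
    finally have second: "(\<Sum>r<n - k. (\<sigma> (Suc (k + r)) * coord y (k + r))\<^sup>2) \<le> (\<sigma> (Suc k))\<^sup>2" by simp
    have "(vnorm (A *\<^sub>v y))\<^sup>2 = (vnorm (S *\<^sub>v head k y))\<^sup>2 + (\<Sum>r<n - k. (\<sigma> (Suc (k + r)) * coord y (k + r))\<^sup>2)"
      unfolding vnorm_A_power2[OF y] Shead using sum_split_at[of k] k by simp
    hence "(vnorm (A *\<^sub>v y))\<^sup>2 \<le> (\<sigma> (Suc k))\<^sup>2 + (a\<^sup>2 + c\<^sup>2)" using first second by simp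
    thus "vnorm ((A - lanczos_P A b (k + 1) * lanczos_B A b k * transpose_mat (lanczos_Q A b k)) *\<^sub>v x)
        \<le> sqrt ((\<sigma> (Suc k))\<^sup>2 + (a\<^sup>2 + c\<^sup>2))"
      unfolding gamma_matrix_mult[OF x] y_def[symmetric] by (rule real_le_rsqrt)
  qed
qed

section \<open>Reducing eta to two sums\<close>

text \<open>The absolute value at \<open>0\<close> of the Lagrange basis polynomial for the nodes \<open>(\<sigma> 1)\<^sup>2, \<dots>, (\<sigma> k)\<^sup>2\<close> that is \<open>1\<close> at
\<open>(\<sigma> j)\<^sup>2\<close>.\<close>

definition lagrange_at_zero :: "nat \<Rightarrow> nat \<Rightarrow> real" where
  "lagrange_at_zero k j = (\<Prod>i\<in>{1..k} - {j}. (\<sigma> i)\<^sup>2 / \<bar>(\<sigma> j)\<^sup>2 - (\<sigma> i)\<^sup>2\<bar>)"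

text \<open>A later node lies between \<open>0\<close> and every interpolation node, so each factor
\<open>\<bar>t - node l\<bar>\<close> is largest at \<open>t = 0\<close>.\<close>

lemma lagrange_poly_tail_le:
  assumes k: "k < n" and s: "s < k" and r: "r < n - k"
  shows "\<bar>poly (lagrange_poly node k s) (node (k + r))\<bar> \<le> lagrange_at_zero k (Suc s)"
proof -
  have kr: "k + r < n" using r by simp
  have "\<bar>poly (lagrange_poly node k s) (node (k + r))\<bar> =
      (\<Prod>l\<in>{..<k} - {s}. \<bar>node (k + r) - node l\<bar> / \<bar>node s - node l\<bar>)"
    by (simp add: poly_lagrange_poly abs_prod)
  also have "\<dots> \<le> (\<Prod>l\<in>{..<k} - {s}. node l / \<bar>node s - node l\<bar>)"
  proof (intro prod_mono conjI divide_right_mono)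
    fix l assume "l \<in> {..<k} - {s}"
    hence "node (k + r) \<le> node l" "0 \<le> node (k + r)"
      using sigma_mono[of l "k + r"] sigma_pos[of "k + r"] kr by (auto simp: node_def intro!: power_mono less_imp_le)
    thus "\<bar>node (k + r) - node l\<bar> \<le> node l" by simp
  qed auto
  also have "\<dots> = lagrange_at_zero k (Suc s)"
    unfolding lagrange_at_zero_def node_def
    by (rule prod.reindex_bij_witness[of _ "\<lambda>i. i - 1" Suc]) auto
  finally show ?thesis .
qed

lemma lagrange_at_zero_nonneg: "0 \<le> lagrange_at_zero k j"
  unfolding lagrange_at_zero_def by (intro prod_nonneg) auto

definition tail_energy :: "nat \<Rightarrow> real" where
  "tail_energy k = (\<Sum>j\<in>{k<..n}. (\<sigma> j * ucoef U b j)\<^sup>2)"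

definition lagrange_energy :: "nat \<Rightarrow> real" where
  "lagrange_energy k = (\<Sum>i\<in>{1..k}. (lagrange_at_zero k i / ucoef U b i)\<^sup>2)"

lemma Sigma_Delta_transpose_bound:
  assumes k: "k < n" and v: "v \<in> carrier_vec (n - k)"
  shows "vnorm (mat_diag k (\<lambda>i. \<sigma> (Suc i)) *\<^sub>v (transpose_mat (Delta_mat n U \<sigma> b k) *\<^sub>v v))
    \<le> sqrt (lagrange_energy k * tail_energy k) * vnorm v"
proof -
  define M where "M = mat_diag k (\<lambda>i. \<sigma> (Suc i)) * transpose_mat (Delta_mat n U \<sigma> b k)"
  define g where "g s = lagrange_at_zero k (Suc s) / \<bar>ucoef U b (Suc s)\<bar>" for s
  define h where "h r = \<sigma> (Suc (k + r)) * \<bar>ucoef U b (Suc (k + r))\<bar>" for r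
  have D: "transpose_mat (Delta_mat n U \<sigma> b k) \<in> carrier_mat k (n - k)"
    using Delta_carrier[OF k] by simp
  have M: "M \<in> carrier_mat k (n - k)" unfolding M_def by (rule mult_carrier_mat[OF mat_diag_dim D])
  have entry: "\<bar>M $$ (s, r)\<bar> \<le> g s * h r" if sr: "s < k" "r < n - k" for s r
  proof -
    have pos: "0 < \<sigma> (Suc s)" "0 < \<sigma> (Suc (k + r))" using sigma_pos sr k by auto
    have "M $$ (s, r) = \<sigma> (Suc s) * (wgt (k + r) * poly (lagrange_poly node k s) (node (k + r)) / wgt s)"
      unfolding M_def mat_diag_mult_left[OF D] using sr k by (simp add: Delta_eq)
    also have "\<bar>\<dots>\<bar> = \<bar>poly (lagrange_poly node k s) (node (k + r))\<bar> / \<bar>ucoef U b (Suc s)\<bar> * h r"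
      using pos by (simp add: wgt_def h_def abs_mult)
    also have "\<dots> \<le> g s * h r"
      unfolding g_def using lagrange_poly_tail_le[OF k sr] pos
      by (intro mult_right_mono divide_right_mono) (auto simp: h_def)
    finally show ?thesis .
  qed
  have "(\<Sum>s<k. (g s)\<^sup>2) = lagrange_energy k"
    unfolding lagrange_energy_def g_def
    by (rule sum.reindex_bij_witness[of _ "\<lambda>i. i - 1" Suc]) (auto simp: power_divide)
  moreover have "(\<Sum>r<n - k. (h r)\<^sup>2) = tail_energy k"
    unfolding tail_energy_def h_def
    by (rule sum.reindex_bij_witness[of _ "\<lambda>j. j - Suc k" "\<lambda>r. Suc (k + r)"]) (auto simp: power_mult_distrib)
  moreover have "mat_diag k (\<lambda>i. \<sigma> (Suc i)) *\<^sub>v (transpose_mat (Delta_mat n U \<sigma> b k) *\<^sub>v v) = M *\<^sub>v v"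
    unfolding M_def by (rule assoc_mult_mat_vec[OF mat_diag_dim D v, symmetric])
  ultimately show ?thesis
    using vnorm_mult_vec_rank_one[OF M entry v] by simp
qed

text \<open>If \<open>\<parallel>\<Delta>\<^sub>k\<parallel> \<ge> 1\<close>, the value is the one obtained from the bound \<open>1 / 2\<close>: \<open>(1 / 2)\<^sup>2 + 1 = 5 / 4\<close>.\<close>

definition xi :: "nat \<Rightarrow> real" where
  "xi k = (let d = opnorm (Delta_mat n U \<sigma> b k)
           in if d < 1 then sqrt ((d / (1 + d\<^sup>2))\<^sup>2 + 1) else sqrt 5 / 2)"

lemma xi_nonneg: "0 \<le> xi k"
  by (simp add: xi_def Let_def)

lemma eta_le_energy:
  assumes k: "k < n"
  shows "eta_num n U \<sigma> b k \<le> xi k * (sqrt (lagrange_energy k * tail_energy k) / \<sigma> (Suc k))"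
proof -
  define D where "D = Delta_mat n U \<sigma> b k"
  define S where "S = mat_diag k (\<lambda>i. \<sigma> (Suc i))"
  define G where "G = minv (1\<^sub>m k + transpose_mat D * D)"
  define F where "F = sqrt (lagrange_energy k * tail_energy k)"
  have D: "D \<in> carrier_mat (n - k) k" unfolding D_def by (rule Delta_carrier[OF k])
  have S: "S \<in> carrier_mat k k" by (simp add: S_def)
  have F0: "0 \<le> F"
    unfolding F_def lagrange_energy_def tail_energy_def by (simp add: sum_nonneg)
  have F: "vnorm (S *\<^sub>v (transpose_mat D *\<^sub>v v)) \<le> F * vnorm v" if "v \<in> carrier_vec (n - k)" for v
    unfolding S_def D_def F_def by (rule Sigma_Delta_transpose_bound[OF k that])
  note bound = sqrt_opnorms_le[OF D G_def S F0 F]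
  have "sqrt ((opnorm (S * G * transpose_mat D * D))\<^sup>2 + (opnorm (S * G * transpose_mat D))\<^sup>2) \<le> xi k * F"
  proof (cases "opnorm D < 1")
    case True
    have "xi k = sqrt ((opnorm D / (1 + (opnorm D)\<^sup>2))\<^sup>2 + 1)"
      using True by (simp add: xi_def Let_def D_def)
    thus ?thesis
      using bound[OF _ _ mult_vec_le_opnorm_gram_resolvent[OF D _ True]] opnorm_nonneg[of D]
      by (simp add: divide_nonneg_nonneg)
  next
    case False
    have t: "sqrt ((1 / 2)\<^sup>2 + 1) = xi k"
      using False by (simp add: xi_def Let_def D_def power2_eq_square real_sqrt_divide[of 5 4, simplified])
    show ?thesis
      using bound[of "1 / 2", OF _ _ mult_vec_le_half_gram_resolvent[OF D]] unfolding t by simp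
  qed
  moreover have "eta_num n U \<sigma> b k =
      sqrt ((opnorm (S * G * transpose_mat D * D))\<^sup>2 + (opnorm (S * G * transpose_mat D))\<^sup>2) / \<sigma> (Suc k)"
    by (simp add: eta_num_def Let_def S_def G_def D_def)
  ultimately show ?thesis
    using sigma_pos[OF k] by (simp add: F_def divide_right_mono)
qed

end

section \<open>Elementary sums and products\<close>

lemma geometric_sum_le:
  fixes a :: real
  assumes "0 \<le> a" "a \<le> 1 / 2"
  shows "(\<Sum>t<N. a ^ t) \<le> 1 + 2 * a"
proof (induction N)
  case (Suc N)
  have "(\<Sum>t<Suc N. a ^ t) = 1 + a * (\<Sum>t<N. a ^ t)"
    by (simp add: sum.lessThan_Suc_shift sum_distrib_left del: sum.lessThan_Suc)
  also have "\<dots> \<le> 1 + a * 2" using Suc assms by (intro add_left_mono mult_left_mono) auto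
  finally show ?case by simp
qed (use assms in simp)

text \<open>Weierstrass' product inequality; the upper bound is carried along for the induction.\<close>

lemma prod_one_minus_ge:
  fixes a :: "'i \<Rightarrow> real"
  assumes "finite I" "\<And>i. i \<in> I \<Longrightarrow> 0 \<le> a i \<and> a i \<le> 1"
  shows "1 - sum a I \<le> (\<Prod>i\<in>I. 1 - a i) \<and> (\<Prod>i\<in>I. 1 - a i) \<le> 1"
  using assms
proof (induction I rule: finite_induct)
  case (insert x I)
  let ?P = "\<Prod>i\<in>I. 1 - a i"
  have IH: "1 - sum a I \<le> ?P" "?P \<le> 1" and x: "0 \<le> a x" "a x \<le> 1" using insert by auto
  have P0: "0 \<le> ?P" using insert.prems by (intro prod_nonneg) auto
  have "a x * ?P \<le> a x * 1" using x IH by (intro mult_left_mono) auto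
  hence "1 - sum a (insert x I) \<le> (1 - a x) * ?P" using insert.hyps IH by (simp add: algebra_simps)
  moreover have "(1 - a x) * ?P \<le> 1 * 1" using x IH P0 by (intro mult_mono) auto
  ultimately show ?case using insert.hyps by simp
qed simp

text \<open>By the mean value theorem the right-hand side is \<open>z powr - (2 * \<alpha>)\<close> for some \<open>z\<close> between \<open>x\<close> and \<open>x + 1\<close>.
Summing over \<open>x\<close> telescopes, which is the comparison of the sum with an integral.\<close>

lemma powr_neg_le_telescope:
  fixes x \<alpha> :: real
  assumes x: "0 < x" and \<alpha>: "1 / 2 < \<alpha>"
  shows "(x + 1) powr (- (2 * \<alpha>)) \<le> (x powr (1 - 2 * \<alpha>) - (x + 1) powr (1 - 2 * \<alpha>)) / (2 * \<alpha> - 1)"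
proof -
  have "\<exists>z. x < z \<and> z < x + 1 \<and> (x + 1) powr (1 - 2 * \<alpha>) - x powr (1 - 2 * \<alpha>)
      = (x + 1 - x) * ((1 - 2 * \<alpha>) * z powr (1 - 2 * \<alpha> - 1))"
    by (rule MVT2, simp, rule has_real_derivative_powr, use x in simp)
  then obtain z where z: "x < z" "z < x + 1"
    "(x + 1) powr (1 - 2 * \<alpha>) - x powr (1 - 2 * \<alpha>) = (1 - 2 * \<alpha>) * z powr (- (2 * \<alpha>))" by auto
  have "(x + 1) powr (- (2 * \<alpha>)) \<le> z powr (- (2 * \<alpha>))"
    using z x \<alpha> by (intro powr_mono2') auto
  also have "\<dots> = (x powr (1 - 2 * \<alpha>) - (x + 1) powr (1 - 2 * \<alpha>)) / (2 * \<alpha> - 1)"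
    using z(3) \<alpha> by (simp add: field_simps)
  finally show ?thesis .
qed

lemma sum_powr_neg_le:
  assumes k: "1 \<le> k" and \<alpha>: "1 / 2 < \<alpha>"
  shows "(\<Sum>j\<in>{k<..n}. real j powr (- (2 * \<alpha>))) \<le> real k powr (1 - 2 * \<alpha>) / (2 * \<alpha> - 1)"
proof (cases "k \<le> n")
  case True
  have "(\<Sum>j\<in>{k<..n}. real j powr (- (2 * \<alpha>))) \<le>
      (real k powr (1 - 2 * \<alpha>) - real n powr (1 - 2 * \<alpha>)) / (2 * \<alpha> - 1)"
    using True
  proof (induction n rule: dec_induct)
    case (step n)
    have "{k<..Suc n} = insert (Suc n) {k<..n}" using step by auto
    hence "(\<Sum>j\<in>{k<..Suc n}. real j powr (- (2 * \<alpha>))) =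
        real (Suc n) powr (- (2 * \<alpha>)) + (\<Sum>j\<in>{k<..n}. real j powr (- (2 * \<alpha>)))" by simp
    also have "\<dots> \<le> (real n powr (1 - 2 * \<alpha>) - real (Suc n) powr (1 - 2 * \<alpha>)) / (2 * \<alpha> - 1)
        + (real k powr (1 - 2 * \<alpha>) - real n powr (1 - 2 * \<alpha>)) / (2 * \<alpha> - 1)"
      using powr_neg_le_telescope[of "real n" \<alpha>] step k \<alpha> by (intro add_mono) (auto simp: add.commute)
    finally show ?case by (simp add: diff_divide_distrib)
  qed simp
  also have "\<dots> \<le> real k powr (1 - 2 * \<alpha>) / (2 * \<alpha> - 1)"
    using \<alpha> by (intro divide_right_mono) auto
  finally show ?thesis .
qed (use \<alpha> in simp)

lemma powr_pos_le_telescope: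
  fixes x \<gamma> :: real
  assumes x: "0 < x" and \<gamma>: "0 \<le> \<gamma>"
  shows "x powr \<gamma> \<le> ((x + 1) powr (\<gamma> + 1) - x powr (\<gamma> + 1)) / (\<gamma> + 1)"
proof -
  have "\<exists>z. x < z \<and> z < x + 1 \<and> (x + 1) powr (\<gamma> + 1) - x powr (\<gamma> + 1)
      = (x + 1 - x) * ((\<gamma> + 1) * z powr (\<gamma> + 1 - 1))"
    by (rule MVT2, simp, rule has_real_derivative_powr, use x in simp)
  then obtain z where z: "x < z" "z < x + 1"
    "(x + 1) powr (\<gamma> + 1) - x powr (\<gamma> + 1) = (\<gamma> + 1) * z powr \<gamma>" by auto
  have "x powr \<gamma> \<le> z powr \<gamma>" using z x \<gamma> by (intro powr_mono2) auto
  also have "\<dots> = ((x + 1) powr (\<gamma> + 1) - x powr (\<gamma> + 1)) / (\<gamma> + 1)"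
    using z(3) \<gamma> by (simp add: field_simps)
  finally show ?thesis .
qed

lemma sum_powr_pos_le:
  assumes k: "1 \<le> k" and \<gamma>: "0 \<le> \<gamma>"
  shows "(\<Sum>i\<in>{1..<k}. real i powr \<gamma>) \<le> real k powr (\<gamma> + 1) / (\<gamma> + 1)"
  using k
proof (induction k rule: dec_induct)
  case (step k)
  have "(\<Sum>i\<in>{1..<Suc k}. real i powr \<gamma>) = (\<Sum>i\<in>{1..<k}. real i powr \<gamma>) + real k powr \<gamma>"
    using step by simp
  also have "\<dots> \<le> real k powr (\<gamma> + 1) / (\<gamma> + 1)
      + (real (Suc k) powr (\<gamma> + 1) - real k powr (\<gamma> + 1)) / (\<gamma> + 1)"
    using powr_pos_le_telescope[of "real k" \<gamma>] step \<gamma> by (intro add_mono) (auto simp: add.commute)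
  finally show ?case by (simp add: diff_divide_distrib)
qed (use \<gamma> in simp)

text \<open>All ratios are at most \<open>1\<close>, so the factor \<open>1 + \<beta>\<close> in the exponent may be dropped. The summand \<open>i = k\<close> is \<open>1\<close>;
the others are compared with the integral of \<open>t powr (2 * \<alpha>)\<close>.\<close>

lemma sum_ratio_powr_le:
  assumes k: "1 \<le> k" and \<alpha>: "0 \<le> \<alpha>" and \<beta>: "0 \<le> \<beta>"
  shows "(\<Sum>i\<in>{1..k}. ((real i / real k) powr (\<alpha> * (1 + \<beta>)))\<^sup>2) \<le> 1 + real k / (2 * \<alpha> + 1)"
proof -
  have "((real i / real k) powr (\<alpha> * (1 + \<beta>)))\<^sup>2 \<le> real i powr (2 * \<alpha>) / real k powr (2 * \<alpha>)"
    if i: "i \<in> {1..<k}" for i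
  proof -
    have "((real i / real k) powr (\<alpha> * (1 + \<beta>)))\<^sup>2 = (real i / real k) powr (2 * \<alpha> * (1 + \<beta>))"
      by (simp add: power2_eq_square powr_add[symmetric] algebra_simps)
    also have "\<dots> \<le> (real i / real k) powr (2 * \<alpha>)"
      using i \<alpha> \<beta> by (intro powr_mono') (auto simp: algebra_simps)
    finally show ?thesis by (simp add: powr_divide)
  qed
  hence "(\<Sum>i\<in>{1..<k}. ((real i / real k) powr (\<alpha> * (1 + \<beta>)))\<^sup>2) \<le>
      (\<Sum>i\<in>{1..<k}. real i powr (2 * \<alpha>) / real k powr (2 * \<alpha>))"
    by (rule sum_mono)
  also have "\<dots> = (\<Sum>i\<in>{1..<k}. real i powr (2 * \<alpha>)) / real k powr (2 * \<alpha>)"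
    by (simp add: sum_divide_distrib)
  also have "\<dots> \<le> (real k powr (2 * \<alpha> + 1) / (2 * \<alpha> + 1)) / real k powr (2 * \<alpha>)"
    using sum_powr_pos_le[OF k, of "2 * \<alpha>"] \<alpha> by (intro divide_right_mono) auto
  also have "\<dots> = real k / (2 * \<alpha> + 1)"
    using k by (simp add: powr_add)
  finally have "(\<Sum>i\<in>{1..<k}. ((real i / real k) powr (\<alpha> * (1 + \<beta>)))\<^sup>2) \<le> real k / (2 * \<alpha> + 1)" .
  moreover have "{1..k} = insert k {1..<k}" using k by auto
  ultimately show ?thesis using k by simp
qed

section \<open>Severely ill-posed problems\<close>

locale noisy_lanczos = lanczos_svd m n A U \<sigma> V b
  for m n :: nat and A U :: "real mat" and \<sigma> :: "nat \<Rightarrow> real" and V :: "real mat" and b :: "real vec" +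
  fixes \<beta> \<eta> :: real and k0 :: nat
  assumes noise: "noise_model n U \<sigma> \<beta> b \<eta> k0" and beta_nonneg: "0 \<le> \<beta>"
begin

abbreviation uc :: "nat \<Rightarrow> real" where "uc i \<equiv> \<bar>ucoef U b i\<bar>"

lemma uc_pos: "i \<in> {1..n} \<Longrightarrow> 0 < uc i"
  using ucoef_nonzero by auto

lemma sigma_pos': "i \<in> {1..n} \<Longrightarrow> 0 < \<sigma> i"
  using simple by (auto simp: simple_positive_def)

lemma uc_antimono: "i \<le> j \<Longrightarrow> 1 \<le> i \<Longrightarrow> j \<le> n \<Longrightarrow> uc j \<le> uc i"
proof (induction j rule: dec_induct)
  case (step j)
  have "uc (j + 1) \<le> uc j" using noise step by (auto simp: noise_model_def)
  thus ?case using step by simp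
qed simp

lemma tail_energy_le:
  assumes k: "k < n"
  shows "tail_energy k \<le> (uc (k + 1))\<^sup>2 * (\<Sum>j\<in>{k<..n}. (\<sigma> j)\<^sup>2)"
  unfolding tail_energy_def sum_distrib_left
proof (rule sum_mono)
  fix j assume j: "j \<in> {k<..n}"
  have "(uc j)\<^sup>2 * (\<sigma> j)\<^sup>2 \<le> (uc (k + 1))\<^sup>2 * (\<sigma> j)\<^sup>2"
    using uc_antimono[of "k + 1" j] j by (intro mult_right_mono power_mono) auto
  thus "(\<sigma> j * ucoef U b j)\<^sup>2 \<le> (uc (k + 1))\<^sup>2 * (\<sigma> j)\<^sup>2"
    by (simp add: power_mult_distrib mult.commute)
qed

lemma eta_le_of_energy_bound:
  assumes k: "k < n" and le: "lagrange_energy k * tail_energy k \<le> X\<^sup>2" and X: "0 \<le> X"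
  shows "eta_num n U \<sigma> b k \<le> xi k * (X / \<sigma> (k + 1))"
proof -
  have "sqrt (lagrange_energy k * tail_energy k) \<le> X" using le X by (intro real_le_lsqrt) auto
  hence "xi k * (sqrt (lagrange_energy k * tail_energy k) / \<sigma> (Suc k)) \<le> xi k * (X / \<sigma> (Suc k))"
    using xi_nonneg sigma_pos[OF k] by (intro mult_left_mono divide_right_mono) auto
  thus ?thesis using eta_le_energy[OF k] by simp
qed

context
  fixes C \<rho> c \<epsilon> :: real
  assumes severe: "severely_ill_posed c C \<rho> n \<sigma>" and rho: "1 < \<rho>" "4 * C \<le> \<rho>"
    and C_pos: "0 < C" and eps_def: "\<epsilon> = C\<^sup>2 / \<rho>\<^sup>2"
begin

lemma eps_bounds: "0 \<le> \<epsilon>" "\<epsilon> \<le> 1 / 16"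
proof -
  have "(4 * C)\<^sup>2 \<le> \<rho>\<^sup>2" using rho C_pos by (intro power_mono) auto
  thus "\<epsilon> \<le> 1 / 16" unfolding eps_def using rho by (simp add: power_mult_distrib field_simps)
qed (simp add: eps_def)

text \<open>The hypothesis for \<open>i = j\<close> gives \<open>C \<ge> 1\<close>, so \<open>C\<close> may be replaced by \<open>C ^ (j - i)\<close>. After
that the constants are absorbed in the single small quantity \<open>\<epsilon> = C\<^sup>2 / \<rho>\<^sup>2\<close>.\<close>

lemma sigma_ratio_power2_le:
  assumes "1 \<le> i" "i \<le> j" "j \<le> n"
  shows "(\<sigma> j)\<^sup>2 / (\<sigma> i)\<^sup>2 \<le> \<epsilon> ^ (j - i)"
proof (cases "i = j")
  case True
  thus ?thesis using sigma_pos'[of i] assms by simp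
next
  case False
  have pos: "0 < \<sigma> i" "0 < \<sigma> j" using sigma_pos' assms by auto
  have "\<sigma> i / \<sigma> i \<le> C / \<rho> ^ (i - i)"
    using severe[unfolded severely_ill_posed_def, rule_format, of i i] assms by linarith
  hence C1: "1 \<le> C" using pos by simp
  have "\<sigma> j / \<sigma> i \<le> C / \<rho> ^ (j - i)" using severe assms by (auto simp: severely_ill_posed_def)
  also have "\<dots> \<le> C ^ (j - i) / \<rho> ^ (j - i)"
    using False assms C1 rho by (intro divide_right_mono self_le_power) auto
  finally have "(\<sigma> j / \<sigma> i)\<^sup>2 \<le> ((C / \<rho>) ^ (j - i))\<^sup>2"
    using pos by (intro power_mono) (auto simp: power_divide)
  also have "\<dots> = ((C / \<rho>)\<^sup>2) ^ (j - i)" by (simp add: power_mult[symmetric] mult.commute)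
  finally show ?thesis by (simp add: eps_def power_divide)
qed

lemma sum_sigma_tail_le:
  assumes k: "k < n"
  shows "(\<Sum>j\<in>{k<..n}. (\<sigma> j)\<^sup>2) \<le> (\<sigma> (k + 1))\<^sup>2 * (1 + 2 * \<epsilon>)"
proof -
  have pos: "0 < \<sigma> (k + 1)" using sigma_pos[OF k] by simp
  have "(\<Sum>j\<in>{k<..n}. (\<sigma> j)\<^sup>2) \<le> (\<Sum>j\<in>{k<..n}. (\<sigma> (k + 1))\<^sup>2 * \<epsilon> ^ (j - (k + 1)))"
  proof (rule sum_mono)
    fix j assume "j \<in> {k<..n}"
    thus "(\<sigma> j)\<^sup>2 \<le> (\<sigma> (k + 1))\<^sup>2 * \<epsilon> ^ (j - (k + 1))"
      using sigma_ratio_power2_le[of "k + 1" j] pos by (simp add: pos_divide_le_eq mult.commute)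
  qed
  also have "\<dots> = (\<sigma> (k + 1))\<^sup>2 * (\<Sum>t<n - k. \<epsilon> ^ t)"
    unfolding sum_distrib_left
    by (rule sum.reindex_bij_witness[of _ "\<lambda>t. t + (k + 1)" "\<lambda>j. j - (k + 1)"]) auto
  also have "\<dots> \<le> (\<sigma> (k + 1))\<^sup>2 * (1 + 2 * \<epsilon>)"
    using eps_bounds by (intro mult_left_mono geometric_sum_le) auto
  finally show ?thesis .
qed

text \<open>The factors with \<open>l < i\<close> are \<open>1 / (1 - a l)\<close> with \<open>a l\<close> geometrically small, so their product is close to \<open>1\<close>.
Each of the \<open>k - i\<close> factors with \<open>l > i\<close> is itself \<open>O(\<epsilon>)\<close>.\<close>

lemma lagrange_at_zero_severe:
  assumes i: "1 \<le> i" "i \<le> k" and k: "k \<le> n"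
  shows "lagrange_at_zero k i \<le> (1 + 4 * \<epsilon>) * (2 * \<epsilon>) ^ (k - i)"
proof -
  define f where "f l = (\<sigma> l)\<^sup>2 / \<bar>(\<sigma> i)\<^sup>2 - (\<sigma> l)\<^sup>2\<bar>" for l
  note eps = eps_bounds
  have split: "{1..k} - {i} = {1..<i} \<union> {i<..k}" using i by auto
  have "lagrange_at_zero k i = prod f ({1..<i} \<union> {i<..k})"
    unfolding lagrange_at_zero_def f_def split by (rule refl)
  also have "\<dots> = prod f {1..<i} * prod f {i<..k}" by (rule prod.union_disjoint) auto
  also have "\<dots> \<le> (1 + 4 * \<epsilon>) * (2 * \<epsilon>) ^ (k - i)"
  proof (rule mult_mono)
    define a where "a l = (\<sigma> i)\<^sup>2 / (\<sigma> l)\<^sup>2" for l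
    have a: "0 \<le> a l \<and> a l \<le> \<epsilon> ^ (i - l)" if "l \<in> {1..<i}" for l
      using sigma_ratio_power2_le[of l i] that i k by (auto simp: a_def)
    have a1: "\<epsilon> ^ (i - l) \<le> \<epsilon>" if "l \<in> {1..<i}" for l
      using power_decreasing[of 1 "i - l" \<epsilon>] that eps by auto
    have "(\<Sum>l\<in>{1..<i}. a l) \<le> (\<Sum>l\<in>{1..<i}. \<epsilon> ^ (i - l))" using a by (intro sum_mono) auto
    also have "\<dots> = (\<Sum>t<i - 1. \<epsilon> * \<epsilon> ^ t)"
      by (rule sum.reindex_bij_witness[of _ "\<lambda>t. i - 1 - t" "\<lambda>l. i - 1 - l"])
        (auto simp: power_Suc[symmetric] Suc_diff_Suc simp del: power_Suc)
    also have "\<dots> = \<epsilon> * (\<Sum>t<i - 1. \<epsilon> ^ t)" by (simp add: sum_distrib_left)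
    also have "\<dots> \<le> \<epsilon> * (1 + 2 * \<epsilon>)" using eps by (intro mult_left_mono geometric_sum_le) auto
    also have "\<dots> \<le> \<epsilon> * 2" using eps by (intro mult_left_mono) auto
    finally have "1 - 2 * \<epsilon> \<le> 1 - sum a {1..<i}" by simp
    also have "\<dots> \<le> (\<Prod>l\<in>{1..<i}. 1 - a l)"
      using prod_one_minus_ge[of "{1..<i}" a] a a1 eps by fastforce
    finally have P: "1 - 2 * \<epsilon> \<le> (\<Prod>l\<in>{1..<i}. 1 - a l)" .
    have "f l = 1 / (1 - a l)" if l: "l \<in> {1..<i}" for l
    proof -
      have "0 < \<sigma> l" "0 < \<sigma> i" using sigma_pos' l i k by auto
      moreover have "a l < 1" using a[OF l] a1[OF l] eps by simp
      ultimately have "(\<sigma> i)\<^sup>2 < (\<sigma> l)\<^sup>2" "(\<sigma> l)\<^sup>2 \<noteq> 0" by (auto simp: a_def)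
      thus ?thesis by (simp add: f_def a_def field_simps)
    qed
    hence "prod f {1..<i} = 1 / (\<Prod>l\<in>{1..<i}. 1 - a l)" by (simp add: prod_dividef)
    also have "\<dots> \<le> 1 / (1 - 2 * \<epsilon>)" using P eps by (intro divide_left_mono) auto
    also have "\<dots> \<le> 1 + 4 * \<epsilon>"
    proof -
      have "\<epsilon> * (8 * \<epsilon>) \<le> \<epsilon> * 2" using eps by (intro mult_left_mono) auto
      thus ?thesis using eps by (simp add: divide_le_eq algebra_simps)
    qed
    finally show "prod f {1..<i} \<le> 1 + 4 * \<epsilon>" .
    have "f l \<le> 2 * \<epsilon>" if l: "l \<in> {i<..k}" for l
    proof -
      have pos: "0 < \<sigma> l" "0 < \<sigma> i" using sigma_pos' l i k by auto
      have "(\<sigma> l)\<^sup>2 / (\<sigma> i)\<^sup>2 \<le> \<epsilon> ^ (l - i)" using sigma_ratio_power2_le[of i l] l i k by auto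
      also have "\<dots> \<le> \<epsilon>" using power_decreasing[of 1 "l - i" \<epsilon>] l eps by auto
      finally have le: "(\<sigma> l)\<^sup>2 \<le> \<epsilon> * (\<sigma> i)\<^sup>2" using pos by (simp add: pos_divide_le_eq)
      also have "\<dots> \<le> 1 / 16 * (\<sigma> i)\<^sup>2" using eps by (intro mult_right_mono) auto
      finally have half: "(\<sigma> i)\<^sup>2 / 2 \<le> (\<sigma> i)\<^sup>2 - (\<sigma> l)\<^sup>2"
        using zero_le_power2[of "\<sigma> i"] by linarith
      have si: "0 < (\<sigma> i)\<^sup>2" using pos by simp
      have "0 \<le> (\<sigma> i)\<^sup>2 - (\<sigma> l)\<^sup>2" using half si by linarith
      hence "f l = (\<sigma> l)\<^sup>2 / ((\<sigma> i)\<^sup>2 - (\<sigma> l)\<^sup>2)" by (simp add: f_def)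
      also have "\<dots> \<le> (\<epsilon> * (\<sigma> i)\<^sup>2) / ((\<sigma> i)\<^sup>2 / 2)"
        using le half si eps by (intro frac_le) auto
      also have "\<dots> = 2 * \<epsilon>" using si by simp
      finally show ?thesis .
    qed
    hence "prod f {i<..k} \<le> (\<Prod>l\<in>{i<..k}. 2 * \<epsilon>)" by (intro prod_mono) (auto simp: f_def)
    thus "prod f {i<..k} \<le> (2 * \<epsilon>) ^ (k - i)" by simp
  qed (use eps in \<open>auto simp: f_def intro!: prod_nonneg\<close>)
  finally show ?thesis .
qed

text \<open>Only the summand \<open>i = k\<close> matters; the others decay geometrically even though the
coefficients of \<open>b\<close> enter only through their monotonicity.\<close>

lemma lagrange_energy_severe:
  assumes k: "1 \<le> k" "k \<le> n"
  shows "lagrange_energy k \<le> ((1 + 4 * \<epsilon>) / uc k)\<^sup>2 * (1 + 8 * \<epsilon>\<^sup>2)"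
proof -
  note eps = eps_bounds
  have "lagrange_energy k \<le> (\<Sum>i\<in>{1..k}. ((1 + 4 * \<epsilon>) / uc k)\<^sup>2 * (4 * \<epsilon>\<^sup>2) ^ (k - i))"
    unfolding lagrange_energy_def
  proof (rule sum_mono)
    fix i assume i: "i \<in> {1..k}"
    have "(lagrange_at_zero k i / ucoef U b i)\<^sup>2 = (lagrange_at_zero k i / uc i)\<^sup>2"
      by (simp add: power_divide)
    also have "\<dots> \<le> ((1 + 4 * \<epsilon>) * (2 * \<epsilon>) ^ (k - i) / uc k)\<^sup>2"
      using lagrange_at_zero_severe[of i k] lagrange_at_zero_nonneg[of k i] uc_antimono[of i k] uc_pos[of k] i k
      by (intro power_mono frac_le) auto
    also have "\<dots> = ((1 + 4 * \<epsilon>) / uc k)\<^sup>2 * ((2 * \<epsilon>)\<^sup>2) ^ (k - i)"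
      unfolding power_mult[symmetric] mult.commute[of 2]
      by (simp only: power_mult times_divide_eq_left power_divide power_mult_distrib[of "1 + 4 * \<epsilon>"])
    finally show "(lagrange_at_zero k i / ucoef U b i)\<^sup>2 \<le> ((1 + 4 * \<epsilon>) / uc k)\<^sup>2 * (4 * \<epsilon>\<^sup>2) ^ (k - i)"
      by (simp add: power_mult_distrib)
  qed
  also have "\<dots> = ((1 + 4 * \<epsilon>) / uc k)\<^sup>2 * (\<Sum>t<k. (4 * \<epsilon>\<^sup>2) ^ t)"
    unfolding sum_distrib_left
    by (rule sum.reindex_bij_witness[of _ "\<lambda>t. k - t" "\<lambda>i. k - i"]) auto
  also have "\<dots> \<le> ((1 + 4 * \<epsilon>) / uc k)\<^sup>2 * (1 + 2 * (4 * \<epsilon>\<^sup>2))"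
  proof (intro mult_left_mono geometric_sum_le)
    have "\<epsilon>\<^sup>2 \<le> (1 / 16)\<^sup>2" using eps by (intro power_mono) auto
    thus "4 * \<epsilon>\<^sup>2 \<le> 1 / 2" by (simp add: power2_eq_square)
  qed auto
  finally show ?thesis by simp
qed

lemma eta_severe:
  assumes k: "1 \<le> k" "k < n"
  shows "eta_num n U \<sigma> b k \<le> xi k * (uc (k + 1) / uc k) * (1 + 7 * \<epsilon>)"
proof -
  note eps = eps_bounds
  have pos: "0 < \<sigma> (k + 1)" using sigma_pos[OF k(2)] by simp
  define X where "X = \<sigma> (k + 1) * (uc (k + 1) / uc k) * (1 + 7 * \<epsilon>)"
  have "lagrange_energy k * tail_energy k \<le>
      (((1 + 4 * \<epsilon>) / uc k)\<^sup>2 * (1 + 8 * \<epsilon>\<^sup>2)) * ((uc (k + 1))\<^sup>2 * ((\<sigma> (k + 1))\<^sup>2 * (1 + 2 * \<epsilon>)))"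
  proof (rule mult_mono)
    show "lagrange_energy k \<le> ((1 + 4 * \<epsilon>) / uc k)\<^sup>2 * (1 + 8 * \<epsilon>\<^sup>2)"
      by (rule lagrange_energy_severe) (use k in auto)
    show "tail_energy k \<le> (uc (k + 1))\<^sup>2 * ((\<sigma> (k + 1))\<^sup>2 * (1 + 2 * \<epsilon>))"
      by (rule order_trans[OF tail_energy_le[OF k(2)] mult_left_mono[OF sum_sigma_tail_le[OF k(2)]]]) simp
    show "0 \<le> tail_energy k" by (simp add: tail_energy_def sum_nonneg)
  qed simp
  also have "\<dots> = (\<sigma> (k + 1) * (uc (k + 1) / uc k))\<^sup>2 * ((1 + 4 * \<epsilon>)\<^sup>2 * ((1 + 8 * \<epsilon>\<^sup>2) * (1 + 2 * \<epsilon>)))"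
    by (simp add: power_mult_distrib power_divide)
  also have "\<dots> \<le> (\<sigma> (k + 1) * (uc (k + 1) / uc k))\<^sup>2 * ((1 + 4 * \<epsilon>)\<^sup>2 * ((1 + 2 * \<epsilon>) * (1 + 2 * \<epsilon>)))"
  proof (intro mult_left_mono mult_right_mono)
    have "\<epsilon> * (8 * \<epsilon>) \<le> \<epsilon> * 2" using eps by (intro mult_left_mono) auto
    thus "1 + 8 * \<epsilon>\<^sup>2 \<le> 1 + 2 * \<epsilon>" by (simp add: power2_eq_square)
  qed (use eps in auto)
  also have "\<dots> = (\<sigma> (k + 1) * (uc (k + 1) / uc k))\<^sup>2 * ((1 + 4 * \<epsilon>) * (1 + 2 * \<epsilon>))\<^sup>2"
    by (simp add: power2_eq_square)
  also have "\<dots> \<le> (\<sigma> (k + 1) * (uc (k + 1) / uc k))\<^sup>2 * (1 + 7 * \<epsilon>)\<^sup>2"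
  proof (intro mult_left_mono power_mono)
    have "\<epsilon> * (8 * \<epsilon>) \<le> \<epsilon> * 1" using eps by (intro mult_left_mono) auto
    thus "(1 + 4 * \<epsilon>) * (1 + 2 * \<epsilon>) \<le> 1 + 7 * \<epsilon>" by (simp add: algebra_simps)
  qed (use eps in auto)
  also have "\<dots> = X\<^sup>2" by (simp only: X_def power_mult_distrib)
  finally have "eta_num n U \<sigma> b k \<le> xi k * (X / \<sigma> (k + 1))"
    by (rule eta_le_of_energy_bound[OF k(2)]) (use pos eps in \<open>simp add: X_def\<close>)
  also have "X / \<sigma> (k + 1) = uc (k + 1) / uc k * (1 + 7 * \<epsilon>)" using pos by (simp add: X_def)
  finally show ?thesis by (simp add: mult.assoc)
qed

end

section \<open>Moderately and mildly ill-posed problems\<close>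

lemma lagrange_at_zero_le_max:
  assumes "i \<in> {1..k}"
  shows "lagrange_at_zero k i \<le> lagrange_max \<sigma> k"
  unfolding lagrange_at_zero_def lagrange_max_def by (rule Max_ge) (use assms in auto)

context
  fixes \<zeta> \<alpha> :: real
  assumes poly: "polynomially_ill_posed \<zeta> \<alpha> n \<sigma>" and zeta: "0 < \<zeta>" and alpha: "1 / 2 < \<alpha>"
begin

lemma sigma_eq: "j \<in> {1..n} \<Longrightarrow> \<sigma> j = \<zeta> * real j powr (- \<alpha>)"
  using poly by (simp add: polynomially_ill_posed_def)

lemma sum_sigma_tail_poly:
  assumes k: "1 \<le> k" "k < n"
  shows "(\<Sum>j\<in>{k<..n}. (\<sigma> j)\<^sup>2) \<le> (\<sigma> k)\<^sup>2 * (real k / (2 * \<alpha> - 1))"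
proof -
  have sq: "(\<sigma> j)\<^sup>2 = \<zeta>\<^sup>2 * real j powr (- (2 * \<alpha>))" if "j \<in> {1..n}" for j
    using sigma_eq[OF that] by (simp add: power_mult_distrib power2_eq_square[of "_ powr _"] powr_add[symmetric])
  have "(\<Sum>j\<in>{k<..n}. (\<sigma> j)\<^sup>2) = \<zeta>\<^sup>2 * (\<Sum>j\<in>{k<..n}. real j powr (- (2 * \<alpha>)))"
    unfolding sum_distrib_left by (intro sum.cong) (auto simp: sq)
  also have "\<dots> \<le> \<zeta>\<^sup>2 * (real k powr (1 - 2 * \<alpha>) / (2 * \<alpha> - 1))"
    using alpha k by (intro mult_left_mono sum_powr_neg_le) auto
  also have "real k powr (1 - 2 * \<alpha>) = real k * real k powr (- (2 * \<alpha>))"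
    using k powr_add[of "real k" 1 "- (2 * \<alpha>)"] by simp
  also have "\<zeta>\<^sup>2 * (real k * real k powr (- (2 * \<alpha>)) / (2 * \<alpha> - 1)) = (\<sigma> k)\<^sup>2 * (real k / (2 * \<alpha> - 1))"
    using sq[of k] k by simp
  finally show ?thesis .
qed

text \<open>The three cases of the polynomial bound, including \<open>k = 1\<close> where \<open>lagrange_max\<close> is an empty product, differ
only in the estimate \<open>s\<close> for the sum of the squared coefficient ratios.\<close>

lemma eta_poly:
  assumes k: "1 \<le> k" "k < n" and s: "(\<Sum>i\<in>{1..k}. (uc k / uc i)\<^sup>2) \<le> s"
  shows "eta_num n U \<sigma> b k \<le> xi k * (\<sigma> k / \<sigma> (k + 1)) * (uc (k + 1) / uc k)
    * sqrt (s * (real k / (2 * \<alpha> - 1))) * lagrange_max \<sigma> k"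
proof -
  define L where "L = lagrange_max \<sigma> k"
  define X where "X = \<sigma> k * (uc (k + 1) / uc k) * sqrt (s * (real k / (2 * \<alpha> - 1))) * L"
  have L0: "0 \<le> L"
    using lagrange_at_zero_nonneg[of k 1] lagrange_at_zero_le_max[of 1 k] k by (auto simp: L_def)
  have s0: "0 \<le> s" using s by (rule order_trans[rotated]) (simp add: sum_nonneg)
  have pos: "0 < \<sigma> k" "0 < uc k" using sigma_pos' uc_pos k by auto
  have "lagrange_energy k \<le> (\<Sum>i\<in>{1..k}. (L / uc k)\<^sup>2 * (uc k / uc i)\<^sup>2)"
    unfolding lagrange_energy_def
  proof (rule sum_mono)
    fix i assume i: "i \<in> {1..k}"
    have "(lagrange_at_zero k i / ucoef U b i)\<^sup>2 = (lagrange_at_zero k i / uc i)\<^sup>2"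
      by (simp add: power_divide)
    also have "\<dots> \<le> (L / uc i)\<^sup>2"
      using lagrange_at_zero_le_max[OF i] lagrange_at_zero_nonneg[of k i]
      by (intro power_mono divide_right_mono divide_nonneg_nonneg) (auto simp: L_def)
    also have "\<dots> = (L / uc k)\<^sup>2 * (uc k / uc i)\<^sup>2" using pos by (simp add: power_divide)
    finally show "(lagrange_at_zero k i / ucoef U b i)\<^sup>2 \<le> (L / uc k)\<^sup>2 * (uc k / uc i)\<^sup>2" .
  qed
  also have "\<dots> \<le> (L / uc k)\<^sup>2 * s"
    unfolding sum_distrib_left[symmetric] by (intro mult_left_mono s) simp
  finally have le: "lagrange_energy k \<le> (L / uc k)\<^sup>2 * s" .
  have "lagrange_energy k * tail_energy k \<le>
      ((L / uc k)\<^sup>2 * s) * ((uc (k + 1))\<^sup>2 * ((\<sigma> k)\<^sup>2 * (real k / (2 * \<alpha> - 1))))"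
  proof (rule mult_mono[OF le])
    show "tail_energy k \<le> (uc (k + 1))\<^sup>2 * ((\<sigma> k)\<^sup>2 * (real k / (2 * \<alpha> - 1)))"
      by (rule order_trans[OF tail_energy_le[OF k(2)] mult_left_mono[OF sum_sigma_tail_poly[OF k]]]) simp
    show "0 \<le> tail_energy k" by (simp add: tail_energy_def sum_nonneg)
  qed (use s0 in simp)
  also have "\<dots> = X\<^sup>2"
    using s0 alpha by (simp add: X_def power_mult_distrib power_divide mult_ac)
  finally have "eta_num n U \<sigma> b k \<le> xi k * (X / \<sigma> (k + 1))"
    by (rule eta_le_of_energy_bound[OF k(2)]) (use pos L0 s0 alpha in \<open>simp add: X_def\<close>)
  thus ?thesis by (simp add: X_def L_def mult_ac)
qed

text \<open>Up to the transition index the coefficient of index \<open>i\<close> is \<open>\<sigma> i powr (1 + \<beta>)\<close>, that is, proportional to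
\<open>i powr - (\<alpha> * (1 + \<beta>))\<close>.\<close>

lemma picard_ratio_sum_le:
  assumes k: "1 \<le> k" "k \<le> k0"
  shows "(\<Sum>i\<in>{1..k}. (uc k / uc i)\<^sup>2) \<le> 1 + real k / (2 * \<alpha> + 1)"
proof -
  have k0n: "k0 < n" using noise by (simp add: noise_model_def)
  have "uc k / uc i = (real i / real k) powr (\<alpha> * (1 + \<beta>))" if i: "i \<in> {1..k}" for i
  proof -
    have uc: "uc j = (\<zeta> powr (1 + \<beta>)) * real j powr (- (\<alpha> * (1 + \<beta>)))" if "j \<in> {1..k}" for j
    proof -
      have "uc j = \<sigma> j powr (1 + \<beta>)" using noise that k by (auto simp: noise_model_def)
      also have "\<dots> = (\<zeta> * real j powr (- \<alpha>)) powr (1 + \<beta>)" using sigma_eq[of j] that k k0n by simp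
      also have "\<dots> = (\<zeta> powr (1 + \<beta>)) * real j powr (- (\<alpha> * (1 + \<beta>)))"
        using zeta by (simp add: powr_mult powr_powr)
      finally show ?thesis .
    qed
    have "uc k / uc i = real k powr (- (\<alpha> * (1 + \<beta>))) / real i powr (- (\<alpha> * (1 + \<beta>)))"
      using uc[of i] uc[of k] i k zeta by simp
    also have "\<dots> = real i powr (\<alpha> * (1 + \<beta>)) / real k powr (\<alpha> * (1 + \<beta>))"
      by (simp only: powr_minus inverse_eq_divide) simp
    finally show ?thesis by (simp only: powr_divide)
  qed
  hence "(\<Sum>i\<in>{1..k}. (uc k / uc i)\<^sup>2) = (\<Sum>i\<in>{1..k}. ((real i / real k) powr (\<alpha> * (1 + \<beta>)))\<^sup>2)"
    by (intro sum.cong) auto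
  also have "\<dots> \<le> 1 + real k / (2 * \<alpha> + 1)"
    using sum_ratio_powr_le[OF k(1), of \<alpha> \<beta>] alpha beta_nonneg by simp
  finally show ?thesis .
qed

text \<open>Beyond the transition index the coefficients are constant, so each index \<open>i > k0\<close> contributes \<open>1\<close>.
For \<open>i \<le> k0\<close> the numerator is enlarged to the coefficient of index \<open>k0\<close>.\<close>

lemma noise_ratio_sum_le:
  assumes k: "k0 < k" "k < n"
  shows "(\<Sum>i\<in>{1..k}. (uc k / uc i)\<^sup>2) \<le> real k - real k0 + 1 + real k0 / (2 * \<alpha> + 1)"
proof -
  have k0: "1 \<le> k0" using noise by (simp add: noise_model_def)
  have split: "{1..k} = {1..k0} \<union> {k0<..k}" using k k0 by auto
  have "(\<Sum>i\<in>{1..k}. (uc k / uc i)\<^sup>2) = (\<Sum>i\<in>{1..k0}. (uc k / uc i)\<^sup>2) + (\<Sum>i\<in>{k0<..k}. (uc k / uc i)\<^sup>2)"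
    unfolding split by (rule sum.union_disjoint) auto
  also have "(\<Sum>i\<in>{1..k0}. (uc k / uc i)\<^sup>2) \<le> (\<Sum>i\<in>{1..k0}. (uc k0 / uc i)\<^sup>2)"
    using uc_antimono[of k0 k] k0 k by (intro sum_mono power_mono divide_right_mono) auto
  also have "\<dots> \<le> 1 + real k0 / (2 * \<alpha> + 1)" using picard_ratio_sum_le[OF k0] by simp
  also have "(\<Sum>i\<in>{k0<..k}. (uc k / uc i)\<^sup>2) = (\<Sum>i\<in>{k0<..k}. 1)"
    using noise k by (intro sum.cong) (auto simp: noise_model_def)
  also have "\<dots> = real k - real k0" using k by simp
  finally show ?thesis by simp
qed

end

lemma noise_ratio_one: "k0 < k \<Longrightarrow> k < n \<Longrightarrow> uc (k + 1) / uc k = 1"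
  using noise by (auto simp: noise_model_def)

end

section \<open>The accuracy of the rank-k approximation\<close>

theorem theorem6:
  fixes c C \<beta> :: real
  assumes "0 < c" and "c \<le> C" and "0 < \<beta>"
  shows "\<exists>K \<rho>0 :: real. \<forall>m n A U \<sigma> V b bhat e \<eta> k0.
    is_svd m n A U \<sigma> V \<and> simple_positive n \<sigma> \<and>
    b = bhat + e \<and> e \<in> carrier_vec m \<and>
    discrete_picard m n U \<sigma> \<beta> bhat \<and> noise_model n U \<sigma> \<beta> b \<eta> k0 \<longrightarrow>
    (\<forall>k\<in>{1..n - 1}.
      \<sigma> (k + 1) \<le> lanczos_gamma A b k \<and>
      lanczos_gamma A b k \<le> sqrt (1 + (eta_num n U \<sigma> b k)\<^sup>2) * \<sigma> (k + 1) \<and>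
      (\<exists>\<xi>.
        (opnorm (Delta_mat n U \<sigma> b k) < 1 \<longrightarrow>
          \<xi> = sqrt ((opnorm (Delta_mat n U \<sigma> b k) / (1 + (opnorm (Delta_mat n U \<sigma> b k))\<^sup>2))\<^sup>2 + 1)) \<and>
        (opnorm (Delta_mat n U \<sigma> b k) \<ge> 1 \<longrightarrow> \<xi> \<le> sqrt 5 / 2) \<and>
        (\<forall>\<rho>. 1 < \<rho> \<and> \<rho>0 \<le> \<rho> \<and> severely_ill_posed c C \<rho> n \<sigma> \<longrightarrow>
          (\<exists>r. \<bar>r\<bar> \<le> K / \<rho>\<^sup>2 \<and>
            (1 \<le> k \<and> k \<le> k0 \<longrightarrow>
              eta_num n U \<sigma> b k \<le> \<xi> * (\<bar>ucoef U b (k + 1)\<bar> / \<bar>ucoef U b k\<bar>) * (1 + r)) \<and>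
            (k0 < k \<and> k \<le> n - 1 \<longrightarrow>
              eta_num n U \<sigma> b k \<le> \<xi> * sqrt (real k - real k0 + 1) * (1 + r)))) \<and>
        (\<forall>\<zeta> \<alpha>. 0 < \<zeta> \<and> 1 / 2 < \<alpha> \<and> polynomially_ill_posed \<zeta> \<alpha> n \<sigma> \<longrightarrow>
          (k = 1 \<longrightarrow>
            eta_num n U \<sigma> b k \<le> \<xi> * (\<sigma> 1 / \<sigma> 2) * (\<bar>ucoef U b 2\<bar> / \<bar>ucoef U b 1\<bar>) *
              sqrt (1 / (2 * \<alpha> - 1))) \<and>
          (1 < k \<and> k \<le> k0 \<longrightarrow>
            eta_num n U \<sigma> b k \<le> \<xi> * (\<sigma> k / \<sigma> (k + 1)) * (\<bar>ucoef U b (k + 1)\<bar> / \<bar>ucoef U b k\<bar>) *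
              sqrt ((real k)\<^sup>2 / (4 * \<alpha>\<^sup>2 - 1) + real k / (2 * \<alpha> - 1)) * lagrange_max \<sigma> k) \<and>
          (k0 < k \<and> k \<le> n - 1 \<longrightarrow>
            eta_num n U \<sigma> b k \<le> \<xi> * (\<sigma> k / \<sigma> (k + 1)) *
              sqrt (real k * real k0 / (4 * \<alpha>\<^sup>2 - 1) + real k * (real k - real k0 + 1) / (2 * \<alpha> - 1)) *
              lagrange_max \<sigma> k))))"
  \<comment> \<open>\<open>4 * C \<le> \<rho>\<close> gives \<open>\<epsilon> = C\<^sup>2 / \<rho>\<^sup>2 \<le> 1 / 16\<close>, and then \<open>r = 7 * \<epsilon>\<close> serves in both severe cases\<close>
proof (rule exI[of _ "7 * C\<^sup>2"], rule exI[of _ "4 * C"], intro allI impI ballI, elim conjE, goal_cases)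
  case (1 m n A U \<sigma> V b bhat e \<eta> k0 k)
  have svd: "is_svd m n A U \<sigma> V" and simple: "simple_positive n \<sigma>"
    and b: "b = bhat + e" "e \<in> carrier_vec m" "discrete_picard m n U \<sigma> \<beta> bhat"
    and noise: "noise_model n U \<sigma> \<beta> b \<eta> k0" and k: "k \<in> {1..n - 1}" by fact+
  have nz: "ucoef U b i \<noteq> 0" if "i \<in> {1..n}" for i
  proof (cases "i \<le> k0")
    case True
    hence "\<bar>ucoef U b i\<bar> = \<sigma> i powr (1 + \<beta>)" using noise that by (auto simp: noise_model_def)
    moreover have "0 < \<sigma> i" using simple that by (auto simp: simple_positive_def)
    ultimately show ?thesis by auto
  next
    case False
    thus ?thesis using noise that by (auto simp: noise_model_def)
  qed
  interpret noisy_lanczos m n A U \<sigma> V b \<beta> \<eta> k0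
    by unfold_locales (use svd simple b noise nz assms in \<open>auto simp: discrete_picard_def\<close>)
  have k': "1 \<le> k" "k < n" using k by auto
  have k0: "1 \<le> k0" using noise by (simp add: noise_model_def)
  have lower: "\<sigma> (k + 1) \<le> lanczos_gamma A b k" using sigma_le_gamma[of k] k' by simp
  have upper: "lanczos_gamma A b k \<le> sqrt (1 + (eta_num n U \<sigma> b k)\<^sup>2) * \<sigma> (k + 1)"
    using gamma_le[of k] k' by simp
  have severe: "\<exists>r. \<bar>r\<bar> \<le> 7 * C\<^sup>2 / \<rho>\<^sup>2 \<and>
      (1 \<le> k \<and> k \<le> k0 \<longrightarrow> eta_num n U \<sigma> b k \<le> xi k * (uc (k + 1) / uc k) * (1 + r)) \<and>
      (k0 < k \<and> k \<le> n - 1 \<longrightarrow> eta_num n U \<sigma> b k \<le> xi k * sqrt (real k - real k0 + 1) * (1 + r))"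
    if rho: "1 < \<rho> \<and> 4 * C \<le> \<rho> \<and> severely_ill_posed c C \<rho> n \<sigma>" for \<rho>
  proof -
    define \<epsilon> where "\<epsilon> = C\<^sup>2 / \<rho>\<^sup>2"
    have eps: "0 \<le> \<epsilon>" by (simp add: \<epsilon>_def)
    have eta: "eta_num n U \<sigma> b k \<le> xi k * (uc (k + 1) / uc k) * (1 + 7 * \<epsilon>)"
      using eta_severe[OF _ _ _ _ \<epsilon>_def k'] rho assms by auto
    \<comment> \<open>past \<open>k0\<close> the coefficient ratio is \<open>1\<close>, and the square root is at least \<open>1\<close>\<close>
    have "eta_num n U \<sigma> b k \<le> xi k * sqrt (real k - real k0 + 1) * (1 + 7 * \<epsilon>)" if "k0 < k"
    proof -
      have "uc (k + 1) / uc k \<le> sqrt (real k - real k0 + 1)"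
        unfolding noise_ratio_one[OF that k'(2)] using that by simp
      hence "xi k * (uc (k + 1) / uc k) * (1 + 7 * \<epsilon>) \<le> xi k * sqrt (real k - real k0 + 1) * (1 + 7 * \<epsilon>)"
        using xi_nonneg[of k] eps by (intro mult_right_mono mult_left_mono) auto
      thus ?thesis using eta by simp
    qed
    thus ?thesis using eta eps by (intro exI[of _ "7 * \<epsilon>"]) (auto simp: \<epsilon>_def)
  qed
  have poly: "(k = 1 \<longrightarrow>
            eta_num n U \<sigma> b k \<le> xi k * (\<sigma> 1 / \<sigma> 2) * (uc 2 / uc 1) * sqrt (1 / (2 * \<alpha> - 1))) \<and>
          (1 < k \<and> k \<le> k0 \<longrightarrow>
            eta_num n U \<sigma> b k \<le> xi k * (\<sigma> k / \<sigma> (k + 1)) * (uc (k + 1) / uc k) *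
              sqrt ((real k)\<^sup>2 / (4 * \<alpha>\<^sup>2 - 1) + real k / (2 * \<alpha> - 1)) * lagrange_max \<sigma> k) \<and>
          (k0 < k \<and> k \<le> n - 1 \<longrightarrow>
            eta_num n U \<sigma> b k \<le> xi k * (\<sigma> k / \<sigma> (k + 1)) *
              sqrt (real k * real k0 / (4 * \<alpha>\<^sup>2 - 1) + real k * (real k - real k0 + 1) / (2 * \<alpha> - 1)) *
              lagrange_max \<sigma> k)"
    if p: "0 < \<zeta> \<and> 1 / 2 < \<alpha> \<and> polynomially_ill_posed \<zeta> \<alpha> n \<sigma>" for \<zeta> \<alpha>
  proof (intro conjI impI; (elim conjE)?)
    have p': "polynomially_ill_posed \<zeta> \<alpha> n \<sigma>" "0 < \<zeta>" "1 / 2 < \<alpha>" using p by auto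
    have fac: "4 * \<alpha>\<^sup>2 - 1 = (2 * \<alpha> + 1) * (2 * \<alpha> - 1)" by (simp add: power2_eq_square algebra_simps)
    have nz: "2 * \<alpha> + 1 \<noteq> 0" "2 * \<alpha> - 1 \<noteq> 0" using p' by auto
    note eta = eta_poly[OF p' k']
    show "eta_num n U \<sigma> b k \<le> xi k * (\<sigma> 1 / \<sigma> 2) * (uc 2 / uc 1) * sqrt (1 / (2 * \<alpha> - 1))" if k1: "k = 1"
    proof -
      have "(\<Sum>i\<in>{1..k}. (uc k / uc i)\<^sup>2) \<le> 1" using uc_pos[of 1] k' by (simp add: k1)
      moreover have "lagrange_max \<sigma> k = 1" by (simp add: lagrange_max_def k1)
      ultimately show ?thesis using eta[of 1] by (simp add: k1 numeral_2_eq_2)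
    qed
    show "eta_num n U \<sigma> b k \<le> xi k * (\<sigma> k / \<sigma> (k + 1)) * (uc (k + 1) / uc k) *
              sqrt ((real k)\<^sup>2 / (4 * \<alpha>\<^sup>2 - 1) + real k / (2 * \<alpha> - 1)) * lagrange_max \<sigma> k"
      if "k \<le> k0"
    proof -
      have "(1 + real k / (2 * \<alpha> + 1)) * (real k / (2 * \<alpha> - 1)) =
          (real k)\<^sup>2 / (4 * \<alpha>\<^sup>2 - 1) + real k / (2 * \<alpha> - 1)"
        unfolding fac distrib_right[of 1] using nz by (simp add: power2_eq_square mult.commute)
      thus ?thesis using eta[OF picard_ratio_sum_le[OF p' k'(1) that]] by simp
    qed
    show "eta_num n U \<sigma> b k \<le> xi k * (\<sigma> k / \<sigma> (k + 1)) *
              sqrt (real k * real k0 / (4 * \<alpha>\<^sup>2 - 1) + real k * (real k - real k0 + 1) / (2 * \<alpha> - 1)) *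
              lagrange_max \<sigma> k"
      if "k0 < k"
    proof -
      have e: "(real k - real k0 + 1 + real k0 / (2 * \<alpha> + 1)) * (real k / (2 * \<alpha> - 1)) =
          real k * real k0 / (4 * \<alpha>\<^sup>2 - 1) + real k * (real k - real k0 + 1) / (2 * \<alpha> - 1)"
        unfolding fac distrib_right[of "real k - real k0 + 1"] using nz by (simp add: mult.commute)
      show ?thesis
        using eta[OF noise_ratio_sum_le[OF p' that k'(2)]]
        unfolding e noise_ratio_one[OF that k'(2)] by simp
    qed
  qed
  show ?case
  proof (intro conjI exI[of _ "xi k"])
    show "opnorm (Delta_mat n U \<sigma> b k) < 1 \<longrightarrow>
        xi k = sqrt ((opnorm (Delta_mat n U \<sigma> b k) / (1 + (opnorm (Delta_mat n U \<sigma> b k))\<^sup>2))\<^sup>2 + 1)"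
      "1 \<le> opnorm (Delta_mat n U \<sigma> b k) \<longrightarrow> xi k \<le> sqrt 5 / 2"
      by (simp_all add: xi_def Let_def)
  qed (rule lower, rule upper, intro allI impI, rule severe, assumption,
      intro allI impI, rule poly, assumption)
qed

end
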